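(* Let $\Upsilon$ be a gain signed graph. An edge set $B\subseteq E$, regarded as a spanning subgraph, is a basis of $M(\Upsilon)$ if and only if: (I) if $\Upsilon$ is hyperbalanced: for each sign-balanced component $\Upsilon_i$ of $\Upsilon$, $B\cap E(\Upsilon_i)$ is a spanning tree of $\Upsilon_i$; for each sign-unbalanced component $\Upsilon_i$, $B\cap E(\Upsilon_i)$ is a spanning disjoint union of sign-unbalanced unicycles; and $B$ contains no loose edges; (II) if $\Upsilon$ is hyperfrustrated: $B$ is as in (I) except that exactly one of the following holds: $B$ has one edge component that is a non-neutral loose edge; or in one sign-balanced component $\Upsilon_i$ that is not a tree, $B\cap E(\Upsilon_i)$ is a spanning sign-balanced unicycle whose circle is not neutral; or in one sign-unbalanced component $\Upsilon_i$, one component $B_0$ of $B\cap E(\Upsilon_i)$ is a theta graph or a handcuff with at least one negative figure, possibly with attached trees, and the unique sign circuit in $B_0$ is non-neutral.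
   Context: Let $\mathbb{K}$ be a field of characteristic $\ne2$. A graph $\Gamma=(V,E)$ has vertex set $V=\{v_1,\dots,v_n\}$ and finite edge set $E$; edges are links (two ends at distinct vertices), loops (two ends at one vertex), half edges (one end) or loose edges (no ends); parallel edges allowed. A gain signed graph $\Upsilon=(\Gamma,\sigma,\varphi)$: $\sigma:E\to\{\pm1\}$ (half edges negative, loose edges positive); with an orientation $\tau$ (signs $\tau(v,e)\in\{\pm1\}$ on edge ends, $\tau(v,e)\tau(w,e)=-\sigma(e)$ for a link or loop with ends $v,w$) each edge has gain $\varphi(e)\in\mathbb{K}$, negated on reorientation. Neutral = gain $0$. Walk gain of $W=u_0e_1\cdots e_lu_l$: $\varphi(W)=-\sum_i\varphi(e_i)\sigma(W_{0,i-1})\tau(u_{i-1},e_i)$, $\sigma(W_{0,j})=\prod_{i\le j}\sigma(e_i)$. Ultrawalks may begin with a half edge $e_0$ at $u_0$ and/or end with a half edge $e_{l+1}$ at $u_l$; their gain adds $\tau(u_0,e_0)\varphi(e_0)$ and/or $-\varphi(e_{l+1})\sigma(W_{0,l})\tau(u_l,e_{l+1})$ to $\varphi(W_{0,l})$. Circles: connected 2-regular subgraphs, sign = product of edge signs; a negative figure is a negative circle or a half edge. A sign circuit is a positive circle, a loose edge, or a handcuff of two negative figures. Its gain: the edge gain for a loose edge; else $\varphi(W)$ for a circuit walk (once around a positive circle; for a handcuff with figures $C_1,C_2$, connecting path $P$ of length $\ge0$: around $C_1$, along $P$, around $C_2$, back along $P$ if both circles; from half edge $C_1$ along $P$, around $C_2$,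 back, ending with $C_1$ if $C_1$ half edge and $C_2$ circle; from one half edge along $P$ to the other if both half edges); well defined up to sign; neutral if $0$. An edge set (or $\Upsilon$, via $E$) is hyperbalanced if all sign circuits in it are neutral, hyperfrustrated otherwise; sign balanced if it has no negative circle and no half edge. Components: connected components (loose edges excluded); edge components of $B$: each loose edge and each non-trivial component of $(V,B)$. $M(\Upsilon)$: matroid on $E$ with rank $n-b_\Sigma(S)+\delta(S)$ ($b_\Sigma$ = number of sign-balanced components of $(V,S)$, $\delta=0$ if hyperbalanced, $1$ otherwise). A handcuff is two figures (circles or half edges) with at most one common vertex together with a path (length $0$ if they meet) joining them and meeting them only at its ends. A unicycle is a circle or half edge with trees attached; sign balanced if the circle is positive, sign unbalanced if it is a negative circle or half edge. A theta graph is the union of three internally disjoint paths between two vertices. For a component $\Upsilon_i$, $E(\Upsilon_i)$ is its edge set. *)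

theory Defs
  imports Complex_Main
begin

text \<open>
  The ends of an edge are the positions of the list \<open>ends G e\<close>: a link is \<open>[v, w]\<close> with
  \<open>v \<noteq> w\<close>, a loop is \<open>[v, v]\<close>, a half edge is \<open>[v]\<close> and a loose edge is \<open>[]\<close>.
  The sign \<open>\<tau>(v,e)\<close> is given per end, as \<open>orient G e i\<close>, because a loop has two ends at the
  same vertex.  The order of the list carries no meaning.  The record holds a reference
  orientation together with the gains with respect to it; reorienting an edge negates both its
  end signs and its gain, so that the products \<open>\<phi>(e) \<tau>(v,e)\<close> used below do not change.
\<close>

record ('v, 'e, 'k) gsgraph =
  verts :: "'v set"
  edges :: "'e set"
  ends :: "'e \<Rightarrow> 'v list"
  sign :: "'e \<Rightarrow> int"
  orient :: "'e \<Rightarrow> nat \<Rightarrow> int"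
  gain :: "'e \<Rightarrow> 'k"

definition ordinary_edge :: "('v, 'e, 'k) gsgraph \<Rightarrow> 'e \<Rightarrow> bool" where
  "ordinary_edge G e \<longleftrightarrow> length (ends G e) = 2"

definition half_edge :: "('v, 'e, 'k) gsgraph \<Rightarrow> 'e \<Rightarrow> bool" where
  "half_edge G e \<longleftrightarrow> length (ends G e) = 1"

definition loose_edge :: "('v, 'e, 'k) gsgraph \<Rightarrow> 'e \<Rightarrow> bool" where
  "loose_edge G e \<longleftrightarrow> ends G e = []"

definition gain_signed_graph :: "('v, 'e, 'k) gsgraph \<Rightarrow> bool" where
  "gain_signed_graph G \<longleftrightarrow>
     finite (verts G) \<and> finite (edges G) \<and>
     (\<forall>e\<in>edges G.
        (ordinary_edge G e \<or> half_edge G e \<or> loose_edge G e) \<and>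
        set (ends G e) \<subseteq> verts G \<and>
        sign G e \<in> {1, -1} \<and>
        (half_edge G e \<longrightarrow> sign G e = -1) \<and>
        (loose_edge G e \<longrightarrow> sign G e = 1) \<and>
        (\<forall>i<length (ends G e). orient G e i \<in> {1, -1}) \<and>
        (ordinary_edge G e \<longrightarrow> orient G e 0 * orient G e 1 = - sign G e))"

text \<open>
  A step \<open>(e, i)\<close> traverses the link or loop \<open>e\<close> from its end \<open>i\<close> to its end \<open>1 - i\<close>.
\<close>

fun walk :: "('v, 'e, 'k) gsgraph \<Rightarrow> 'e set \<Rightarrow> 'v \<Rightarrow> ('e \<times> nat) list \<Rightarrow> 'v \<Rightarrow> bool" where
  "walk G S u [] w \<longleftrightarrow> u = w"
| "walk G S u ((e, i) # p) w \<longleftrightarrow>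
     e \<in> S \<and> ordinary_edge G e \<and> i < 2 \<and> ends G e ! i = u \<and> walk G S (ends G e ! (1 - i)) p w"

definition walk_verts :: "('v, 'e, 'k) gsgraph \<Rightarrow> 'v \<Rightarrow> ('e \<times> nat) list \<Rightarrow> 'v list" where
  "walk_verts G u p = u # map (\<lambda>(e, i). ends G e ! (1 - i)) p"

definition walk_edges :: "('e \<times> nat) list \<Rightarrow> 'e set" where
  "walk_edges p = fst ` set p"

definition reverse_walk :: "('e \<times> nat) list \<Rightarrow> ('e \<times> nat) list" where
  "reverse_walk p = rev (map (\<lambda>(e, i). (e, 1 - i)) p)"

definition path :: "('v, 'e, 'k) gsgraph \<Rightarrow> 'e set \<Rightarrow> 'v \<Rightarrow> ('e \<times> nat) list \<Rightarrow> 'v \<Rightarrow> bool" where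
  "path G S u p w \<longleftrightarrow> walk G S u p w \<and> distinct (walk_verts G u p)"

definition walk_sign :: "('v, 'e, 'k) gsgraph \<Rightarrow> ('e \<times> nat) list \<Rightarrow> int" where
  "walk_sign G p = (\<Prod>(e, i)\<leftarrow>p. sign G e)"

definition walk_gain :: "('v, 'e, 'k::field) gsgraph \<Rightarrow> ('e \<times> nat) list \<Rightarrow> 'k" where
  "walk_gain G p =
     - (\<Sum>j<length p. gain G (fst (p ! j)) * of_int (walk_sign G (take j p))
                       * of_int (orient G (fst (p ! j)) (snd (p ! j))))"

text \<open>The only end of a half edge has index \<open>0\<close>.\<close>

definition ultrawalk_gain ::
  "('v, 'e, 'k::field) gsgraph \<Rightarrow> 'e option \<Rightarrow> ('e \<times> nat) list \<Rightarrow> 'e option \<Rightarrow> 'k" where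
  "ultrawalk_gain G a p b =
     (case a of None \<Rightarrow> 0 | Some e \<Rightarrow> of_int (orient G e 0) * gain G e)
     + walk_gain G p
     + (case b of None \<Rightarrow> 0
        | Some e \<Rightarrow> - (gain G e * of_int (walk_sign G p) * of_int (orient G e 0)))"

definition edge_verts :: "('v, 'e, 'k) gsgraph \<Rightarrow> 'e set \<Rightarrow> 'v set" where
  "edge_verts G S = (\<Union>e\<in>S. set (ends G e))"

text \<open>The vertex sets of the connected components of the graph \<open>(X, S)\<close>.\<close>

definition components :: "('v, 'e, 'k) gsgraph \<Rightarrow> 'v set \<Rightarrow> 'e set \<Rightarrow> 'v set set" where
  "components G X S = X // {(u, w). u \<in> X \<and> w \<in> X \<and> (\<exists>p. walk G S u p w)}"

text \<open>The edges of \<open>S\<close> that belong to a component with vertex set \<open>X\<close>; no loose edge does.\<close>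

definition edges_in :: "('v, 'e, 'k) gsgraph \<Rightarrow> 'e set \<Rightarrow> 'v set \<Rightarrow> 'e set" where
  "edges_in G S X = {e \<in> S. \<not> loose_edge G e \<and> set (ends G e) \<subseteq> X}"

definition connected_graph :: "('v, 'e, 'k) gsgraph \<Rightarrow> 'v set \<Rightarrow> 'e set \<Rightarrow> bool" where
  "connected_graph G X S \<longleftrightarrow> (\<forall>u\<in>X. \<forall>w\<in>X. \<exists>p. walk G S u p w)"

definition degree :: "('v, 'e, 'k) gsgraph \<Rightarrow> 'e set \<Rightarrow> 'v \<Rightarrow> nat" where
  "degree G S v = (\<Sum>e\<in>S. count_list (ends G e) v)"

text \<open>
  Circles consist of links and loops only.  Without this condition a path with a half edge at
  each end would be connected and 2-regular.
\<close>

definition circle :: "('v, 'e, 'k) gsgraph \<Rightarrow> 'e set \<Rightarrow> bool" where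
  "circle G C \<longleftrightarrow>
     C \<noteq> {} \<and> C \<subseteq> edges G \<and> (\<forall>e\<in>C. ordinary_edge G e) \<and>
     connected_graph G (edge_verts G C) C \<and> (\<forall>v\<in>edge_verts G C. degree G C v = 2)"

definition positive_circle :: "('v, 'e, 'k) gsgraph \<Rightarrow> 'e set \<Rightarrow> bool" where
  "positive_circle G C \<longleftrightarrow> circle G C \<and> (\<Prod>e\<in>C. sign G e) = 1"

definition negative_circle :: "('v, 'e, 'k) gsgraph \<Rightarrow> 'e set \<Rightarrow> bool" where
  "negative_circle G C \<longleftrightarrow> circle G C \<and> (\<Prod>e\<in>C. sign G e) = -1"

definition half_edge_figure :: "('v, 'e, 'k) gsgraph \<Rightarrow> 'e set \<Rightarrow> bool" where
  "half_edge_figure G F \<longleftrightarrow> (\<exists>e\<in>edges G. half_edge G e \<and> F = {e})"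

definition figure :: "('v, 'e, 'k) gsgraph \<Rightarrow> 'e set \<Rightarrow> bool" where
  "figure G F \<longleftrightarrow> circle G F \<or> half_edge_figure G F"

definition negative_figure :: "('v, 'e, 'k) gsgraph \<Rightarrow> 'e set \<Rightarrow> bool" where
  "negative_figure G F \<longleftrightarrow> negative_circle G F \<or> half_edge_figure G F"

text \<open>
  The figures \<open>C1\<close>, \<open>C2\<close> and the path \<open>p\<close> from \<open>u\<close> in \<open>C1\<close> to \<open>w\<close> in \<open>C2\<close> form a handcuff.
  The condition \<open>C1 \<noteq> C2\<close> is not redundant: a loop or a half edge meets itself in one vertex.
\<close>

definition handcuff_parts ::
  "('v, 'e, 'k) gsgraph \<Rightarrow> 'e set \<Rightarrow> 'v \<Rightarrow> ('e \<times> nat) list \<Rightarrow> 'v \<Rightarrow> 'e set \<Rightarrow> bool" where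
  "handcuff_parts G C1 u p w C2 \<longleftrightarrow>
     figure G C1 \<and> figure G C2 \<and> C1 \<noteq> C2 \<and>
     card (edge_verts G C1 \<inter> edge_verts G C2) \<le> 1 \<and>
     path G (edges G) u p w \<and>
     set (walk_verts G u p) \<inter> edge_verts G C1 = {u} \<and>
     set (walk_verts G u p) \<inter> edge_verts G C2 = {w} \<and>
     (edge_verts G C1 \<inter> edge_verts G C2 \<noteq> {} \<longrightarrow> p = [])"

definition handcuff :: "('v, 'e, 'k) gsgraph \<Rightarrow> 'e set \<Rightarrow> bool" where
  "handcuff G H \<longleftrightarrow>
     (\<exists>C1 u p w C2. handcuff_parts G C1 u p w C2 \<and> H = C1 \<union> walk_edges p \<union> C2)"

text \<open>
  Edge-disjointness excludes using one and the same link as two of the three paths; in all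
  other cases it follows from internal disjointness.
\<close>

definition internally_disjoint ::
  "('v, 'e, 'k) gsgraph \<Rightarrow> 'v \<Rightarrow> 'v \<Rightarrow> ('e \<times> nat) list \<Rightarrow> ('e \<times> nat) list \<Rightarrow> bool" where
  "internally_disjoint G u w p q \<longleftrightarrow>
     set (walk_verts G u p) \<inter> set (walk_verts G u q) = {u, w} \<and>
     walk_edges p \<inter> walk_edges q = {}"

definition theta_graph :: "('v, 'e, 'k) gsgraph \<Rightarrow> 'e set \<Rightarrow> bool" where
  "theta_graph G H \<longleftrightarrow>
     (\<exists>u w p q r. u \<noteq> w \<and>
        path G (edges G) u p w \<and> path G (edges G) u q w \<and> path G (edges G) u r w \<and>
        internally_disjoint G u w p q \<and> internally_disjoint G u w p r \<and>
        internally_disjoint G u w q r \<and>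
        H = walk_edges p \<union> walk_edges q \<union> walk_edges r)"

definition sign_circuit :: "('v, 'e, 'k) gsgraph \<Rightarrow> 'e set \<Rightarrow> bool" where
  "sign_circuit G C \<longleftrightarrow>
     positive_circle G C \<or>
     (\<exists>e\<in>edges G. loose_edge G e \<and> C = {e}) \<or>
     (\<exists>C1 u p w C2. handcuff_parts G C1 u p w C2 \<and> negative_figure G C1 \<and> negative_figure G C2 \<and>
        C = C1 \<union> walk_edges p \<union> C2)"

definition once_around :: "('v, 'e, 'k) gsgraph \<Rightarrow> 'e set \<Rightarrow> 'v \<Rightarrow> ('e \<times> nat) list \<Rightarrow> bool" where
  "once_around G C u p \<longleftrightarrow> walk G C u p u \<and> distinct (map fst p) \<and> walk_edges p = C"

text \<open>
  The gain of a sign circuit depends, up to its sign, on the choice of the circuit walk; hence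
  it is a relation.
\<close>

inductive circuit_gain :: "('v, 'e, 'k::field) gsgraph \<Rightarrow> 'e set \<Rightarrow> 'k \<Rightarrow> bool"
  for G where
  loose: "e \<in> edges G \<Longrightarrow> loose_edge G e \<Longrightarrow> circuit_gain G {e} (gain G e)"
| circle: "positive_circle G C \<Longrightarrow> once_around G C u p \<Longrightarrow> circuit_gain G C (walk_gain G p)"
| circle_circle:
    "handcuff_parts G C1 u p w C2 \<Longrightarrow> negative_circle G C1 \<Longrightarrow> negative_circle G C2 \<Longrightarrow>
     once_around G C1 u q1 \<Longrightarrow> once_around G C2 w q2 \<Longrightarrow>
     circuit_gain G (C1 \<union> walk_edges p \<union> C2) (walk_gain G (q1 @ p @ q2 @ reverse_walk p))"
| half_circle:
    "handcuff_parts G {e} u p w C2 \<Longrightarrow> half_edge G e \<Longrightarrow> negative_circle G C2 \<Longrightarrow>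
     once_around G C2 w q \<Longrightarrow>
     circuit_gain G ({e} \<union> walk_edges p \<union> C2)
       (ultrawalk_gain G (Some e) (p @ q @ reverse_walk p) (Some e))"
| half_half:
    "handcuff_parts G {e} u p w {f} \<Longrightarrow> half_edge G e \<Longrightarrow> half_edge G f \<Longrightarrow>
     circuit_gain G ({e} \<union> walk_edges p \<union> {f}) (ultrawalk_gain G (Some e) p (Some f))"

definition neutral :: "('v, 'e, 'k::field) gsgraph \<Rightarrow> 'e set \<Rightarrow> bool" where
  "neutral G C \<longleftrightarrow> circuit_gain G C 0"

definition hyperbalanced :: "('v, 'e, 'k::field) gsgraph \<Rightarrow> 'e set \<Rightarrow> bool" where
  "hyperbalanced G S \<longleftrightarrow> (\<forall>C\<subseteq>S. sign_circuit G C \<longrightarrow> neutral G C)"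

definition sign_balanced :: "('v, 'e, 'k) gsgraph \<Rightarrow> 'e set \<Rightarrow> bool" where
  "sign_balanced G S \<longleftrightarrow> (\<nexists>C. C \<subseteq> S \<and> negative_circle G C) \<and> (\<nexists>e. e \<in> S \<and> half_edge G e)"

text \<open>A matroid enters through its ground set \<open>E\<close> and rank function \<open>r\<close>.\<close>

definition rank_indep :: "'e set \<Rightarrow> ('e set \<Rightarrow> nat) \<Rightarrow> 'e set \<Rightarrow> bool" where
  "rank_indep E r I \<longleftrightarrow> I \<subseteq> E \<and> r I = card I"

definition rank_basis :: "'e set \<Rightarrow> ('e set \<Rightarrow> nat) \<Rightarrow> 'e set \<Rightarrow> bool" where
  "rank_basis E r B \<longleftrightarrow>
     rank_indep E r B \<and> (\<forall>B'. rank_indep E r B' \<and> B \<subseteq> B' \<longrightarrow> B' = B)"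

definition num_balanced :: "('v, 'e, 'k) gsgraph \<Rightarrow> 'e set \<Rightarrow> nat" where
  "num_balanced G S = card {X \<in> components G (verts G) S. sign_balanced G (edges_in G S X)}"

text \<open>The rank function of \<open>M(G)\<close>.  The subtraction does not truncate: there are at most as many
  components as vertices.\<close>

definition gs_rank :: "('v, 'e, 'k::field) gsgraph \<Rightarrow> 'e set \<Rightarrow> nat" where
  "gs_rank G S =
     card (verts G) - num_balanced G S + (if hyperbalanced G S then 0 else 1)"

definition forest :: "('v, 'e, 'k) gsgraph \<Rightarrow> 'e set \<Rightarrow> bool" where
  "forest G T \<longleftrightarrow> T \<subseteq> edges G \<and> (\<forall>e\<in>T. ordinary_edge G e) \<and> (\<nexists>C. C \<subseteq> T \<and> circle G C)"

definition tree :: "('v, 'e, 'k) gsgraph \<Rightarrow> 'v set \<Rightarrow> 'e set \<Rightarrow> bool" where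
  "tree G X T \<longleftrightarrow> edge_verts G T \<subseteq> X \<and> forest G T \<and> X \<noteq> {} \<and> connected_graph G X T"

text \<open>
  \<open>(X, T)\<close> consists of \<open>H\<close> with (possibly trivial) trees attached: these are the components of
  \<open>(X, T - H)\<close>, and each of them shares exactly one vertex with \<open>H\<close>.
\<close>

definition with_trees ::
  "('v, 'e, 'k) gsgraph \<Rightarrow> 'e set \<Rightarrow> 'v set \<Rightarrow> 'e set \<Rightarrow> bool" where
  "with_trees G H X T \<longleftrightarrow>
     H \<subseteq> T \<and> edge_verts G T \<subseteq> X \<and> forest G (T - H) \<and>
     (\<forall>Z\<in>components G X (T - H). \<exists>!v. v \<in> Z \<and> v \<in> edge_verts G H)"

definition unbalanced_unicycle :: "('v, 'e, 'k) gsgraph \<Rightarrow> 'v set \<Rightarrow> 'e set \<Rightarrow> bool" where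
  "unbalanced_unicycle G X T \<longleftrightarrow> (\<exists>F. negative_figure G F \<and> with_trees G F X T)"

definition nonneutral_balanced_unicycle ::
  "('v, 'e, 'k::field) gsgraph \<Rightarrow> 'v set \<Rightarrow> 'e set \<Rightarrow> bool" where
  "nonneutral_balanced_unicycle G X T \<longleftrightarrow>
     (\<exists>C. positive_circle G C \<and> with_trees G C X T \<and> \<not> neutral G C)"

definition nonneutral_theta_or_handcuff ::
  "('v, 'e, 'k::field) gsgraph \<Rightarrow> 'v set \<Rightarrow> 'e set \<Rightarrow> bool" where
  "nonneutral_theta_or_handcuff G X T \<longleftrightarrow>
     (\<exists>H. (theta_graph G H \<or> handcuff G H) \<and> (\<exists>F\<subseteq>H. negative_figure G F) \<and> with_trees G H X T) \<and>
     (\<exists>C. {C'. C' \<subseteq> T \<and> sign_circuit G C'} = {C} \<and> \<not> neutral G C)"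

abbreviation comps :: "('v, 'e, 'k) gsgraph \<Rightarrow> 'v set set" where
  "comps G \<equiv> components G (verts G) (edges G)"

definition balanced_comp :: "('v, 'e, 'k) gsgraph \<Rightarrow> 'v set \<Rightarrow> bool" where
  "balanced_comp G X \<longleftrightarrow> X \<in> comps G \<and> sign_balanced G (edges_in G (edges G) X)"

definition unbalanced_comp :: "('v, 'e, 'k) gsgraph \<Rightarrow> 'v set \<Rightarrow> bool" where
  "unbalanced_comp G X \<longleftrightarrow> X \<in> comps G \<and> \<not> sign_balanced G (edges_in G (edges G) X)"

abbreviation part :: "('v, 'e, 'k) gsgraph \<Rightarrow> 'e set \<Rightarrow> 'v set \<Rightarrow> 'e set" where
  "part G B X \<equiv> B \<inter> edges_in G (edges G) X"

definition union_of_unbalanced_unicycles ::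
  "('v, 'e, 'k) gsgraph \<Rightarrow> 'v set \<Rightarrow> 'e set \<Rightarrow> bool" where
  "union_of_unbalanced_unicycles G X T \<longleftrightarrow>
     (\<forall>Y\<in>components G X T. unbalanced_unicycle G Y (edges_in G T Y))"

definition union_with_nonneutral_exception ::
  "('v, 'e, 'k::field) gsgraph \<Rightarrow> 'v set \<Rightarrow> 'e set \<Rightarrow> bool" where
  "union_with_nonneutral_exception G X T \<longleftrightarrow>
     (\<exists>Y0\<in>components G X T.
        nonneutral_theta_or_handcuff G Y0 (edges_in G T Y0) \<and>
        (\<forall>Y\<in>components G X T - {Y0}. unbalanced_unicycle G Y (edges_in G T Y)))"

definition no_loose_edges :: "('v, 'e, 'k) gsgraph \<Rightarrow> 'e set \<Rightarrow> bool" where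
  "no_loose_edges G B \<longleftrightarrow> (\<forall>e\<in>B. \<not> loose_edge G e)"

definition comp_conditions :: "('v, 'e, 'k) gsgraph \<Rightarrow> 'e set \<Rightarrow> 'v set set \<Rightarrow> bool" where
  "comp_conditions G B A \<longleftrightarrow>
     (\<forall>X. balanced_comp G X \<and> X \<notin> A \<longrightarrow> tree G X (part G B X)) \<and>
     (\<forall>X. unbalanced_comp G X \<and> X \<notin> A \<longrightarrow> union_of_unbalanced_unicycles G X (part G B X))"

definition type_I :: "('v, 'e, 'k) gsgraph \<Rightarrow> 'e set \<Rightarrow> bool" where
  "type_I G B \<longleftrightarrow> comp_conditions G B {} \<and> no_loose_edges G B"

definition type_II_loose :: "('v, 'e, 'k::field) gsgraph \<Rightarrow> 'e set \<Rightarrow> bool" where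
  "type_II_loose G B \<longleftrightarrow>
     comp_conditions G B {} \<and>
     (\<exists>e\<in>B. loose_edge G e \<and> \<not> neutral G {e} \<and> no_loose_edges G (B - {e}))"

definition type_II_balanced :: "('v, 'e, 'k::field) gsgraph \<Rightarrow> 'e set \<Rightarrow> bool" where
  "type_II_balanced G B \<longleftrightarrow>
     no_loose_edges G B \<and>
     (\<exists>X. balanced_comp G X \<and> \<not> tree G X (edges_in G (edges G) X) \<and>
          nonneutral_balanced_unicycle G X (part G B X) \<and>
          comp_conditions G B {X})"

definition type_II_unbalanced :: "('v, 'e, 'k::field) gsgraph \<Rightarrow> 'e set \<Rightarrow> bool" where
  "type_II_unbalanced G B \<longleftrightarrow>
     no_loose_edges G B \<and>
     (\<exists>X. unbalanced_comp G X \<and>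
          union_with_nonneutral_exception G X (part G B X) \<and>
          comp_conditions G B {X})"

definition exactly_one :: "bool \<Rightarrow> bool \<Rightarrow> bool \<Rightarrow> bool" where
  "exactly_one P Q R \<longleftrightarrow> P \<and> \<not> Q \<and> \<not> R \<or> \<not> P \<and> Q \<and> \<not> R \<or> \<not> P \<and> \<not> Q \<and> R"

end

theory Submission
  imports Defs
begin

section \<open>The bases of the matroid of a gain signed graph\<close>

text \<open>
  The whole argument is a count. Every component \<open>Y\<close> of an edge set \<open>S\<close> carries at least
  \<open>card Y - 1\<close> edges if it is sign balanced and at least \<open>card Y\<close> if it is not, so
  \<open>card S + b(S) - n\<close> is the number of loose edges plus the sum of the nonnegative excesses of the
  components; call it the nullity of \<open>S\<close>. A set is independent iff its nullity equals \<open>\<delta>\<close>.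

  Nullity and sign circuits are linked by linear algebra without dimensions. A sign circuit carries a
  nowhere zero linear relation between the vectors \<open>\<Sum>\<tau>(v,e) v\<close> of its edges, and its gain is the
  same combination of the edge gains; conversely, if \<open>b\<close> drops when edges are added, the switching
  function of a balanced component (this needs characteristic \<open>\<noteq> 2\<close>) annihilates the old edges but
  not all the new ones. Hence removing an edge of a sign circuit lowers the nullity by one, sets of
  nullity \<open>0\<close> have a potential and no sign circuit, sets of nullity \<open>1\<close> have exactly one, and the
  bases are the sets \<open>B\<close> with nullity \<open>\<delta>(B)\<close> that have the same \<open>b\<close> and \<open>\<delta>\<close> as \<open>E\<close>. In such a \<open>B\<close>
  at most one component has positive excess, and then it is a circle, a theta graph or a handcuff
  with trees attached.
\<close>

subsection \<open>Walks, paths and cycles\<close>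

text \<open>The edges are read as columns of an incidence matrix over the field: the column of
  \<open>e\<close> has the entries \<tau>(v,e) at its ends, added up at a loop. A potential \<theta>
  on the vertices is a row combination with values \<open>edge_val G \<theta>\<close>. Then n - b(S)
  is the rank of the columns in S, and S is hyperbalanced iff the gains on S are the values of a
  potential, so \<delta> measures the extra row of gains. No rank is ever computed: one relation per
  sign circuit, and one potential that separates an edge from a set, are enough.

  The characteristic enters twice. A handcuff with a circle has coefficients 2 or -2 on its path,
  which is walked in both directions; and a potential that changes its sign around a negative circle
  satisfies 2 \<theta>(u) = 0, which has to force \<theta>(u) = 0.

  The obstacle is that trees, unicycles, theta graphs and handcuffs with trees are defined by shape,
  while nullity is a number. Each shape is turned into connectedness, a difference between the
  numbers of edges and vertices, and balance; paths are built only where a circuit, theta graph or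
  handcuff must be found.\<close>

definition conn :: "('v, 'e, 'k) gsgraph \<Rightarrow> 'e set \<Rightarrow> 'v \<Rightarrow> 'v \<Rightarrow> bool" where
  "conn G S u w \<longleftrightarrow> (\<exists>p. walk G S u p w)"

definition source :: "('v, 'e, 'k) gsgraph \<Rightarrow> 'e \<times> nat \<Rightarrow> 'v" where
  "source G s = ends G (fst s) ! snd s"

definition target :: "('v, 'e, 'k) gsgraph \<Rightarrow> 'e \<times> nat \<Rightarrow> 'v" where
  "target G s = ends G (fst s) ! (1 - snd s)"

text \<open>The targets of a closed walk list its vertices with the start placed at the end.
  Distinct edges are demanded as well because a link walked forth and back has two distinct
  targets.\<close>

definition cycle :: "('v, 'e, 'k) gsgraph \<Rightarrow> 'e set \<Rightarrow> 'v \<Rightarrow> ('e \<times> nat) list \<Rightarrow> bool" where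
  "cycle G S u q \<longleftrightarrow>
     walk G S u q u \<and> q \<noteq> [] \<and> distinct (map fst q) \<and> distinct (map (target G) q)"

section \<open>Walks: vertices, edges, concatenation and reversal\<close>

lemma walk_verts_target: "walk_verts G u p = u # map (target G) p"
  by (auto simp: walk_verts_def target_def)

lemma walk_verts_Nil [simp]: "walk_verts G u [] = [u]"
  by (simp add: walk_verts_def)

lemma walk_edges_Nil [simp]: "walk_edges [] = {}"
  by (simp add: walk_edges_def)

lemma walk_edges_Cons [simp]: "walk_edges (s # p) = insert (fst s) (walk_edges p)"
  by (simp add: walk_edges_def)

lemma walk_edges_append [simp]: "walk_edges (p @ q) = walk_edges p \<union> walk_edges q"
  by (auto simp: walk_edges_def)

lemma finite_walk_edges [simp]: "finite (walk_edges p)"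
  by (simp add: walk_edges_def)

lemma walk_edges_reverse [simp]: "walk_edges (reverse_walk p) = walk_edges p"
  by (force simp: walk_edges_def reverse_walk_def)

lemma walk_Cons:
  "walk G S u (s # p) w \<longleftrightarrow>
     fst s \<in> S \<and> ordinary_edge G (fst s) \<and> snd s < 2 \<and> source G s = u \<and> walk G S (target G s) p w"
  by (cases s) (auto simp: source_def target_def)

lemma walk_append:
  "walk G S u (p @ q) w \<longleftrightarrow> (\<exists>v. walk G S u p v \<and> walk G S v q w)"
  by (induction p arbitrary: u) (auto simp del: walk.simps(2) simp: walk_Cons)

lemma walk_restrict:
  assumes "walk G S u p w" "walk_edges p \<subseteq> S'"
  shows "walk G S' u p w"
  using assms by (induction p arbitrary: u) (auto simp del: walk.simps(2) simp: walk_Cons)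

lemma walk_edges_subset: "walk G S u p w \<Longrightarrow> walk_edges p \<subseteq> S"
  by (induction p arbitrary: u) (auto simp del: walk.simps(2) simp: walk_Cons)

lemma walk_mono: "walk G S u p w \<Longrightarrow> S \<subseteq> S' \<Longrightarrow> walk G S' u p w"
  using walk_restrict walk_edges_subset by (metis subset_trans)

lemma walk_ordinary: "walk G S u p w \<Longrightarrow> e \<in> walk_edges p \<Longrightarrow> ordinary_edge G e"
  by (induction p arbitrary: u) (auto simp del: walk.simps(2) simp: walk_Cons)

text \<open>Degree counts and the reversal of paths rest on reading the vertex sequence in these two
  ways.\<close>

lemma walk_sources_targets:
  "walk G S u p w \<Longrightarrow> map (source G) p @ [w] = u # map (target G) p"
  by (induction p arbitrary: u) (auto simp del: walk.simps(2) simp: walk_Cons)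

lemma walk_end_in: "walk G S u p w \<Longrightarrow> w \<in> set (walk_verts G u p)"
  by (metis in_set_conv_decomp walk_sources_targets walk_verts_target)

lemma walk_last: "walk G S u p w \<Longrightarrow> p \<noteq> [] \<Longrightarrow> w = target G (last p)"
  by (metis last_ConsR last_map last_snoc map_is_Nil_conv walk_sources_targets)

lemma walk_single: "walk G S u [s] w \<longleftrightarrow>
  fst s \<in> S \<and> ordinary_edge G (fst s) \<and> snd s < 2 \<and> source G s = u \<and> target G s = w"
  by (auto simp del: walk.simps(2) simp: walk_Cons)

lemma reverse_walk_Nil [simp]: "reverse_walk [] = []"
  by (simp add: reverse_walk_def)

lemma reverse_walk_Cons: "reverse_walk (s # p) = reverse_walk p @ [(fst s, 1 - snd s)]"
  by (cases s) (simp add: reverse_walk_def)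

lemma walk_reverse: "walk G S u p w \<Longrightarrow> walk G S w (reverse_walk p) u"
proof (induction p arbitrary: u)
  case (Cons s p)
  have s: "fst s \<in> S" "ordinary_edge G (fst s)" "snd s < 2" "source G s = u"
    "walk G S (target G s) p w"
    using Cons.prems by (simp_all del: walk.simps(2) add: walk_Cons)
  have "walk G S (target G s) [(fst s, 1 - snd s)] u"
    using s by (auto simp: source_def target_def less_2_cases_iff)
  then show ?case
    using Cons.IH[OF s(5)] by (auto simp: reverse_walk_Cons walk_append)
qed simp

lemma ordinary_ends:
  assumes "ordinary_edge G e"
  shows "set (ends G e) = {ends G e ! 0, ends G e ! 1}" "ends G e = [ends G e ! 0, ends G e ! 1]"
proof -
  obtain a b where "ends G e = [a, b]"
    using assms by (auto simp: ordinary_edge_def numeral_2_eq_2 length_Suc_conv)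
  then show "set (ends G e) = {ends G e ! 0, ends G e ! 1}"
    "ends G e = [ends G e ! 0, ends G e ! 1]" by auto
qed

lemma step_ends:
  assumes "ordinary_edge G (fst s)" "snd s < 2"
  shows "set (ends G (fst s)) = {source G s, target G s}"
    "count_list (ends G (fst s)) v =
      (if source G s = v then 1 else 0) + (if target G s = v then 1 else 0)"
proof -
  obtain a b where "ends G (fst s) = [a, b]"
    using ordinary_ends(2)[OF assms(1)] by blast
  moreover have "snd s = 0 \<or> snd s = 1" using assms(2) by auto
  ultimately show "set (ends G (fst s)) = {source G s, target G s}"
    "count_list (ends G (fst s)) v =
      (if source G s = v then 1 else 0) + (if target G s = v then 1 else 0)"
    by (auto simp: source_def target_def)
qed

lemma edge_verts_insert [simp]: "edge_verts G (insert e S) = set (ends G e) \<union> edge_verts G S"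
  by (auto simp: edge_verts_def)

lemma edge_verts_empty [simp]: "edge_verts G {} = {}"
  by (auto simp: edge_verts_def)

lemma edge_verts_Un [simp]: "edge_verts G (S \<union> S') = edge_verts G S \<union> edge_verts G S'"
  by (auto simp: edge_verts_def)

lemma edge_verts_mono: "S \<subseteq> S' \<Longrightarrow> edge_verts G S \<subseteq> edge_verts G S'"
  by (auto simp: edge_verts_def)

lemma walk_verts_edge_verts:
  "walk G S u p w \<Longrightarrow> set (walk_verts G u p) = insert u (edge_verts G (walk_edges p))"
proof (induction p arbitrary: u)
  case (Cons s p)
  have s: "ordinary_edge G (fst s)" "snd s < 2" "source G s = u"
    "walk G S (target G s) p w"
    using Cons.prems by (simp_all del: walk.simps(2) add: walk_Cons)
  show ?case using Cons.IH[OF s(4)] step_ends(1)[OF s(1,2)] s(3)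
    by (auto simp: walk_verts_target)
qed simp

lemma walk_verts_closed:
  "walk G S u q u \<Longrightarrow> q \<noteq> [] \<Longrightarrow> set (map (target G) q) = edge_verts G (walk_edges q)
     \<and> u \<in> edge_verts G (walk_edges q)"
proof -
  assume w: "walk G S u q u" "q \<noteq> []"
  obtain s q' where q: "q = s # q'" using w(2) by (cases q) auto
  have "u \<in> edge_verts G (walk_edges q)"
    using w(1) q step_ends(1)[of G s] by (auto simp del: walk.simps(2) simp: walk_Cons)
  moreover have "u \<in> set (map (target G) q)"
    using walk_last[OF w] w(2) by auto
  ultimately show ?thesis
    using walk_verts_edge_verts[OF w(1)] by (simp add: walk_verts_target insert_absorb)
qed

section \<open>Connectivity and paths\<close>

lemma conn_refl [simp]: "conn G S u u"
  unfolding conn_def by (rule exI[of _ "[]"]) simp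

lemma conn_sym: "conn G S u w \<Longrightarrow> conn G S w u"
  unfolding conn_def by (metis walk_reverse)

lemma conn_trans: "conn G S u v \<Longrightarrow> conn G S v w \<Longrightarrow> conn G S u w"
  unfolding conn_def by (metis walk_append)

lemma connected_graph_conn: "connected_graph G X S \<longleftrightarrow> (\<forall>u\<in>X. \<forall>w\<in>X. conn G S u w)"
  by (simp add: connected_graph_def conn_def)

lemma connected_graphI: "(\<And>x. x \<in> X \<Longrightarrow> conn G S u x) \<Longrightarrow> connected_graph G X S"
  unfolding connected_graph_conn by (blast intro: conn_trans[of G S _ u] conn_sym[of G S u])

lemma conn_mono: "conn G S u w \<Longrightarrow> S \<subseteq> S' \<Longrightarrow> conn G S' u w"
  unfolding conn_def by (metis walk_mono)

lemma conn_empty [simp]: "conn G {} u w \<longleftrightarrow> u = w"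
proof -
  have "walk G {} u p w \<Longrightarrow> u = w" for p by (cases p) auto
  then show ?thesis by (auto simp: conn_def intro: exI[of _ "[]"])
qed

lemma walk_split:
  assumes "walk G S u p w" "x \<in> set (walk_verts G u p)"
  obtains q r where "p = q @ r" "walk G S u q x" "walk G S x r w"
  using assms
proof (induction p arbitrary: u thesis)
  case Nil
  then show ?case by (metis append_Nil set_ConsD walk.simps(1) walk_verts_Nil empty_iff empty_set)
next
  case (Cons s p)
  show ?case
  proof (cases "x = u")
    case True
    then show ?thesis using Cons.prems(1)[of "[]" "s # p"] Cons.prems(2) by simp
  next
    case False
    have x: "x \<in> set (walk_verts G (target G s) p)"
      using Cons.prems(3) False by (auto simp: walk_verts_target)
    have w: "walk G S (target G s) p w"
      using Cons.prems(2) by (simp del: walk.simps(2) add: walk_Cons)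
    obtain q r where "p = q @ r" "walk G S (target G s) q x" "walk G S x r w"
      using Cons.IH[OF _ w x] by blast
    then show ?thesis using Cons.prems(1)[of "s # q" r] Cons.prems(2)
      by (simp del: walk.simps(2) add: walk_Cons)
  qed
qed

lemma conn_walk_vert: "walk G S u p w \<Longrightarrow> x \<in> set (walk_verts G u p) \<Longrightarrow> conn G (walk_edges p) u x"
  by (metis conn_def sup_ge1 walk_edges_append walk_restrict walk_split)

lemma path_split:
  assumes "path G S u p w" "x \<in> set (walk_verts G u p)"
  obtains q r where "p = q @ r" "path G S u q x" "path G S x r w"
proof -
  have d: "distinct (walk_verts G u p)" and w: "walk G S u p w"
    using assms(1) by (auto simp: path_def)
  obtain q r where qr: "p = q @ r" "walk G S u q x" "walk G S x r w"
    by (rule walk_split[OF w assms(2)])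
  have "distinct (walk_verts G u q)" using d qr(1) by (auto simp: walk_verts_target)
  moreover have "distinct (walk_verts G x r)"
  proof (cases "q = []")
    case True
    then show ?thesis using d qr by (auto simp: walk_verts_target)
  next
    case False
    then have "x \<in> set (map (target G) q)" using walk_last[OF qr(2)] by auto
    then show ?thesis using d qr(1) by (auto simp: walk_verts_target)
  qed
  ultimately show ?thesis using that qr by (auto simp: path_def)
qed

text \<open>Loop erasure from the front: if the start already lies on the path found for the rest of
  the walk, only the part of that path from there on is kept.\<close>

lemma conn_path:
  assumes "conn G S u w"
  obtains p where "path G S u p w"
proof -
  obtain p where "walk G S u p w" using assms by (auto simp: conn_def)
  then have "\<exists>p. path G S u p w"
  proof (induction p arbitrary: u)
    case Nil
    then show ?case by (intro exI[of _ "[]"]) (simp add: path_def)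
  next
    case (Cons s p)
    have s: "fst s \<in> S" "ordinary_edge G (fst s)" "snd s < 2" "source G s = u"
      "walk G S (target G s) p w"
      using Cons.prems by (simp_all del: walk.simps(2) add: walk_Cons)
    obtain q where q: "path G S (target G s) q w" using Cons.IH[OF s(5)] by blast
    show ?case
    proof (cases "u \<in> set (walk_verts G (target G s) q)")
      case True
      then show ?thesis using path_split[OF q True] by blast
    next
      case False
      then have "path G S u (s # q) w"
        using q s by (simp del: walk.simps(2) add: path_def walk_Cons walk_verts_target)
      then show ?thesis by blast
    qed
  qed
  then show ?thesis using that by blast
qed

text \<open>A repetition of the first edge would bring the path back to \<open>u\<close>, one of its
  ends.\<close>

lemma path_distinct_edges: "path G S u p w \<Longrightarrow> distinct (map fst p)"
proof (induction p arbitrary: u)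
  case (Cons s p)
  have s: "ordinary_edge G (fst s)" "snd s < 2" "source G s = u" "walk G S (target G s) p w"
    using Cons.prems by (simp_all del: walk.simps(2) add: path_def walk_Cons)
  have d: "u \<notin> set (walk_verts G (target G s) p)" "distinct (walk_verts G (target G s) p)"
    using Cons.prems by (auto simp: path_def walk_verts_target)
  have "fst s \<notin> walk_edges p"
  proof
    assume "fst s \<in> walk_edges p"
    then have "u \<in> edge_verts G (walk_edges p)"
      using step_ends(1)[OF s(1,2)] s(3) by (auto simp: edge_verts_def)
    then show False using d(1) walk_verts_edge_verts[OF s(4)] by auto
  qed
  then show ?case using Cons.IH[of "target G s"] s d
    by (auto simp: path_def walk_edges_def)
qed simp

lemma path_mono: "path G S u p w \<Longrightarrow> S \<subseteq> S' \<Longrightarrow> path G S' u p w"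
  by (auto simp: path_def walk_mono)

lemma path_card: "path G S u p w \<Longrightarrow>
  card (set (walk_verts G u p)) = Suc (length p) \<and> card (walk_edges p) = length p"
  by (metis distinct_card length_Cons length_map list.set_map path_def path_distinct_edges
      walk_edges_def walk_verts_target)

lemma path_edge_two_verts:
  assumes "path G S u p w" "e \<in> walk_edges p"
  obtains x y where "x \<noteq> y" "set (ends G e) = {x, y}" "x \<in> set (walk_verts G u p)"
    "y \<in> set (walk_verts G u p)"
proof -
  obtain i where "(e, i) \<in> set p" using assms(2) by (auto simp: walk_edges_def)
  then obtain q r where p: "p = q @ (e, i) # r" by (metis split_list)
  have w: "walk G S u p w" and d: "distinct (walk_verts G u p)"
    using assms(1) by (auto simp: path_def)
  obtain v where v: "walk G S u q v" "walk G S v ((e, i) # r) w"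
    using w p walk_append by metis
  have e: "ordinary_edge G e" "i < 2" "source G (e, i) = v"
    using v(2) by (auto simp: source_def)
  have v_in: "v \<in> set (walk_verts G u q)" using walk_end_in[OF v(1)] .
  have "target G (e, i) \<notin> set (walk_verts G u q)"
    using d p by (auto simp: walk_verts_target)
  moreover have "set (walk_verts G u q) \<subseteq> set (walk_verts G u p)"
    "target G (e, i) \<in> set (walk_verts G u p)"
    using p by (auto simp: walk_verts_target)
  moreover have "set (ends G e) = {v, target G (e, i)}"
    using step_ends(1)[of G "(e, i)"] e by simp
  ultimately show ?thesis
    using that[of v "target G (e, i)"] v_in by blast
qed

text \<open>Take a shortest path among all those from \<open>A\<close> to \<open>D\<close>: another
  visit to \<open>A\<close> or to \<open>D\<close> would cut it short. It serves as the connecting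
  path of a handcuff.\<close>

lemma conn_between_sets:
  assumes "conn G S a d" "a \<in> A" "d \<in> D"
  obtains u p w where "u \<in> A" "w \<in> D" "path G S u p w"
    "set (walk_verts G u p) \<inter> A = {u}" "set (walk_verts G u p) \<inter> D = {w}"
proof -
  let ?Q = "\<lambda>(u, p, w). u \<in> A \<and> w \<in> D \<and> path G S u p w"
  obtain p0 where "path G S a p0 d" using conn_path[OF assms(1)] .
  then have "?Q (a, p0, d)" using assms by simp
  then obtain t where t: "?Q t" "\<And>t'. ?Q t' \<Longrightarrow> length (fst (snd t)) \<le> length (fst (snd t'))"
    using ex_has_least_nat[of ?Q "(a, p0, d)" "\<lambda>t. length (fst (snd t))"] by blast
  obtain u p w where [simp]: "t = (u, p, w)" by (cases t)
  have P: "u \<in> A" "w \<in> D" "path G S u p w" using t(1) by auto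
  have A: "x = u" if x: "x \<in> set (walk_verts G u p)" "x \<in> A" for x
  proof -
    obtain q r where qr: "p = q @ r" "path G S u q x" "path G S x r w"
      using path_split[OF P(3) x(1)] .
    have "length p \<le> length r" using t(2)[of "(x, r, w)"] qr(3) x P by simp
    then show ?thesis using qr by (simp add: path_def)
  qed
  have D: "x = w" if x: "x \<in> set (walk_verts G u p)" "x \<in> D" for x
  proof -
    obtain q r where qr: "p = q @ r" "path G S u q x" "path G S x r w"
      using path_split[OF P(3) x(1)] .
    have "length p \<le> length q" using t(2)[of "(u, q, x)"] qr(2) x P by simp
    then show ?thesis using qr by (simp add: path_def)
  qed
  have "w \<in> set (walk_verts G u p)" using P(3) walk_end_in by (auto simp: path_def)
  moreover have "u \<in> set (walk_verts G u p)" by (simp add: walk_verts_target)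
  ultimately show ?thesis using that[OF P] A D P by blast
qed

text \<open>The ear of a theta graph: a shortest path between two different vertices of
  \<open>Z\<close> has no inner vertex in \<open>Z\<close>, since its part up to such a vertex would
  be shorter.\<close>

lemma conn_within_set:
  assumes "conn G S a d" "a \<in> Z" "d \<in> Z" "a \<noteq> d"
  obtains u p w where "u \<in> Z" "w \<in> Z" "u \<noteq> w" "path G S u p w"
    "set (walk_verts G u p) \<inter> Z = {u, w}"
proof -
  let ?Q = "\<lambda>(u, p, w). u \<in> Z \<and> w \<in> Z \<and> u \<noteq> w \<and> path G S u p w"
  obtain p0 where "path G S a p0 d" using conn_path[OF assms(1)] .
  then have "?Q (a, p0, d)" using assms by simp
  then obtain t where t: "?Q t" "\<And>t'. ?Q t' \<Longrightarrow> length (fst (snd t)) \<le> length (fst (snd t'))"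
    using ex_has_least_nat[of ?Q "(a, p0, d)" "\<lambda>t. length (fst (snd t))"] by blast
  obtain u p w where [simp]: "t = (u, p, w)" by (cases t)
  have P: "u \<in> Z" "w \<in> Z" "u \<noteq> w" "path G S u p w" using t(1) by auto
  have D: "x = u \<or> x = w" if x: "x \<in> set (walk_verts G u p)" "x \<in> Z" for x
  proof (rule ccontr)
    assume ne: "\<not> ?thesis"
    obtain q r where qr: "p = q @ r" "path G S u q x" "path G S x r w"
      using path_split[OF P(4) x(1)] .
    have "length p \<le> length q" using t(2)[of "(u, q, x)"] qr(2) x P ne by auto
    then show False using qr ne by (simp add: path_def)
  qed
  have "w \<in> set (walk_verts G u p)" using P(4) walk_end_in by (auto simp: path_def)
  moreover have "u \<in> set (walk_verts G u p)" by (simp add: walk_verts_target)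
  ultimately show ?thesis using that[OF P] D P by blast
qed

text \<open>Crossing \<open>e\<close> repeatedly gains nothing: what lies between two crossings can
  be cut out, so that at most one crossing remains, in one of the two directions.\<close>

lemma conn_insertD:
  assumes "conn G (insert e S) u w"
  shows "conn G S u w \<or> ordinary_edge G e \<and>
    (conn G S u (ends G e ! 0) \<and> conn G S (ends G e ! 1) w \<or>
     conn G S u (ends G e ! 1) \<and> conn G S (ends G e ! 0) w)"
proof -
  obtain p where "walk G (insert e S) u p w" using assms by (auto simp: conn_def)
  then show ?thesis
  proof (induction p arbitrary: u)
    case (Cons s p)
    have s: "fst s \<in> insert e S" "ordinary_edge G (fst s)" "snd s < 2" "source G s = u"
      "walk G (insert e S) (target G s) p w"
      using Cons.prems by (simp_all del: walk.simps(2) add: walk_Cons)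
    note IH = Cons.IH[OF s(5)]
    show ?case
    proof (cases "fst s \<in> S")
      case True
      then have "walk G S u [s] (target G s)" unfolding walk_single using s by auto
      then have "conn G S u (target G s)" by (auto simp: conn_def)
      then show ?thesis using IH conn_trans[OF \<open>conn G S u (target G s)\<close>] by blast
    next
      case False
      then have e: "fst s = e" using s by auto
      have "snd s = 0 \<or> snd s = 1" using s(3) by auto
      then show ?thesis using IH s(2,4) e by (auto simp: source_def target_def)
    qed
  qed simp
qed

lemma conn_edge:
  assumes "e \<in> S" "ordinary_edge G e" "x \<in> set (ends G e)" "y \<in> set (ends G e)"
  shows "conn G S x y"
proof -
  have "conn G S (ends G e ! 0) (ends G e ! 1)"
    unfolding conn_def using assms by (intro exI[of _ "[(e, 0)]"]) auto
  then show ?thesis using assms(3,4) ordinary_ends(1)[OF assms(2)] conn_sym[of G S "ends G e ! 0"] by fastforce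
qed

text \<open>The second premise is conditional because a half edge or a loose edge carries no step of
  a walk, so that its deletion never disconnects.\<close>

lemma conn_remove:
  assumes "conn G S u w" "ordinary_edge G e \<Longrightarrow> conn G (S - {e}) (ends G e ! 0) (ends G e ! 1)"
  shows "conn G (S - {e}) u w"
proof -
  have "conn G (insert e (S - {e})) u w" using assms(1) by (rule conn_mono) auto
  from conn_insertD[OF this] show ?thesis
    using assms(2) by (meson conn_trans conn_sym)
qed

text \<open>Follow the walk until it is about to use an edge of \<open>H\<close>, or else to its
  end: the vertex reached is an end of an edge of \<open>H\<close>. This roots the edges outside
  \<open>H\<close> in the vertices of \<open>H\<close>.\<close>

lemma conn_edges_avoid:
  assumes "conn G (S \<union> H) y z" "z \<in> edge_verts G H"
  shows "\<exists>z'\<in>edge_verts G H. conn G S y z'"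
proof -
  obtain p where "walk G (S \<union> H) y p z" using assms by (auto simp: conn_def)
  then show ?thesis
  proof (induction p arbitrary: y)
    case Nil
    then show ?case using assms(2) by (auto intro: bexI[of _ y])
  next
    case (Cons s p)
    have s: "fst s \<in> S \<union> H" "ordinary_edge G (fst s)" "snd s < 2" "source G s = y"
      "walk G (S \<union> H) (target G s) p z"
      using Cons.prems by (simp_all del: walk.simps(2) add: walk_Cons)
    show ?case
    proof (cases "fst s \<in> H")
      case True
      then have "y \<in> edge_verts G H" using step_ends(1)[OF s(2,3)] s(4)
        by (auto simp: edge_verts_def)
      then show ?thesis by (auto intro: bexI[of _ y])
    next
      case False
      then have "walk G S y [s] (target G s)" unfolding walk_single using s by auto
      then have "conn G S y (target G s)" by (auto simp: conn_def)
      then show ?thesis using Cons.IH[OF s(5)] conn_trans[OF \<open>conn G S y (target G s)\<close>] by blast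
    qed
  qed
qed

section \<open>Trails, cycles and degrees\<close>

lemma trail_degree:
  assumes "walk G S u p w" "distinct (map fst p)"
  shows "degree G (walk_edges p) v = count_list (map (source G) p) v + count_list (map (target G) p) v"
  using assms
proof (induction p arbitrary: u)
  case (Cons s p)
  have s: "ordinary_edge G (fst s)" "snd s < 2" "walk G S (target G s) p w"
    using Cons.prems by (simp_all del: walk.simps(2) add: walk_Cons)
  have "fst s \<notin> walk_edges p" using Cons.prems(2) by (auto simp: walk_edges_def)
  then have "degree G (walk_edges (s # p)) v = count_list (ends G (fst s)) v + degree G (walk_edges p) v"
    by (simp add: degree_def)
  then show ?case using Cons.IH[OF s(3)] Cons.prems(2) step_ends(2)[OF s(1,2)] by auto
qed (simp add: degree_def)

lemma count_list_distinct: "distinct xs \<Longrightarrow> count_list xs v = (if v \<in> set xs then 1 else 0)"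
  by (induction xs) auto

text \<open>The sources of a closed walk are its targets in another order, so each vertex counts
  once as a source and once as a target.\<close>

lemma cycle_degree:
  assumes "cycle G S u q"
  shows "degree G (walk_edges q) v = (if v \<in> edge_verts G (walk_edges q) then 2 else 0)"
proof -
  have q: "walk G S u q u" "q \<noteq> []" "distinct (map fst q)" "distinct (map (target G) q)"
    using assms by (auto simp: cycle_def)
  have "count_list (map (source G) q @ [u]) v = count_list (u # map (target G) q) v"
    using walk_sources_targets[OF q(1)] by simp
  then have "count_list (map (source G) q) v = count_list (map (target G) q) v"
    by (auto split: if_splits)
  then show ?thesis
    using trail_degree[OF q(1,3), of v] count_list_distinct[OF q(4), of v] walk_verts_closed[OF q(1,2)]
    by simp
qed

lemma cycle_imp_circle:
  assumes "cycle G S u q" "S \<subseteq> edges G"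
  shows "circle G (walk_edges q)" "u \<in> edge_verts G (walk_edges q)"
proof -
  have q: "walk G S u q u" "q \<noteq> []"
    using assms by (auto simp: cycle_def)
  have c: "conn G (walk_edges q) u x" if "x \<in> edge_verts G (walk_edges q)" for x
    using conn_walk_vert[OF q(1)] walk_verts_edge_verts[OF q(1)] that by blast
  then have "connected_graph G (edge_verts G (walk_edges q)) (walk_edges q)"
    by (rule connected_graphI)
  moreover have "walk_edges q \<noteq> {}" using q(2) by (simp add: walk_edges_def)
  moreover have "walk_edges q \<subseteq> edges G" using walk_edges_subset[OF q(1)] assms(2) by blast
  moreover have "\<forall>e\<in>walk_edges q. ordinary_edge G e" using walk_ordinary[OF q(1)] by blast
  moreover have "\<forall>v\<in>edge_verts G (walk_edges q). degree G (walk_edges q) v = 2"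
    using cycle_degree[OF assms(1)] by simp
  ultimately show "circle G (walk_edges q)" unfolding circle_def by blast
  show "u \<in> edge_verts G (walk_edges q)" using walk_verts_closed[OF q] by blast
qed

lemma path_edge_cycle:
  assumes "path G S u p w" "fst s \<notin> walk_edges p" "ordinary_edge G (fst s)" "snd s < 2"
    "source G s = w" "target G s = u"
  shows "cycle G (insert (fst s) S) u (p @ [s])"
proof -
  have "walk G (insert (fst s) S) u p w" using assms(1) walk_mono[of G S u p w] by (auto simp: path_def)
  moreover have "walk G (insert (fst s) S) w [s] u" unfolding walk_single using assms by simp
  moreover have "distinct (map fst p)" using path_distinct_edges[OF assms(1)] .
  ultimately show ?thesis using assms
    by (auto simp del: walk.simps(2) simp: cycle_def walk_append path_def walk_verts_target walk_edges_def)
qed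

lemma target_reverse:
  "walk G S u p w \<Longrightarrow> map (target G) (reverse_walk p) = rev (map (source G) p)"
proof (induction p arbitrary: u)
  case (Cons s p)
  have s: "snd s < 2" "walk G S (target G s) p w"
    using Cons.prems by (simp_all del: walk.simps(2) add: walk_Cons)
  then show ?case using Cons.IH[OF s(2)]
    by (auto simp: reverse_walk_Cons target_def source_def less_2_cases_iff)
qed simp

lemma fst_reverse: "map fst (reverse_walk p) = rev (map fst p)"
  by (auto simp: reverse_walk_def rev_map)

lemma walk_verts_reverse:
  "walk G S u p w \<Longrightarrow> walk_verts G w (reverse_walk p) = rev (walk_verts G u p)"
  using walk_sources_targets[of G S u p w, symmetric]
  by (simp add: walk_verts_target target_reverse)

lemma path_reverse: "path G S u p w \<Longrightarrow> path G S w (reverse_walk p) u"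
  using walk_reverse walk_verts_reverse by (fastforce simp: path_def)

lemma two_paths_cycle:
  assumes "path G S u p w" "path G S u q w" "internally_disjoint G u w p q" "u \<noteq> w"
  shows "cycle G S u (p @ reverse_walk q)"
proof -
  have w: "walk G S u p w" "walk G S u q w" and d: "distinct (walk_verts G u p)"
    "distinct (walk_verts G u q)"
    using assms by (auto simp: path_def)
  have "p \<noteq> []" using assms(4) w(1) by auto
  have i: "set (walk_verts G u p) \<inter> set (walk_verts G u q) = {u, w}"
    "walk_edges p \<inter> walk_edges q = {}" using assms(3) by (auto simp: internally_disjoint_def)
  \<comment> \<open>Reversal turns the sources of \<open>q\<close> into targets. In the closed walk
    \<open>w\<close> then occurs once, as a target of \<open>p\<close>, and \<open>u\<close> once,
    as a source of \<open>q\<close>.\<close>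
  have q: "walk_verts G u q = map (source G) q @ [w]"
    using walk_sources_targets[OF w(2)] by (simp add: walk_verts_target)
  have "distinct (map (target G) (p @ reverse_walk q))"
    using d i(1) unfolding q walk_verts_target[of G u p] map_append target_reverse[OF w(2)]
    by auto
  moreover have "distinct (map fst (p @ reverse_walk q))"
    using path_distinct_edges[OF assms(1)] path_distinct_edges[OF assms(2)] i(2)
    unfolding map_append fst_reverse by (auto simp: walk_edges_def)
  ultimately show ?thesis
    using w(1) walk_reverse[OF w(2)] \<open>p \<noteq> []\<close> by (auto simp: cycle_def walk_append)
qed

lemma cycle_rotate:
  assumes "cycle G S u q" "v \<in> edge_verts G (walk_edges q)"
  obtains q' where "cycle G S v q'" "walk_edges q' = walk_edges q"
proof -
  have q: "walk G S u q u" "q \<noteq> []" "distinct (map fst q)" "distinct (map (target G) q)"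
    using assms by (auto simp: cycle_def)
  have "v \<in> set (walk_verts G u q)" using assms(2) walk_verts_edge_verts[OF q(1)] by blast
  then obtain q1 q2 where s: "q = q1 @ q2" "walk G S u q1 v" "walk G S v q2 u"
    using walk_split[OF q(1)] by blast
  have "cycle G S v (q2 @ q1)" using s q by (auto simp: cycle_def walk_append)
  moreover have "walk_edges (q2 @ q1) = walk_edges q" using s by auto
  ultimately show ?thesis using that by blast
qed

text \<open>The rest of the cycle, rotated to start right after \<open>e\<close>, joins the ends of
  \<open>e\<close>.\<close>

lemma cycle_remove_edge:
  assumes "cycle G S u q" "e \<in> walk_edges q"
  shows "conn G (S - {e}) (ends G e ! 0) (ends G e ! 1)"
proof -
  have q: "walk G S u q u" "distinct (map fst q)" using assms by (auto simp: cycle_def)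
  obtain i where "(e, i) \<in> set q" using assms(2) by (auto simp: walk_edges_def)
  then obtain q1 q2 where s: "q = q1 @ (e, i) # q2" by (metis split_list)
  obtain v where v: "walk G S u q1 v" "walk G S v ((e, i) # q2) u"
    using q(1) s walk_append by metis
  have e: "i < 2" "source G (e, i) = v" "walk G S (target G (e, i)) q2 u"
    using v(2) by (auto simp: source_def target_def)
  have "e \<notin> walk_edges q1" "e \<notin> walk_edges q2" using q(2) s by (auto simp: walk_edges_def)
  then have "walk_edges q1 \<subseteq> S - {e}" "walk_edges q2 \<subseteq> S - {e}"
    using walk_edges_subset[OF v(1)] walk_edges_subset[OF e(3)] by auto
  then have "walk G (S - {e}) u q1 v" "walk G (S - {e}) (target G (e, i)) q2 u"
    using walk_restrict[OF v(1)] walk_restrict[OF e(3)] by blast+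
  then have "walk G (S - {e}) (target G (e, i)) (q2 @ q1) (source G (e, i))"
    using e(2) by (auto simp: walk_append)
  then have "conn G (S - {e}) (target G (e, i)) (source G (e, i))"
    by (auto simp: conn_def)
  then show ?thesis using e(1) conn_sym by (auto simp: source_def target_def less_2_cases_iff)
qed

subsection \<open>Counting edges against components\<close>

text \<open>All counts below come from this inequality and its equality case, applied with \<open>Z\<close> a single
  vertex or the vertex set of a figure.\<close>

lemma card_le_roots:
  assumes "finite S" "finite Z" "\<And>x. x \<in> X \<Longrightarrow> \<exists>z\<in>Z. conn G S x z"
  shows "card X \<le> card Z + card S"
  using assms
proof (induction S arbitrary: Z)
  case empty
  then have "X \<subseteq> Z" by auto
  then show ?case using empty card_mono by (metis trans_le_add1)
next
  case (insert e S)
  show ?case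
  proof (cases "\<forall>x\<in>X. \<exists>z\<in>Z. conn G S x z")
    case True
    then have "card X \<le> card Z + card S" using insert by blast
    then show ?thesis using insert by simp
  next
    case False
    then obtain x where x: "x \<in> X" "\<And>z. z \<in> Z \<Longrightarrow> \<not> conn G S x z" by blast
    obtain z where z: "z \<in> Z" "conn G (insert e S) x z" using insert.prems(2)[OF x(1)] by blast
    \<comment> \<open>\<open>b\<close> is the end of \<open>e\<close> on the side of the root
      \<open>z\<close>. The other end \<open>a\<close> becomes a further root in place of
      \<open>e\<close>: whatever reaches a root through \<open>e\<close> reaches \<open>a\<close> or
      \<open>b\<close> without it.\<close>
    obtain a b where ab: "conn G S b z"
      "\<And>u w. conn G (insert e S) u w \<Longrightarrow> conn G S u w \<or> conn G S u a \<or> conn G S u b"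
      using conn_insertD[OF z(2)] x(2)[OF z(1)] conn_insertD[of G e S] by metis
    have "\<exists>z'\<in>insert a Z. conn G S y z'" if y: "y \<in> X" for y
    proof -
      obtain z' where z': "z' \<in> Z" "conn G (insert e S) y z'" using insert.prems(2)[OF y] by blast
      then show ?thesis using ab(2)[OF z'(2)] conn_trans[OF _ ab(1), of y] z(1) by blast
    qed
    then have "card X \<le> card (insert a Z) + card S"
      using insert.IH[of "insert a Z"] insert.prems(1) by blast
    also have "card (insert a Z) \<le> Suc (card Z)"
      using insert.prems(1) by (simp add: card_insert_if)
    finally show ?thesis using insert by simp
  qed
qed

text \<open>In the tight case nothing can be spared: deleting an edge that is no bridge, or a root
  joined to another root, would leave a rooted graph that violates
  \<open>card_le_roots\<close>.\<close>

lemma card_eq_roots: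
  assumes "finite S" "finite Z" "\<And>x. x \<in> X \<Longrightarrow> \<exists>z\<in>Z. conn G S x z"
    and "card X = card Z + card S"
  shows "e \<in> S \<Longrightarrow> ordinary_edge G e" "\<not> cycle G S u q"
    "z \<in> Z \<Longrightarrow> z' \<in> Z \<Longrightarrow> conn G S z z' \<Longrightarrow> z = z'"
proof -
  have rem: "\<not> ((ordinary_edge G e \<longrightarrow> conn G (S - {e}) (ends G e ! 0) (ends G e ! 1)))"
    if "e \<in> S" for e
  proof
    assume *: "ordinary_edge G e \<longrightarrow> conn G (S - {e}) (ends G e ! 0) (ends G e ! 1)"
    have "\<exists>z\<in>Z. conn G (S - {e}) x z" if "x \<in> X" for x
      using assms(3)[OF that] conn_remove[of G S x _ e] * by blast
    then have "card X \<le> card Z + card (S - {e})"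
      using card_le_roots[of "S - {e}" Z] assms(1,2) by blast
    moreover have "card (S - {e}) < card S" using assms(1) that by (rule card_Diff1_less)
    ultimately show False using assms(4) by simp
  qed
  show "e \<in> S \<Longrightarrow> ordinary_edge G e" using rem by blast
  show "\<not> cycle G S u q"
  proof
    assume c: "cycle G S u q"
    then obtain s q' where "q = s # q'" by (auto simp: cycle_def neq_Nil_conv)
    then have s: "fst s \<in> walk_edges q" by simp
    moreover have "walk_edges q \<subseteq> S" using c walk_edges_subset[of G S u q u] by (simp add: cycle_def)
    ultimately show False
      using cycle_remove_edge[OF c s] rem[of "fst s"] by blast
  qed
  assume z: "z \<in> Z" "z' \<in> Z" "conn G S z z'"
  show "z = z'"
  proof (rule ccontr)
    assume ne: "z \<noteq> z'"
    have "\<exists>y\<in>Z - {z}. conn G S x y" if x: "x \<in> X" for x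
    proof -
      obtain y where y: "y \<in> Z" "conn G S x y" using assms(3)[OF x] by blast
      show ?thesis
        using y z ne conn_trans[OF _ z(3), of x] by (cases "y = z") blast+
    qed
    then have "card X \<le> card (Z - {z}) + card S"
      using card_le_roots[OF assms(1), of "Z - {z}"] assms(2) by blast
    moreover have "card (Z - {z}) < card Z" using assms(2) z(1) by (rule card_Diff1_less)
    ultimately show False using assms(4) by simp
  qed
qed

text \<open>Converse of the tight case, by induction on the edges: without \<open>e\<close> one tree
  falls into two, and the end \<open>a\<close> of \<open>e\<close> that is cut off from the root
  becomes a root of its own.\<close>

lemma acyclic_card_roots:
  assumes "finite S" "finite X" "Z \<subseteq> X" "edge_verts G S \<subseteq> X"
    and "\<And>x. x \<in> X \<Longrightarrow> \<exists>z\<in>Z. conn G S x z"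
    and "\<And>e. e \<in> S \<Longrightarrow> ordinary_edge G e" "\<And>u q. \<not> cycle G S u q"
    and "\<And>z z'. z \<in> Z \<Longrightarrow> z' \<in> Z \<Longrightarrow> conn G S z z' \<Longrightarrow> z = z'"
  shows "card X = card Z + card S"
  using assms
proof (induction S arbitrary: Z)
  case empty
  then have "X = Z" by auto
  then show ?case by simp
next
  case (insert e S)
  have mono: "conn G S u w \<Longrightarrow> conn G (insert e S) u w" for u w
    by (rule conn_mono) auto
  have e: "ordinary_edge G e" using insert.prems(5) by blast
  let ?a = "ends G e ! 0" and ?b = "ends G e ! 1"
  have ends: "?a \<in> X" "?b \<in> X" using insert.prems(3) ordinary_ends(1)[OF e] by auto
  have ab_conn: "conn G (insert e S) ?a ?b"
    using conn_edge[of e "insert e S" G ?a ?b] e ordinary_ends(1)[OF e] by auto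
  have nab: "\<not> conn G S ?a ?b"
  proof
    assume "conn G S ?a ?b"
    then obtain p where p: "path G S ?a p ?b" by (rule conn_path)
    then have "e \<notin> walk_edges p"
      using insert.hyps(2) by (auto simp: path_def dest: walk_edges_subset)
    then have "cycle G (insert e S) ?a (p @ [(e, 1)])"
      using path_edge_cycle[OF p, of "(e, 1)"] e by (simp add: source_def target_def)
    then show False using insert.prems(6) by blast
  qed
  obtain z where z: "z \<in> Z" "conn G (insert e S) ?a z" using insert.prems(4)[OF ends(1)] by blast
  have "conn G S ?a z \<or> conn G S ?b z"
    using conn_insertD[OF z(2)] nab by blast
  then obtain a b where ab: "{a, b} = {?a, ?b}" "conn G S b z" by blast
  have nc: "\<not> conn G S a b" "\<not> conn G S b a"
    using ab(1) nab conn_sym[of G S ?b ?a] by (auto simp: doubleton_eq_iff)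
  have abX: "a \<in> X" using ab(1) ends by (auto simp: doubleton_eq_iff)
  have abc: "conn G (insert e S) a b"
    using ab(1) ab_conn conn_sym[OF ab_conn] by (auto simp: doubleton_eq_iff)
  have ins: "conn G S u w \<or> conn G S u a \<or> conn G S u b" if "conn G (insert e S) u w" for u w
    using conn_insertD[OF that] ab(1) by (auto simp: doubleton_eq_iff)
  have az: "conn G (insert e S) a z" using conn_trans[OF abc mono[OF ab(2)]] .
  have only_z: "z' = z" if "z' \<in> Z" "conn G S a z'" for z'
  proof -
    have "conn G (insert e S) z z'" using conn_trans[OF conn_sym[OF az] mono[OF that(2)]] .
    then show ?thesis using insert.prems(7)[OF z(1) that(1)] by blast
  qed
  \<comment> \<open>By \<open>only_z\<close> such a root is \<open>z\<close> itself, and then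
    \<open>a\<close> and \<open>b\<close> would be connected without \<open>e\<close>, so that
    \<open>e\<close> would close a cycle.\<close>
  have naz: "\<not> conn G S a z'" if "z' \<in> Z" for z'
  proof
    assume c: "conn G S a z'"
    then have "z' = z" using only_z that by blast
    then show False using nc(1) conn_trans[OF c] conn_sym[OF ab(2)] by blast
  qed
  have aZ: "a \<notin> Z" using naz[of a] by auto
  have "card X = card (insert a Z) + card S"
  proof (rule insert.IH)
    show "\<exists>z\<in>insert a Z. conn G S x z" if x: "x \<in> X" for x
    proof -
      obtain y where y: "y \<in> Z" "conn G (insert e S) x y" using insert.prems(4)[OF x] by blast
      show ?thesis using ins[OF y(2)] y(1) conn_trans[OF _ ab(2), of x] z(1) by blast
    qed
    show "\<not> cycle G S u q" for u q
    proof
      assume "cycle G S u q"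
      then have "cycle G (insert e S) u q"
        using walk_mono[of G S u q u "insert e S"] by (auto simp: cycle_def)
      then show False using insert.prems(6) by blast
    qed
    show "y = y'" if y: "y \<in> insert a Z" "y' \<in> insert a Z" "conn G S y y'" for y y'
      using y insert.prems(7)[of y y'] mono[of y y'] naz[of y] naz[of y'] conn_sym[OF y(3)] by blast
  qed (use insert.prems abX in auto)
  then show ?case using aZ insert.hyps insert.prems(1,2)
    by (simp add: finite_subset)
qed

section \<open>Circles and their traversals\<close>

lemma sum_count_list_pair:
  assumes "finite X" "a \<in> X" "b \<in> X"
  shows "(\<Sum>v\<in>X. count_list [a, b] v) = 2"
proof -
  have "(\<Sum>v\<in>X. count_list [a, b] v) = (\<Sum>v\<in>X. (if a = v then 1 else 0) + (if b = v then 1 else 0))"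
    by (rule sum.cong) auto
  also have "\<dots> = 2" using assms by (simp add: sum.distrib)
  finally show ?thesis .
qed

text \<open>Handshake lemma; a loop counts twice at its vertex because \<open>ends\<close> lists
  that vertex twice.\<close>

lemma sum_degree:
  assumes "finite C" "finite X" "\<And>e. e \<in> C \<Longrightarrow> ordinary_edge G e" "edge_verts G C \<subseteq> X"
  shows "(\<Sum>v\<in>X. degree G C v) = 2 * card C"
proof -
  have "(\<Sum>v\<in>X. count_list (ends G e) v) = 2" if e: "e \<in> C" for e
  proof -
    obtain a b where ab: "ends G e = [a, b]" using ordinary_ends(2)[OF assms(3)[OF e]] by blast
    then have "a \<in> X" "b \<in> X" using assms(4) e unfolding edge_verts_def by (metis UN_subset_iff list.set_intros subsetD)+
    then show ?thesis using sum_count_list_pair[OF assms(2)] ab by metis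
  qed
  then show ?thesis unfolding degree_def by (subst sum.swap) simp
qed

lemma circleD:
  assumes "circle G C"
  shows "C \<noteq> {}" "C \<subseteq> edges G" "e \<in> C \<Longrightarrow> ordinary_edge G e"
    "v \<in> edge_verts G C \<Longrightarrow> w \<in> edge_verts G C \<Longrightarrow> conn G C v w"
    "v \<in> edge_verts G C \<Longrightarrow> degree G C v = 2"
  using assms by (auto simp: circle_def connected_graph_def conn_def)

lemma finite_edge_verts [simp]: "finite S \<Longrightarrow> finite (edge_verts G S)"
  by (simp add: edge_verts_def)

lemma ordinary_verts_nonempty: "ordinary_edge G e \<Longrightarrow> set (ends G e) \<noteq> {}"
  using ordinary_ends(1)[of G e] by auto

lemma circle_verts_nonempty: "circle G C \<Longrightarrow> edge_verts G C \<noteq> {}"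
  using circleD(1,3)[of G C] ordinary_verts_nonempty[of G] by (auto simp: edge_verts_def)

lemma circle_card:
  assumes "circle G C" "finite C"
  shows "card C = card (edge_verts G C)"
proof -
  have "(\<Sum>v\<in>edge_verts G C. degree G C v) = 2 * card C"
    using assms circleD(3) by (intro sum_degree) auto
  moreover have "(\<Sum>v\<in>edge_verts G C. degree G C v) = (\<Sum>v\<in>edge_verts G C. 2)"
    using circleD(5)[OF assms(1)] by (rule sum.cong[OF refl])
  ultimately show ?thesis by simp
qed

text \<open>At a vertex of \<open>D\<close> both edge ends that \<open>C\<close> has there are used
  up by \<open>D\<close>. Hence no edge of \<open>C\<close> leaves \<open>D\<close>, and the
  connectedness of \<open>C\<close> makes \<open>D\<close> all of it.\<close>

lemma circle_minimal:
  assumes "circle G C" "finite C" "D \<subseteq> C" "D \<noteq> {}" "\<And>v. v \<in> edge_verts G D \<Longrightarrow> degree G D v = 2"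
  shows "D = C"
proof -
  have fD: "finite D" using assms finite_subset by blast
  have "edge_verts G D \<noteq> {}"
    using assms(3,4) circleD(3)[OF assms(1)] ordinary_verts_nonempty[of G] by (auto simp: edge_verts_def)
  then obtain u where u: "u \<in> edge_verts G D" by blast
  have step: "e \<in> D" if "e \<in> C" "v \<in> set (ends G e)" "v \<in> edge_verts G D" for e v
  proof (rule ccontr)
    assume "e \<notin> D"
    then have "degree G C v \<ge> degree G (insert e D) v"
      using assms(2,3) that(1) unfolding degree_def by (intro sum_mono2) auto
    moreover have "degree G (insert e D) v = count_list (ends G e) v + degree G D v"
      using \<open>e \<notin> D\<close> fD by (simp add: degree_def)
    moreover have "count_list (ends G e) v > 0" using that(2) count_list_0_iff[of "ends G e" v] by auto
    moreover have "degree G C v = 2"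
      by (rule circleD(5)[OF assms(1) subsetD[OF edge_verts_mono[OF assms(3)] that(3)]])
    ultimately show False using assms(5)[OF that(3)] by simp
  qed
  have w: "walk G C v p w \<Longrightarrow> v \<in> edge_verts G D \<Longrightarrow> w \<in> edge_verts G D" for v p w
  proof (induction p arbitrary: v)
    case (Cons s p)
    have s: "fst s \<in> C" "ordinary_edge G (fst s)" "snd s < 2" "source G s = v"
      "walk G C (target G s) p w"
      using Cons.prems(1) by (simp_all del: walk.simps(2) add: walk_Cons)
    have "v \<in> set (ends G (fst s))" "target G s \<in> set (ends G (fst s))"
      using step_ends(1)[OF s(2,3)] s(4) by auto
    then have "target G s \<in> edge_verts G D"
      using step[OF s(1) _ Cons.prems(2)] by (auto simp: edge_verts_def)
    then show ?case using Cons.IH[OF s(5)] by blast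
  qed simp
  have "e \<in> D" if e: "e \<in> C" for e
  proof -
    obtain v where v: "v \<in> set (ends G e)"
      using ordinary_verts_nonempty[OF circleD(3)[OF assms(1) e]] by (meson ex_in_conv)
    have "u \<in> edge_verts G C" "v \<in> edge_verts G C"
      using u edge_verts_mono[OF assms(3), of G] v e by (auto simp: edge_verts_def)
    then have "conn G C u v" by (rule circleD(4)[OF assms(1)])
    then have "v \<in> edge_verts G D" using w u by (auto simp: conn_def)
    then show ?thesis by (rule step[OF e v])
  qed
  then show ?thesis using assms(3) by blast
qed

text \<open>A connected graph with as many edges as vertices is no tree, so \<open>C\<close>
  contains some cycle. By \<open>circle_minimal\<close> this cycle exhausts \<open>C\<close>, and
  rotation moves its start to \<open>u\<close>.\<close>

lemma circle_imp_cycle: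
  assumes "circle G C" "finite C" "u \<in> edge_verts G C"
  obtains q where "cycle G C u q" "walk_edges q = C"
proof -
  have "\<exists>v q. cycle G C v q"
  proof (rule ccontr)
    assume nc: "\<not> ?thesis"
    have "card (edge_verts G C) = card {u} + card C"
      by (rule acyclic_card_roots)
        (use assms nc circleD(3,4)[OF assms(1)] in auto)
    then show False using circle_card[OF assms(1,2)] by simp
  qed
  then obtain v q where q: "cycle G C v q" by blast
  have "walk_edges q = C"
  proof (rule circle_minimal[OF assms(1,2)])
    show "walk_edges q \<subseteq> C" using q walk_edges_subset[of G C v q v] by (simp add: cycle_def)
    show "walk_edges q \<noteq> {}" using q by (auto simp: cycle_def walk_edges_def)
  qed (use cycle_degree[OF q] in simp)
  moreover obtain q' where "cycle G C u q'" "walk_edges q' = walk_edges q"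
    using cycle_rotate[OF q] assms(3) calculation by blast
  ultimately show ?thesis using that by simp
qed

lemma circle_remove_edge:
  assumes "circle G C" "finite C" "e \<in> C" "C \<subseteq> S"
  shows "conn G (S - {e}) (ends G e ! 0) (ends G e ! 1)"
proof -
  obtain u where "u \<in> edge_verts G C" using circle_verts_nonempty[OF assms(1)] by blast
  then obtain q where q: "cycle G C u q" "walk_edges q = C"
    using circle_imp_cycle[OF assms(1,2)] by blast
  have "conn G (C - {e}) (ends G e ! 0) (ends G e ! 1)"
    using cycle_remove_edge[OF q(1)] q(2) assms(3) by blast
  then show ?thesis by (rule conn_mono) (use assms(4) in auto)
qed

lemma circle_once_around:
  assumes "circle G C" "finite C" "u \<in> edge_verts G C"
  obtains q where "once_around G C u q"
  using circle_imp_cycle[OF assms] by (metis cycle_def once_around_def)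

lemma circle_two_paths:
  assumes "circle G C" "finite C" "u \<in> edge_verts G C" "w \<in> edge_verts G C" "u \<noteq> w"
  obtains p q where "path G C u p w" "path G C u q w" "internally_disjoint G u w p q"
    "walk_edges p \<union> walk_edges q = C"
proof -
  obtain c where c: "cycle G C u c" "walk_edges c = C"
    using circle_imp_cycle[OF assms(1,2,3)] .
  have cw: "walk G C u c u" "distinct (map fst c)" "distinct (map (target G) c)"
    using c by (auto simp: cycle_def)
  have "w \<in> set (walk_verts G u c)" using walk_verts_edge_verts[OF cw(1)] c(2) assms(4) by simp
  then obtain p r where pr: "c = p @ r" "walk G C u p w" "walk G C w r u"
    using walk_split[OF cw(1)] by blast
  have "p \<noteq> []" "r \<noteq> []" using pr assms(5) by auto
  then have w_in: "w \<in> set (map (target G) p)" and u_in: "u \<in> set (map (target G) r)"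
    using walk_last[OF pr(2)] walk_last[OF pr(3)] by auto
  have dp: "distinct (walk_verts G u p)" and dr: "distinct (walk_verts G w r)"
    using cw(3) pr(1) w_in u_in by (auto simp: walk_verts_target)
  have "set (walk_verts G u p) \<inter> set (walk_verts G w r) = {u, w}"
    using cw(3) pr(1) w_in u_in by (auto simp: walk_verts_target)
  then have "internally_disjoint G u w p (reverse_walk r)"
    using cw(2) pr(1) walk_verts_reverse[OF pr(3)]
    unfolding internally_disjoint_def walk_edges_reverse by (auto simp: walk_edges_def)
  moreover have "path G C u (reverse_walk r) w"
    using path_reverse[of G C w r u] pr(3) dr by (auto simp: path_def)
  ultimately show ?thesis
    using that[of p "reverse_walk r"] pr dp c(2) by (auto simp: path_def)
qed

section \<open>Components, and paths that meet figures\<close>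

lemma components_conn: "Z \<in> components G X S \<longleftrightarrow> (\<exists>x\<in>X. Z = {w \<in> X. conn G S x w})"
  by (auto simp: components_def quotient_def conn_def Image_def)

lemma components_image: "components G X S = (\<lambda>x. {w \<in> X. conn G S x w}) ` X"
  by (auto simp: components_conn)

lemma path_self: "path G S u p u \<Longrightarrow> p = []"
  by (cases p rule: rev_cases) (auto simp: path_def walk_verts_target walk_append dest: walk_last)

lemma path_between_figures:
  assumes "path G S u p w" "set (walk_verts G u p) \<inter> A = {u}" "set (walk_verts G u p) \<inter> D = {w}"
  shows "u \<in> A" "w \<in> D" "u \<in> D \<Longrightarrow> u = w"
proof -
  have "u \<in> set (walk_verts G u p)" by (simp add: walk_verts_target)
  then show "u \<in> A" "w \<in> D" "u \<in> D \<Longrightarrow> u = w" using assms(2,3) by blast+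
qed

text \<open>An edge of a path is a link, so a common edge would mean two common vertices.\<close>

lemma path_edges_disjoint:
  assumes "path G S u p w" "set (walk_verts G u p) \<inter> edge_verts G C = {z}"
  shows "C \<inter> walk_edges p = {}"
proof (rule ccontr)
  assume "\<not> ?thesis"
  then obtain e where e: "e \<in> C" "e \<in> walk_edges p" by blast
  obtain x y where xy: "x \<noteq> y" "set (ends G e) = {x, y}" "x \<in> set (walk_verts G u p)"
    "y \<in> set (walk_verts G u p)" by (rule path_edge_two_verts[OF assms(1) e(2)])
  then have "x \<in> edge_verts G C" "y \<in> edge_verts G C" using e(1) by (auto simp: edge_verts_def)
  then have "x = z" "y = z" using xy assms(2) by blast+
  then show False using xy(1) by simp
qed

subsection \<open>Circles, handcuffs and theta graphs\<close>

lemma card_Diff_add: "finite T \<Longrightarrow> H \<subseteq> T \<Longrightarrow> card (T - H) + card H = card T"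
  by (simp add: card_Diff_subset card_mono finite_subset)

locale gain_signed =
  fixes G :: "('v, 'e, 'k::field) gsgraph"
  assumes gsg: "gain_signed_graph G"
begin

lemma finite_edges: "finite (edges G)" and finite_verts: "finite (verts G)"
  using gsg by (auto simp: gain_signed_graph_def)

lemma finite_subset_edges: "S \<subseteq> edges G \<Longrightarrow> finite S"
  using finite_edges finite_subset by blast

lemma edge_kinds: "e \<in> edges G \<Longrightarrow> ordinary_edge G e \<or> half_edge G e \<or> loose_edge G e"
  using gsg by (auto simp: gain_signed_graph_def)

lemma kinds_disjoint:
  "ordinary_edge G e \<Longrightarrow> \<not> half_edge G e" "ordinary_edge G e \<Longrightarrow> \<not> loose_edge G e"
  "half_edge G e \<Longrightarrow> \<not> loose_edge G e"
  by (auto simp: ordinary_edge_def half_edge_def loose_edge_def)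

lemma ends_in_verts: "e \<in> edges G \<Longrightarrow> set (ends G e) \<subseteq> verts G"
  using gsg by (auto simp: gain_signed_graph_def)

lemma sign_pm: "e \<in> edges G \<Longrightarrow> sign G e = 1 \<or> sign G e = -1"
  using gsg by (auto simp: gain_signed_graph_def)

lemma prod_sign_pm: "C \<subseteq> edges G \<Longrightarrow> prod (sign G) C = 1 \<or> prod (sign G) C = -1"
proof -
  assume C: "C \<subseteq> edges G"
  then have "finite C" by (rule finite_subset_edges)
  then show ?thesis using C
  proof (induction C)
    case (insert e C)
    then show ?case using sign_pm[of e] by auto
  qed simp
qed

lemma half_ends: "half_edge G e \<Longrightarrow> \<exists>v. ends G e = [v]"
  by (auto simp: half_edge_def length_Suc_conv)

lemma circle_sign: "circle G C \<Longrightarrow> positive_circle G C \<or> negative_circle G C"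
  using prod_sign_pm[OF circleD(2)] by (auto simp: positive_circle_def negative_circle_def)

lemma negative_figure_figure: "negative_figure G F \<Longrightarrow> figure G F"
  by (auto simp: negative_figure_def figure_def negative_circle_def)

lemma figure_subset: "figure G F \<Longrightarrow> F \<subseteq> edges G"
  by (auto simp: figure_def half_edge_figure_def dest: circleD(2))

lemma figureE:
  assumes "figure G F"
  obtains (circle) "circle G F"
  | (half) e v where "F = {e}" "e \<in> edges G" "half_edge G e" "ends G e = [v]"
proof (cases "circle G F")
  case False
  then obtain e where e: "e \<in> edges G" "half_edge G e" "F = {e}"
    using assms by (auto simp: figure_def half_edge_figure_def)
  obtain v where "ends G e = [v]" using half_ends[OF e(2)] by blast
  then show ?thesis using e half by blast
qed (rule circle)

lemma figure_verts_nonempty: "figure G F \<Longrightarrow> edge_verts G F \<noteq> {}"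
  by (erule figureE) (auto dest: circle_verts_nonempty)

lemma figure_nonempty: "figure G F \<Longrightarrow> F \<noteq> {}"
  using figure_verts_nonempty by fastforce

lemma figure_connected: "figure G F \<Longrightarrow> connected_graph G (edge_verts G F) F"
  by (erule figureE) (simp_all add: circle_def connected_graph_conn)

lemma figure_card: "figure G F \<Longrightarrow> card F = card (edge_verts G F)"
  by (erule figureE) (simp_all add: circle_card finite_subset_edges circleD(2))

lemma figure_remove_edge:
  assumes "figure G F" "e \<in> F" "F \<subseteq> S" "conn G S u w"
  shows "conn G (S - {e}) u w"
  using assms(4)
proof (rule conn_remove)
  assume e: "ordinary_edge G e"
  then have "circle G F" using assms(1,2) kinds_disjoint by (auto simp: figure_def half_edge_figure_def)
  then show "conn G (S - {e}) (ends G e ! 0) (ends G e ! 1)"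
    by (intro circle_remove_edge[OF _ finite_subset_edges[OF circleD(2)] assms(2,3)])
qed

text \<open>A loop alone has degree 2 at its vertex, so \<open>circle_minimal\<close> applies to
  \<open>{e}\<close>.\<close>

lemma loop_circle:
  assumes "circle G C" "e \<in> C" "ends G e = [a, a]"
  shows "C = {e}"
proof -
  have "{e} = C"
    by (rule circle_minimal[OF assms(1) finite_subset_edges[OF circleD(2)[OF assms(1)]]])
      (use assms in \<open>auto simp: degree_def\<close>)
  then show ?thesis by simp
qed

text \<open>A common edge of the two figures brings its ends along. Since at most one vertex is
  shared, it is a loop or a half edge, hence all of both figures, against
  \<open>C1 \<noteq> C2\<close>.\<close>

lemma handcuff_disjoint:
  assumes "handcuff_parts G C1 u p w C2"
  shows "C1 \<inter> C2 = {}" "C1 \<inter> walk_edges p = {}" "C2 \<inter> walk_edges p = {}"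
proof -
  have h: "figure G C1" "figure G C2" "C1 \<noteq> C2" "card (edge_verts G C1 \<inter> edge_verts G C2) \<le> 1"
    "path G (edges G) u p w" "set (walk_verts G u p) \<inter> edge_verts G C1 = {u}"
    "set (walk_verts G u p) \<inter> edge_verts G C2 = {w}"
    using assms by (auto simp: handcuff_parts_def)
  show "C1 \<inter> C2 = {}"
  proof (rule ccontr)
    assume "\<not> ?thesis"
    then obtain e where e: "e \<in> C1" "e \<in> C2" by blast
    show False
    proof (cases "ordinary_edge G e")
      case False
      then show ?thesis
        using h(1-3) e circleD(3)[of G C1 e] circleD(3)[of G C2 e]
        by (auto simp: figure_def half_edge_figure_def)
    next
      case True
      then have c: "circle G C1" "circle G C2"
        using h e kinds_disjoint by (auto simp: figure_def half_edge_figure_def)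
      obtain a b where ab: "ends G e = [a, b]" using ordinary_ends(2)[OF True] by blast
      have sub: "{a, b} \<subseteq> edge_verts G C1 \<inter> edge_verts G C2"
        using e ab by (force simp: edge_verts_def)
      have "finite (edge_verts G C1 \<inter> edge_verts G C2)"
        using finite_subset_edges[OF circleD(2)[OF c(1)]] by simp
      from card_mono[OF this sub] have "a = b" using h(4) by (cases "a = b") auto
      then have "C1 = {e}" "C2 = {e}" using loop_circle[OF c(1) e(1)] loop_circle[OF c(2) e(2)] ab by auto
      then show ?thesis using h(3) by simp
    qed
  qed
  show "C1 \<inter> walk_edges p = {}" "C2 \<inter> walk_edges p = {}"
    using path_edges_disjoint h(5-7) by metis+
qed

text \<open>Each figure has as many edges as vertices, and the path has one vertex more than edges.
  Gluing at \<open>u\<close> and at \<open>w\<close> loses one vertex each, which leaves a surplus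
  of one edge.\<close>

lemma handcuff_count:
  assumes "handcuff_parts G C1 u p w C2" "H = C1 \<union> walk_edges p \<union> C2"
  shows "H \<subseteq> edges G" "edge_verts G H \<noteq> {}" "connected_graph G (edge_verts G H) H"
    "card H = Suc (card (edge_verts G H))"
proof -
  have h: "figure G C1" "figure G C2" "C1 \<noteq> C2" "card (edge_verts G C1 \<inter> edge_verts G C2) \<le> 1"
    "path G (edges G) u p w" "set (walk_verts G u p) \<inter> edge_verts G C1 = {u}"
    "set (walk_verts G u p) \<inter> edge_verts G C2 = {w}"
    "edge_verts G C1 \<inter> edge_verts G C2 \<noteq> {} \<longrightarrow> p = []"
    using assms by (auto simp: handcuff_parts_def)
  note uw = path_between_figures[OF h(5,6,7)]
  have wk: "walk G (edges G) u p w" using h(5) by (simp add: path_def)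
  let ?P = "set (walk_verts G u p)" and ?V1 = "edge_verts G C1" and ?V2 = "edge_verts G C2"
  have P: "?P = insert u (edge_verts G (walk_edges p))" by (rule walk_verts_edge_verts[OF wk])
  have V: "edge_verts G H = ?V1 \<union> ?P \<union> ?V2" unfolding assms(2) P using uw(1) by auto
  show sub: "H \<subseteq> edges G"
    using figure_subset[OF h(1)] figure_subset[OF h(2)] walk_edges_subset[OF wk] assms(2) by blast
  show "edge_verts G H \<noteq> {}" using uw(1) V by blast
  have H: "C1 \<subseteq> H" "walk_edges p \<subseteq> H" "C2 \<subseteq> H" using assms(2) by auto
  have c1: "conn G H u x" if "x \<in> ?V1" for x
    by (rule conn_mono[OF _ H(1)])
      (use figure_connected[OF h(1)] uw(1) that in \<open>auto simp: connected_graph_conn\<close>)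
  have cp: "conn G H u x" if "x \<in> ?P" for x
    using conn_mono[OF conn_walk_vert[OF wk that] H(2)] .
  have c2: "conn G H u x" if "x \<in> ?V2" for x
  proof -
    have "conn G H w x"
      by (rule conn_mono[OF _ H(3)])
        (use figure_connected[OF h(2)] uw(2) that in \<open>auto simp: connected_graph_conn\<close>)
    then show ?thesis using conn_trans[OF cp[OF walk_end_in[OF wk]]] by blast
  qed
  show "connected_graph G (edge_verts G H) H"
    by (rule connected_graphI[of _ _ _ u]) (use V c1 cp c2 in blast)
  have fin: "finite C1" "finite C2" using figure_subset[OF h(1)] figure_subset[OF h(2)] finite_subset_edges by auto
  note d = handcuff_disjoint[OF assms(1)]
  have pc: "card ?P = Suc (length p)" "card (walk_edges p) = length p"
    using path_card[OF h(5)] by auto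
  have "card (C1 \<union> walk_edges p) = card C1 + length p"
    using card_Un_disjoint[of C1 "walk_edges p"] d(2) fin pc(2) by simp
  moreover have "(C1 \<union> walk_edges p) \<inter> C2 = {}" using d by blast
  ultimately have cH: "card H = card C1 + length p + card C2"
    unfolding assms(2) using card_Un_disjoint[of "C1 \<union> walk_edges p" C2] fin by simp
  have "card (?V1 \<union> ?P) + card {u} = card ?V1 + card ?P"
    using card_Un_Int[of ?V1 ?P] fin h(6) by (simp add: Int_commute)
  moreover have "(?V1 \<union> ?P) \<inter> ?V2 = {w}"
  proof (cases "?V1 \<inter> ?V2 = {}")
    case True
    then show ?thesis using h(7) by blast
  next
    case False
    then have "p = []" using h(8) by blast
    then have "u = w" using wk by simp
    then have "w \<in> ?V1 \<inter> ?V2" using uw(1,2) by simp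
    moreover have "finite (?V1 \<inter> ?V2)" using fin by simp
    ultimately have "?V1 \<inter> ?V2 = {w}"
      using card_le_Suc0_iff_eq[of "?V1 \<inter> ?V2"] h(4) by auto
    then show ?thesis using h(7) by blast
  qed
  then have "card (?V1 \<union> ?P \<union> ?V2) + card {w} = card (?V1 \<union> ?P) + card ?V2"
    using card_Un_Int[of "?V1 \<union> ?P" ?V2] fin by simp
  ultimately show "card H = Suc (card (edge_verts G H))"
    unfolding V cH using pc figure_card[OF h(1)] figure_card[OF h(2)] by simp
qed

text \<open>Three paths with \<open>l\<close> edges altogether have \<open>l + 3\<close> vertices,
  counted path by path; \<open>u\<close> and \<open>w\<close> are counted three times each, so
  \<open>l - 1\<close> vertices remain.\<close>

lemma theta_count:
  assumes "theta_graph G H"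
  shows "H \<subseteq> edges G" "edge_verts G H \<noteq> {}" "connected_graph G (edge_verts G H) H"
    "card H = Suc (card (edge_verts G H))"
proof -
  obtain u w p q r where t: "u \<noteq> w" "path G (edges G) u p w" "path G (edges G) u q w"
    "path G (edges G) u r w" "internally_disjoint G u w p q" "internally_disjoint G u w p r"
    "internally_disjoint G u w q r" and H: "H = walk_edges p \<union> walk_edges q \<union> walk_edges r"
    using assms unfolding theta_graph_def by blast
  have wk: "walk G (edges G) u p w" "walk G (edges G) u q w" "walk G (edges G) u r w"
    using t by (auto simp: path_def)
  have "p \<noteq> []" using wk(1) t(1) by auto
  then obtain s p' where s: "p = s # p'" by (cases p) auto
  have u: "u \<in> edge_verts G (walk_edges p)"
    using wk(1) step_ends(1)[of G s] unfolding s
    by (auto simp del: walk.simps(2) simp: walk_Cons)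
  let ?P = "set (walk_verts G u p)" and ?Q = "set (walk_verts G u q)" and ?R = "set (walk_verts G u r)"
  have V: "edge_verts G H = ?P \<union> ?Q \<union> ?R"
    unfolding H wk[THEN walk_verts_edge_verts] using u by auto
  show "H \<subseteq> edges G" unfolding H using wk[THEN walk_edges_subset] by blast
  show "edge_verts G H \<noteq> {}" using u H by auto
  have sub: "walk_edges p \<subseteq> H" "walk_edges q \<subseteq> H" "walk_edges r \<subseteq> H" using H by auto
  have "conn G H u x" if "x \<in> edge_verts G H" for x
    using that conn_mono[OF conn_walk_vert[OF wk(1)] sub(1)] conn_mono[OF conn_walk_vert[OF wk(2)] sub(2)]
      conn_mono[OF conn_walk_vert[OF wk(3)] sub(3)] unfolding V by blast
  then show "connected_graph G (edge_verts G H) H" by (rule connected_graphI)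
  have d: "?P \<inter> ?Q = {u, w}" "?P \<inter> ?R = {u, w}" "?Q \<inter> ?R = {u, w}"
    "walk_edges p \<inter> walk_edges q = {}" "walk_edges p \<inter> walk_edges r = {}"
    "walk_edges q \<inter> walk_edges r = {}"
    using t by (auto simp: internally_disjoint_def)
  have c: "card {u, w} = 2" using t(1) by simp
  have "card (?P \<union> ?Q) + 2 = card ?P + card ?Q" using card_Un_Int[of ?P ?Q] d(1) c by simp
  moreover have "(?P \<union> ?Q) \<inter> ?R = {u, w}" using d by blast
  then have "card (?P \<union> ?Q \<union> ?R) + 2 = card (?P \<union> ?Q) + card ?R"
    using card_Un_Int[of "?P \<union> ?Q" ?R] c by simp
  moreover have "card (walk_edges p \<union> walk_edges q) = length p + length q"
    using card_Un_disjoint[of "walk_edges p" "walk_edges q"] d(4) t(2,3)[THEN path_card] by simp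
  moreover have "(walk_edges p \<union> walk_edges q) \<inter> walk_edges r = {}" using d by blast
  then have "card H = card (walk_edges p \<union> walk_edges q) + length r"
    unfolding H using card_Un_disjoint[of "walk_edges p \<union> walk_edges q" "walk_edges r"]
      t(4)[THEN path_card] by simp
  ultimately show "card H = Suc (card (edge_verts G H))"
    unfolding V using t(2,3,4)[THEN path_card] by simp
qed

section \<open>Trees and attached trees as cardinality conditions\<close>

lemma circle_in_iff_cycle:
  assumes "S \<subseteq> edges G"
  shows "(\<exists>C\<subseteq>S. circle G C) \<longleftrightarrow> (\<exists>u q. cycle G S u q)"
proof
  assume "\<exists>C\<subseteq>S. circle G C"
  then obtain C where C: "C \<subseteq> S" "circle G C" by blast
  obtain u where "u \<in> edge_verts G C" using circle_verts_nonempty[OF C(2)] by blast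
  then obtain q where "cycle G C u q"
    using circle_imp_cycle[OF C(2) finite_subset_edges[OF circleD(2)[OF C(2)]]] by metis
  then have "cycle G S u q" using walk_mono[OF _ C(1)] by (auto simp: cycle_def)
  then show "\<exists>u q. cycle G S u q" by blast
next
  assume "\<exists>u q. cycle G S u q"
  then obtain u q where c: "cycle G S u q" by blast
  then have "walk_edges q \<subseteq> S" using walk_edges_subset[of G S u q u] by (simp add: cycle_def)
  then show "\<exists>C\<subseteq>S. circle G C" using cycle_imp_circle(1)[OF c assms] by blast
qed

lemma forest_iff:
  "T \<subseteq> edges G \<Longrightarrow> forest G T \<longleftrightarrow> (\<forall>e\<in>T. ordinary_edge G e) \<and> (\<forall>u q. \<not> cycle G T u q)"
  using circle_in_iff_cycle[of T] unfolding forest_def by blast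

text \<open>A tree is the case of a single root, where \<open>acyclic_card_roots\<close> and
  \<open>card_eq_roots\<close> give the two directions.\<close>

lemma tree_iff:
  assumes "T \<subseteq> edges G" "finite X" "X \<noteq> {}" "edge_verts G T \<subseteq> X"
  shows "tree G X T \<longleftrightarrow> connected_graph G X T \<and> card X = Suc (card T)"
proof -
  have fin: "finite T" using finite_subset_edges[OF assms(1)] .
  obtain x where x: "x \<in> X" using assms(3) by blast
  show ?thesis
  proof
    assume t: "tree G X T"
    then have c: "connected_graph G X T" "forest G T" by (auto simp: tree_def)
    have "card X = card {x} + card T"
      by (rule acyclic_card_roots[OF fin assms(2)])
        (use c x assms forest_iff in \<open>auto simp: connected_graph_conn\<close>)
    then show "connected_graph G X T \<and> card X = Suc (card T)" using c by simp
  next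
    assume c: "connected_graph G X T \<and> card X = Suc (card T)"
    then have roots: "\<And>y. y \<in> X \<Longrightarrow> \<exists>z\<in>{x}. conn G T y z" "card X = card {x} + card T"
      using x by (auto simp: connected_graph_conn)
    have "forest G T"
      unfolding forest_iff[OF assms(1)] using card_eq_roots(1,2)[OF fin _ roots] by auto
    then show "tree G X T" using c assms by (simp add: tree_def)
  qed
qed

text \<open>The edges outside \<open>H\<close> join every vertex to a vertex of \<open>H\<close>, so
  \<open>card_le_roots\<close> applies with these vertices as roots. Thus the surplus of edges over
  vertices cannot shrink from \<open>H\<close> to a connected graph around it.\<close>

lemma connected_card_bound:
  assumes "finite T" "connected_graph G X T" "edge_verts G T \<subseteq> X" "H \<subseteq> T" "edge_verts G H \<noteq> {}"
  shows "card X + card H \<le> card (edge_verts G H) + card T"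
proof -
  have roots: "\<exists>z\<in>edge_verts G H. conn G (T - H) x z" if x: "x \<in> X" for x
  proof -
    obtain z where z: "z \<in> edge_verts G H" using assms(5) by blast
    then have "z \<in> X" using assms(3) edge_verts_mono[OF assms(4), of G] by blast
    then have "conn G ((T - H) \<union> H) x z"
      using assms(2,4) x by (simp add: connected_graph_conn Un_absorb2)
    then show ?thesis by (rule conn_edges_avoid[OF _ z])
  qed
  have "card X \<le> card (edge_verts G H) + card (T - H)"
    by (rule card_le_roots[OF _ _ roots]) (use assms finite_subset[OF assms(4,1)] in auto)
  moreover have "card (T - H) + card H = card T"
    by (rule card_Diff_add[OF assms(1,4)])
  ultimately show ?thesis by simp
qed

text \<open>Attaching trees adds as many edges as vertices. Conversely, this count is the tight case
  with the vertices of \<open>H\<close> as roots, which forces the edges outside \<open>H\<close> to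
  form a forest with exactly one root in each component.\<close>

lemma with_trees_iff:
  assumes "T \<subseteq> edges G" "finite X" "edge_verts G T \<subseteq> X" "H \<subseteq> T" "edge_verts G H \<noteq> {}"
    "connected_graph G (edge_verts G H) H"
  shows "with_trees G H X T \<longleftrightarrow>
    connected_graph G X T \<and> card X + card H = card (edge_verts G H) + card T"
proof -
  let ?Z = "edge_verts G H"
  have fin: "finite T" "finite H" "finite (T - H)" "finite ?Z"
    using finite_subset_edges[OF assms(1)] finite_subset[OF assms(4)] by auto
  have ZX: "?Z \<subseteq> X" using assms(3) edge_verts_mono[OF assms(4), of G] by blast
  have cTH: "card (T - H) + card H = card T"
    by (rule card_Diff_add[OF fin(1) assms(4)])
  have ev: "edge_verts G (T - H) \<subseteq> X" using assms(3) edge_verts_mono[of "T - H" T G] by blast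
  have sub: "T - H \<subseteq> edges G" using assms(1) by blast
  have comps: "(\<forall>Z'\<in>components G X (T - H). \<exists>!v. v \<in> Z' \<and> v \<in> ?Z) \<longleftrightarrow>
    (\<forall>x\<in>X. \<exists>!v. v \<in> ?Z \<and> conn G (T - H) x v)"
  proof -
    have "v \<in> X \<and> conn G (T - H) x v \<and> v \<in> ?Z \<longleftrightarrow> v \<in> ?Z \<and> conn G (T - H) x v" for v x
      using ZX by blast
    then show ?thesis unfolding components_image by simp
  qed
  show ?thesis
  proof
    assume w: "with_trees G H X T"
    then have u: "\<exists>!v. v \<in> ?Z \<and> conn G (T - H) x v" if "x \<in> X" for x
      using comps that by (auto simp: with_trees_def)
    have f: "forest G (T - H)" using w by (simp add: with_trees_def)
    have "card X = card ?Z + card (T - H)"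
    proof (rule acyclic_card_roots[OF fin(3) assms(2) ZX ev])
      show "\<exists>z\<in>?Z. conn G (T - H) x z" if "x \<in> X" for x using u[OF that] by blast
      show "ordinary_edge G e" if "e \<in> T - H" for e using f that forest_iff[OF sub] by blast
      show "\<not> cycle G (T - H) v q" for v q using f forest_iff[OF sub] by blast
      show "z = z'" if z: "z \<in> ?Z" "z' \<in> ?Z" "conn G (T - H) z z'" for z z'
      proof -
        have "z \<in> X" using z(1) ZX by blast
        from u[OF this] z show ?thesis using conn_refl[of G "T - H" z] by blast
      qed
    qed
    moreover have "connected_graph G X T"
    proof -
      obtain z where z: "z \<in> ?Z" using assms(5) by blast
      have "conn G T z x" if x: "x \<in> X" for x
      proof -
        obtain v where v: "v \<in> ?Z" "conn G (T - H) x v" using u[OF x] by blast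
        have "conn G T z v"
          by (rule conn_mono[OF _ assms(4)]) (use assms(6) z v(1) in \<open>auto simp: connected_graph_conn\<close>)
        moreover have "conn G T v x" using conn_sym[OF conn_mono[OF v(2)]] by blast
        ultimately show ?thesis by (rule conn_trans)
      qed
      then show ?thesis by (rule connected_graphI)
    qed
    ultimately show "connected_graph G X T \<and> card X + card H = card ?Z + card T" using cTH by simp
  next
    assume c: "connected_graph G X T \<and> card X + card H = card ?Z + card T"
    have roots: "\<exists>z\<in>?Z. conn G (T - H) x z" if x: "x \<in> X" for x
    proof -
      obtain z where z: "z \<in> ?Z" using assms(5) by blast
      then have "conn G ((T - H) \<union> H) x z"
        using c ZX assms(4) x by (auto simp: connected_graph_conn Un_absorb2)
      then show ?thesis by (rule conn_edges_avoid[OF _ z])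
    qed
    have card: "card X = card ?Z + card (T - H)" using c cTH by simp
    note eq = card_eq_roots[OF fin(3,4) roots card]
    have "\<exists>!v. v \<in> ?Z \<and> conn G (T - H) x v" if x: "x \<in> X" for x
    proof -
      obtain z where z: "z \<in> ?Z" "conn G (T - H) x z" using roots[OF x] by blast
      have "y = z" if "y \<in> ?Z \<and> conn G (T - H) x y" for y
        using eq(3)[of y z] conn_trans[OF conn_sym z(2), of y] that z(1) by blast
      then show ?thesis using z by blast
    qed
    moreover have "forest G (T - H)" unfolding forest_iff[OF sub] using eq(1,2) by auto
    ultimately show "with_trees G H X T"
      unfolding with_trees_def comps using assms(3,4) by blast
  qed
qed

section \<open>Graphs with more edges than vertices\<close>

lemma connected_remove_figure_edge:
  assumes "connected_graph G X T" "figure G F" "F \<subseteq> T" "e \<in> F"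
  shows "connected_graph G X (T - {e})"
  unfolding connected_graph_conn
proof (intro ballI)
  fix u w assume "u \<in> X" "w \<in> X"
  then have "conn G T u w" using assms(1) by (auto simp: connected_graph_conn)
  then show "conn G (T - {e}) u w" by (rule figure_remove_edge[OF assms(2,4,3)])
qed

text \<open>The connecting path is a shortest one inside \<open>S\<close>. As \<open>S\<close> joins
  no two vertices of \<open>F\<close> while \<open>F2\<close> is connected within \<open>S\<close>,
  a common vertex of the figures can only be \<open>u\<close>; then \<open>u = w\<close> and the
  path is trivial.\<close>

lemma figure_handcuff:
  assumes "figure G F" "figure G F2" "F2 \<inter> F = {}" "S \<subseteq> edges G" "F2 \<subseteq> S"
    and conn_F2: "\<And>x. x \<in> edge_verts G F2 \<Longrightarrow> \<exists>z\<in>edge_verts G F. conn G S x z"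
    and distinct: "\<And>z z'. z \<in> edge_verts G F \<Longrightarrow> z' \<in> edge_verts G F \<Longrightarrow> conn G S z z' \<Longrightarrow> z = z'"
  shows "\<exists>u p w. handcuff_parts G F u p w F2 \<and> walk_edges p \<subseteq> S"
proof -
  let ?Z = "edge_verts G F" and ?D = "edge_verts G F2"
  have conn2: "conn G S x y" if "x \<in> ?D" "y \<in> ?D" for x y
    by (rule conn_mono[OF _ assms(5)])
      (use figure_connected[OF assms(2)] that in \<open>auto simp: connected_graph_conn\<close>)
  obtain d where d: "d \<in> ?D" using figure_verts_nonempty[OF assms(2)] by blast
  obtain z where z: "z \<in> ?Z" "conn G S d z" using conn_F2[OF d] by blast
  obtain u p w where p: "u \<in> ?Z" "w \<in> ?D" "path G S u p w"
    "set (walk_verts G u p) \<inter> ?Z = {u}" "set (walk_verts G u p) \<inter> ?D = {w}"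
    by (rule conn_between_sets[OF conn_sym[OF z(2)] z(1) d])
  have uw: "conn G S u w" using p(3) by (auto simp: path_def conn_def)
  have at_u: "x = u" if x: "x \<in> ?Z" "x \<in> ?D" for x
    using distinct[OF p(1) x(1) conn_trans[OF uw conn2[OF p(2) x(2)]]] by simp
  have "?Z \<inter> ?D \<subseteq> {u}" using at_u by blast
  then have "card (?Z \<inter> ?D) \<le> 1" using card_mono[of "{u}" "?Z \<inter> ?D"] by simp
  moreover have "p = []" if ne: "?Z \<inter> ?D \<noteq> {}"
  proof -
    have "u \<in> ?D" using ne at_u by auto
    then have "u = w" by (rule path_between_figures(3)[OF p(3,4,5)])
    then show ?thesis using p(3) by (auto dest: path_self)
  qed
  moreover have "F \<noteq> F2" using assms(3) figure_nonempty[OF assms(1)] by blast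
  ultimately have "handcuff_parts G F u p w F2"
    using assms(1,2) p path_mono[OF p(3) assms(4)] by (simp add: handcuff_parts_def)
  then show ?thesis using p(3) walk_edges_subset[of G S u p w] by (auto simp: path_def)
qed

text \<open>The edges outside \<open>F\<close> are too many to form trees rooted in \<open>F\<close>: they contain either an ear of
  \<open>F\<close> or a second figure.\<close>

lemma bicyclic_structure:
  assumes "T \<subseteq> edges G" "finite X" "edge_verts G T \<subseteq> X" "no_loose_edges G T"
    "connected_graph G X T" "card X < card T" "figure G F" "F \<subseteq> T"
  obtains (handcuff) F2 u p w where "figure G F2" "F2 \<subseteq> T" "walk_edges p \<subseteq> T"
      "handcuff_parts G F u p w F2"
  | (theta) u w p q r where "u \<noteq> w" "path G (edges G) u p w" "path G (edges G) u q w"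
      "path G (edges G) u r w" "internally_disjoint G u w p q" "internally_disjoint G u w p r"
      "internally_disjoint G u w q r" "circle G F" "F = walk_edges q \<union> walk_edges r"
      "walk_edges p \<subseteq> T" "walk_edges p \<inter> F = {}"
proof -
  let ?Z = "edge_verts G F" and ?S = "T - F"
  have fin: "finite T" "finite F"
    using finite_subset_edges[OF assms(1)] finite_subset[OF assms(8)] by auto
  have ZX: "?Z \<subseteq> X" using assms(3) edge_verts_mono[OF assms(8), of G] by blast
  have subE: "?S \<subseteq> edges G" using assms(1) by blast
  have evS: "edge_verts G ?S \<subseteq> X" using assms(3) edge_verts_mono[of ?S T G] by blast
  have roots: "\<exists>z\<in>?Z. conn G ?S x z" if x: "x \<in> X" for x
  proof -
    obtain z where z: "z \<in> ?Z" using figure_verts_nonempty[OF assms(7)] by blast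
    then have "conn G (?S \<union> F) x z"
      using assms(5,8) ZX x by (auto simp: connected_graph_conn Un_absorb2)
    then show ?thesis by (rule conn_edges_avoid[OF _ z])
  qed
  \<comment> \<open>\<open>F\<close> has as many edges as vertices, so equality here would mean that
    \<open>T\<close> has no more edges than \<open>X\<close> has vertices.\<close>
  have card: "card X \<noteq> card ?Z + card ?S"
    using card_Diff_add[OF fin(1) assms(8)] assms(6) figure_card[OF assms(7)] by simp
  show ?thesis
  proof (cases "\<exists>z\<in>?Z. \<exists>z'\<in>?Z. z \<noteq> z' \<and> conn G ?S z z'")
    case True
    then obtain a d where ad: "a \<in> ?Z" "d \<in> ?Z" "a \<noteq> d" "conn G ?S a d" by blast
    obtain u p w where p: "u \<in> ?Z" "w \<in> ?Z" "u \<noteq> w" "path G ?S u p w"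
      "set (walk_verts G u p) \<inter> ?Z = {u, w}"
      by (rule conn_within_set[OF ad(4,1,2,3)])
    \<comment> \<open>The ear ends at two different vertices of \<open>F\<close>, and a half edge
      has only one.\<close>
    have c: "circle G F"
      using assms(7)
    proof (cases rule: figureE)
      case (half e v)
      then show ?thesis using p(1-3) by simp
    qed
    have sub: "F \<subseteq> edges G" using circleD(2)[OF c] .
    obtain q r where qr: "path G F u q w" "path G F u r w" "internally_disjoint G u w q r"
      "walk_edges q \<union> walk_edges r = F"
      by (rule circle_two_paths[OF c fin(2) p(1,2,3)])
    have pS: "walk_edges p \<subseteq> ?S" using p(4) walk_edges_subset[of G ?S u p w] by (simp add: path_def)
    have id: "internally_disjoint G u w p s" if s: "path G F u s w" for s
    proof -
      have w: "walk G F u s w" using s by (simp add: path_def)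
      have "walk_edges s \<subseteq> F" by (rule walk_edges_subset[OF w])
      moreover have "set (walk_verts G u s) \<subseteq> ?Z"
        using walk_verts_edge_verts[OF w] edge_verts_mono[OF walk_edges_subset[OF w], of G] p(1) by simp
      moreover have "u \<in> set (walk_verts G u s)" "w \<in> set (walk_verts G u s)"
        using walk_end_in[OF w] by (simp_all add: walk_verts_target)
      ultimately show ?thesis using p(5) pS unfolding internally_disjoint_def by blast
    qed
    show ?thesis
      by (rule theta[of u w p q r])
        (use p(3) path_mono[OF p(4) subE] path_mono[OF qr(1) sub] path_mono[OF qr(2) sub]
          id[OF qr(1)] id[OF qr(2)] qr(3,4) c pS in auto)
  next
    case False
    then have dist: "\<And>z z'. z \<in> ?Z \<Longrightarrow> z' \<in> ?Z \<Longrightarrow> conn G ?S z z' \<Longrightarrow> z = z'" by blast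
    have "\<exists>F2. figure G F2 \<and> F2 \<subseteq> ?S"
    proof (rule ccontr)
      assume no: "\<not> ?thesis"
      have ord: "ordinary_edge G e" if e: "e \<in> ?S" for e
      proof (rule ccontr)
        assume "\<not> ordinary_edge G e"
        then have "half_edge G e" using edge_kinds[of e] assms(1,4) e unfolding no_loose_edges_def by blast
        then have "figure G {e}" using subE e by (auto simp: figure_def half_edge_figure_def)
        then show False using no e by blast
      qed
      have acyc: "\<not> cycle G ?S v q" for v q
        using circle_in_iff_cycle[OF subE] no by (auto simp: figure_def)
      have "card X = card ?Z + card ?S"
        by (rule acyclic_card_roots[OF _ assms(2) ZX evS roots ord acyc dist]) (use fin in auto)
      then show False using card by simp
    qed
    then obtain F2 where F2: "figure G F2" "F2 \<subseteq> ?S" by blast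
    have F2X: "x \<in> X" if "x \<in> edge_verts G F2" for x
      using evS edge_verts_mono[OF F2(2), of G] that by blast
    obtain u p w where "handcuff_parts G F u p w F2" "walk_edges p \<subseteq> ?S"
      using figure_handcuff[OF assms(7) F2(1) _ subE F2(2) roots[OF F2X] dist] F2(2) by blast
    then show ?thesis using F2 by (intro handcuff[of F2 p u w]) auto
  qed
qed

lemma bicyclic_theta_or_handcuff:
  assumes "T \<subseteq> edges G" "finite X" "edge_verts G T \<subseteq> X" "no_loose_edges G T"
    "connected_graph G X T" "card X < card T" "figure G F" "F \<subseteq> T"
  obtains H where "H \<subseteq> T" "theta_graph G H \<or> handcuff G H"
proof (cases rule: bicyclic_structure[OF assms, case_names handcuff theta])
  case (handcuff F2 u p w)
  then have "handcuff G (F \<union> walk_edges p \<union> F2)" unfolding handcuff_def by blast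
  then show ?thesis using that[of "F \<union> walk_edges p \<union> F2"] handcuff assms(8) by blast
next
  case (theta u w p q r)
  then have "theta_graph G (walk_edges p \<union> walk_edges q \<union> walk_edges r)"
    unfolding theta_graph_def by blast
  then show ?thesis using that[of "walk_edges p \<union> walk_edges q \<union> walk_edges r"] theta assms(8) by blast
qed

text \<open>In the handcuff case the second figure is a positive circle or a second negative figure.
  In the theta case \<open>F\<close> is a negative circle, so its two paths differ in sign, and the
  third path agrees in sign with one of them; these two form a positive circle.\<close>

lemma bicyclic_sign_circuit:
  assumes "T \<subseteq> edges G" "finite X" "edge_verts G T \<subseteq> X" "no_loose_edges G T"
    "connected_graph G X T" "card X < card T" "negative_figure G F" "F \<subseteq> T"
  obtains C where "C \<subseteq> T" "sign_circuit G C"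
proof (cases rule: bicyclic_structure[OF assms(1-6) negative_figure_figure[OF assms(7)] assms(8),
    case_names handcuff theta])
  case (handcuff F2 u p w)
  show ?thesis
  proof (cases "positive_circle G F2")
    case True
    then show ?thesis using that handcuff by (auto simp: sign_circuit_def)
  next
    case False
    then have "negative_figure G F2"
      using handcuff(1) circle_sign[of F2] by (auto simp: figure_def negative_figure_def)
    then have "sign_circuit G (F \<union> walk_edges p \<union> F2)"
      using handcuff(4) assms(7) unfolding sign_circuit_def by blast
    then show ?thesis using that[of "F \<union> walk_edges p \<union> F2"] handcuff assms(8) by blast
  qed
next
  case (theta u w p q r)
  have neg: "prod (sign G) F = -1"
  proof -
    have "\<not> half_edge_figure G F"
      using theta(8) circleD(3)[OF theta(8)] kinds_disjoint(1) by (auto simp: half_edge_figure_def)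
    then show ?thesis using assms(7) by (simp add: negative_figure_def negative_circle_def)
  qed
  have "walk_edges q \<inter> walk_edges r = {}" using theta(7) by (simp add: internally_disjoint_def)
  then have "prod (sign G) (walk_edges q) * prod (sign G) (walk_edges r) = -1"
    using neg theta(9) prod.union_disjoint[of "walk_edges q" "walk_edges r" "sign G"] by simp
  moreover have "walk_edges s \<subseteq> edges G" if "s \<in> {p, q, r}" for s
    using theta(2-4) that walk_edges_subset[of G "edges G" u s w] by (auto simp: path_def)
  then have "prod (sign G) (walk_edges s) = 1 \<or> prod (sign G) (walk_edges s) = -1"
    if "s \<in> {p, q, r}" for s using prod_sign_pm[of "walk_edges s"] that by simp
  from this[of p] this[of q] this[of r]
  have "prod (sign G) (walk_edges p) = 1 \<or> prod (sign G) (walk_edges p) = -1"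
    "prod (sign G) (walk_edges q) = 1 \<or> prod (sign G) (walk_edges q) = -1"
    "prod (sign G) (walk_edges r) = 1 \<or> prod (sign G) (walk_edges r) = -1" by simp_all
  ultimately have "prod (sign G) (walk_edges p) * prod (sign G) (walk_edges q) = 1 \<or>
    prod (sign G) (walk_edges p) * prod (sign G) (walk_edges r) = 1" by auto
  then obtain s where s: "s \<in> {q, r}"
    "prod (sign G) (walk_edges p) * prod (sign G) (walk_edges s) = 1" by blast
  have s': "path G (edges G) u s w" "internally_disjoint G u w p s" using s(1) theta(3-6) by auto
  have "circle G (walk_edges (p @ reverse_walk s))"
    by (rule cycle_imp_circle(1)[OF two_paths_cycle[OF theta(2) s' theta(1)] subset_refl])
  moreover have "walk_edges p \<inter> walk_edges s = {}" using s'(2) by (simp add: internally_disjoint_def)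
  ultimately have "positive_circle G (walk_edges p \<union> walk_edges s)"
    using s(2) by (simp add: positive_circle_def prod.union_disjoint)
  moreover have "walk_edges p \<union> walk_edges s \<subseteq> T" using theta(9,10) s(1) assms(8) by blast
  ultimately show ?thesis
    using that[of "walk_edges p \<union> walk_edges s"] by (simp add: sign_circuit_def)
qed

text \<open>Balance rules out half edges, so all edges are links or loops; they are too many for a
  tree, and the resulting circle is positive by balance.\<close>

lemma unicyclic_positive_circle:
  assumes "T \<subseteq> edges G" "finite X" "X \<noteq> {}" "edge_verts G T \<subseteq> X" "no_loose_edges G T"
    "connected_graph G X T" "card X \<le> card T" "sign_balanced G T"
  obtains C where "C \<subseteq> T" "positive_circle G C"
proof -
  obtain x where x: "x \<in> X" using assms(3) by blast
  have ord: "ordinary_edge G e" if "e \<in> T" for e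
    using edge_kinds[of e] assms(1,5,8) that by (auto simp: sign_balanced_def no_loose_edges_def)
  have "\<exists>C\<subseteq>T. circle G C"
  proof (rule ccontr)
    assume "\<not> ?thesis"
    then have acyc: "\<not> cycle G T v q" for v q using circle_in_iff_cycle[OF assms(1)] by blast
    have "card X = card {x} + card T"
      by (rule acyclic_card_roots[OF finite_subset_edges[OF assms(1)] assms(2) _ assms(4) _ ord acyc])
        (use x assms(6) in \<open>auto simp: connected_graph_conn\<close>)
    then show False using assms(7) by simp
  qed
  then show ?thesis using that circle_sign assms(8) unfolding sign_balanced_def by blast
qed

section \<open>Unicycles, theta graphs and handcuffs with trees as cardinality conditions\<close>

lemma not_sign_balanced_iff:
  "S \<subseteq> edges G \<Longrightarrow> \<not> sign_balanced G S \<longleftrightarrow> (\<exists>F\<subseteq>S. negative_figure G F)"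
  unfolding sign_balanced_def negative_figure_def half_edge_figure_def by blast

lemma unbalanced_unicycle_iff:
  assumes "T \<subseteq> edges G" "finite X" "edge_verts G T \<subseteq> X"
  shows "unbalanced_unicycle G X T \<longleftrightarrow>
    connected_graph G X T \<and> card X = card T \<and> \<not> sign_balanced G T"
proof
  assume "unbalanced_unicycle G X T"
  then obtain F where F: "negative_figure G F" "with_trees G F X T"
    by (auto simp: unbalanced_unicycle_def)
  have f: "figure G F" using negative_figure_figure[OF F(1)] .
  have sub: "F \<subseteq> T" using F(2) by (simp add: with_trees_def)
  show "connected_graph G X T \<and> card X = card T \<and> \<not> sign_balanced G T"
    using F(2) sub F(1) with_trees_iff[OF assms sub figure_verts_nonempty[OF f] figure_connected[OF f]]
      not_sign_balanced_iff[OF assms(1)] figure_card[OF f] by auto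
next
  assume a: "connected_graph G X T \<and> card X = card T \<and> \<not> sign_balanced G T"
  then obtain F where F: "F \<subseteq> T" "negative_figure G F" using not_sign_balanced_iff[OF assms(1)] by blast
  have f: "figure G F" using negative_figure_figure[OF F(2)] .
  have "with_trees G F X T"
    using with_trees_iff[OF assms F(1) figure_verts_nonempty[OF f] figure_connected[OF f]] a
      figure_card[OF f] by simp
  then show "unbalanced_unicycle G X T" using F(2) by (auto simp: unbalanced_unicycle_def)
qed

lemma theta_or_handcuff_with_trees_iff:
  assumes "T \<subseteq> edges G" "finite X" "edge_verts G T \<subseteq> X" "no_loose_edges G T"
  shows "(\<exists>H. (theta_graph G H \<or> handcuff G H) \<and> (\<exists>F\<subseteq>H. negative_figure G F) \<and> with_trees G H X T)
    \<longleftrightarrow> connected_graph G X T \<and> card T = Suc (card X) \<and> \<not> sign_balanced G T"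
proof -
  have count: "H \<subseteq> edges G" "edge_verts G H \<noteq> {}" "connected_graph G (edge_verts G H) H"
    "card H = Suc (card (edge_verts G H))" if "theta_graph G H \<or> handcuff G H" for H
    using that theta_count[of H] handcuff_count[of _ _ _ _ _ H] unfolding handcuff_def by metis+
  show ?thesis
  proof
    assume "\<exists>H. (theta_graph G H \<or> handcuff G H) \<and> (\<exists>F\<subseteq>H. negative_figure G F) \<and> with_trees G H X T"
    then obtain H F where H: "theta_graph G H \<or> handcuff G H" "F \<subseteq> H" "negative_figure G F"
      "with_trees G H X T" by blast
    have sub: "H \<subseteq> T" using H(4) by (simp add: with_trees_def)
    show "connected_graph G X T \<and> card T = Suc (card X) \<and> \<not> sign_balanced G T"
      using H(2-4) sub with_trees_iff[OF assms(1-3) sub count(2,3)[OF H(1)]] count(4)[OF H(1)]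
        not_sign_balanced_iff[OF assms(1)] by auto
  next
    assume a: "connected_graph G X T \<and> card T = Suc (card X) \<and> \<not> sign_balanced G T"
    then obtain F where F: "F \<subseteq> T" "negative_figure G F" using not_sign_balanced_iff[OF assms(1)] by blast
    have f: "figure G F" using negative_figure_figure[OF F(2)] .
    obtain H where H: "H \<subseteq> T" "theta_graph G H \<or> handcuff G H"
      using bicyclic_theta_or_handcuff[OF assms _ _ f F(1)] a by auto
    have fin: "finite T" using finite_subset_edges[OF assms(1)] .
    have "with_trees G H X T"
      using with_trees_iff[OF assms(1-3) H(1) count(2,3)[OF H(2)]] a count(4)[OF H(2)] by simp
    \<comment> \<open>Deleting an edge of \<open>F\<close> outside \<open>H\<close> would keep the
      graph connected and leave as many edges as vertices, while \<open>H\<close> alone already has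
      one edge more than vertices.\<close>
    moreover have "F \<subseteq> H"
    proof (rule ccontr)
      assume "\<not> F \<subseteq> H"
      then obtain e where e: "e \<in> F" "e \<notin> H" by blast
      have "connected_graph G X (T - {e})"
        using connected_remove_figure_edge[OF _ f F(1) e(1)] a by blast
      moreover have "edge_verts G (T - {e}) \<subseteq> X" using assms(3) edge_verts_mono[of "T - {e}" T G] by blast
      moreover have "H \<subseteq> T - {e}" using H(1) e(2) by blast
      ultimately have "card X + card H \<le> card (edge_verts G H) + card (T - {e})"
        using connected_card_bound[of "T - {e}" X H] fin count(2)[OF H(2)] by simp
      moreover have "card (T - {e}) = card X" using a e(1) F(1) fin by auto
      ultimately show False using count(4)[OF H(2)] by simp
    qed
    ultimately show "\<exists>H. (theta_graph G H \<or> handcuff G H) \<and> (\<exists>F\<subseteq>H. negative_figure G F) \<and> with_trees G H X T"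
      using H(2) F(2) by blast
  qed
qed

lemma balanced_unicycle_iff:
  assumes "T \<subseteq> edges G" "finite X" "edge_verts G T \<subseteq> X" "C \<subseteq> T" "positive_circle G C"
  shows "with_trees G C X T \<longleftrightarrow> connected_graph G X T \<and> card X = card T"
proof -
  have f: "figure G C" using assms(5) by (simp add: figure_def positive_circle_def)
  show ?thesis
    using with_trees_iff[OF assms(1-4) figure_verts_nonempty[OF f] figure_connected[OF f]]
      figure_card[OF f] by simp
qed

end

subsection \<open>Circuit gains as linear functionals\<close>

text \<open>\<open>edge_val G \<theta> e\<close> pairs the potential \<open>\<theta>\<close> with the vector \<open>\<Sum>\<tau>(v,e) v\<close> of \<open>e\<close>.\<close>

definition edge_val :: "('v, 'e, 'k::field) gsgraph \<Rightarrow> ('v \<Rightarrow> 'k) \<Rightarrow> 'e \<Rightarrow> 'k" where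
  "edge_val G \<theta> e = (\<Sum>i<length (ends G e). of_int (orient G e i) * \<theta> (ends G e ! i))"

text \<open>Horner form of the walk gain, with the gains replaced by an arbitrary edge function
  \<open>x\<close>. Since it is linear in \<open>x\<close>, one expression can be evaluated both at
  the gains and at a potential.\<close>

fun gain_along :: "('v, 'e, 'k::field) gsgraph \<Rightarrow> ('e \<Rightarrow> 'k) \<Rightarrow> ('e \<times> nat) list \<Rightarrow> 'k" where
  "gain_along G x [] = 0"
| "gain_along G x (s # p) =
     - (x (fst s) * of_int (orient G (fst s) (snd s))) + of_int (sign G (fst s)) * gain_along G x p"

section \<open>Signs and gains of walks as linear expressions\<close>

lemma walk_sign_Nil [simp]: "walk_sign G [] = 1"
  by (simp add: walk_sign_def)

lemma walk_sign_Cons [simp]: "walk_sign G (s # p) = sign G (fst s) * walk_sign G p"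
  by (cases s) (simp add: walk_sign_def)

lemma walk_sign_append [simp]: "walk_sign G (p @ q) = walk_sign G p * walk_sign G q"
  by (induction p) (simp_all add: mult.assoc)

lemma walk_sign_reverse [simp]: "walk_sign G (reverse_walk p) = walk_sign G p"
  by (induction p) (simp_all add: reverse_walk_Cons mult.commute)

lemma walk_sign_prod: "distinct (map fst p) \<Longrightarrow> walk_sign G p = prod (sign G) (walk_edges p)"
proof (induction p)
  case (Cons s p)
  then have "fst s \<notin> walk_edges p" by (auto simp: walk_edges_def)
  then show ?case using Cons by simp
qed simp

lemma walk_gain_along: "walk_gain G p = gain_along G (gain G) p"
proof (induction p)
  case Nil
  then show ?case by (simp add: walk_gain_def)
next
  case (Cons s p)
  have "walk_gain G (s # p) = - (gain G (fst s) * of_int (orient G (fst s) (snd s))) +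
    of_int (sign G (fst s)) * walk_gain G p"
    unfolding walk_gain_def
    by (simp add: sum.lessThan_Suc_shift sum_distrib_left mult_ac del: sum.lessThan_Suc)
  then show ?case using Cons by simp
qed

lemma gain_along_append:
  "gain_along G x (p @ q) = gain_along G x p + of_int (walk_sign G p) * gain_along G x q"
  by (induction p) (simp_all add: algebra_simps)

text \<open>Glues the coefficients on the two figures and the path of a handcuff into one function
  on its edges.\<close>

lemma sum_three:
  fixes x :: "'a \<Rightarrow> 'b::comm_semiring_0"
  assumes "finite A" "finite B" "finite D" "A \<inter> D = {}" "A \<inter> B = {}" "D \<inter> B = {}"
  shows "(\<Sum>f\<in>A \<union> B \<union> D. (if f \<in> A then a f else if f \<in> B then b f else d f) * x f)
    = (\<Sum>f\<in>A. a f * x f) + (\<Sum>f\<in>B. b f * x f) + (\<Sum>f\<in>D. d f * x f)"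
proof -
  let ?g = "\<lambda>f. (if f \<in> A then a f else if f \<in> B then b f else d f) * x f"
  have "sum ?g (A \<union> B \<union> D) = sum ?g A + sum ?g B + sum ?g D"
    using assms by (subst sum.union_disjoint; (subst sum.union_disjoint)?) auto
  moreover have "sum ?g A = (\<Sum>f\<in>A. a f * x f)" by (rule sum.cong) auto
  moreover have "sum ?g B = (\<Sum>f\<in>B. b f * x f)" using assms by (intro sum.cong) auto
  moreover have "sum ?g D = (\<Sum>f\<in>D. d f * x f)" using assms by (intro sum.cong) auto
  ultimately show ?thesis by simp
qed

context gain_signed
begin

lemma orient_pm: "e \<in> edges G \<Longrightarrow> i < length (ends G e) \<Longrightarrow> orient G e i = 1 \<or> orient G e i = -1"
  using gsg by (auto simp: gain_signed_graph_def)

lemma half_orient_pm: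
  assumes "e \<in> edges G" "half_edge G e"
  shows "(of_int (orient G e 0) :: 'a::ring_1) = 1 \<or> (of_int (orient G e 0) :: 'a) = -1"
proof -
  have "orient G e 0 = 1 \<or> orient G e 0 = -1"
    using orient_pm[OF assms(1), of 0] half_ends[OF assms(2)] by auto
  then show ?thesis by auto
qed

lemma orient_other_end:
  assumes "e \<in> edges G" "ordinary_edge G e" "i < 2"
  shows "orient G e (1 - i) = - sign G e * orient G e i"
proof -
  have o: "orient G e 0 * orient G e 1 = - sign G e"
    using gsg assms(1,2) by (auto simp: gain_signed_graph_def)
  have "orient G e 0 = 1 \<or> orient G e 0 = -1" "orient G e 1 = 1 \<or> orient G e 1 = -1"
    using orient_pm[OF assms(1)] assms(2) by (auto simp: ordinary_edge_def)
  moreover have "i = 0 \<or> i = 1" using assms(3) by auto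
  ultimately show ?thesis using o by auto
qed

lemma sign_square: "e \<in> edges G \<Longrightarrow> (of_int (sign G e) :: 'a::comm_ring_1) * of_int (sign G e) = 1"
  using sign_pm[of e] by auto

lemma walk_sign_pm: "walk_edges p \<subseteq> edges G \<Longrightarrow> walk_sign G p = 1 \<or> walk_sign G p = -1"
proof (induction p)
  case (Cons s p)
  then show ?case using sign_pm[of "fst s"] by auto
qed simp

text \<open>This is the value that gives a walk followed by its reverse the gain
  \<open>0\<close>.\<close>

lemma gain_along_reverse:
  assumes "walk G (edges G) u p w"
  shows "gain_along G x (reverse_walk p) = - (of_int (walk_sign G p) * gain_along G x p)"
  using assms
proof (induction p arbitrary: u)
  case (Cons s p)
  have s: "fst s \<in> edges G" "ordinary_edge G (fst s)" "snd s < 2" "walk G (edges G) (target G s) p w"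
    using Cons.prems by (simp_all del: walk.simps(2) add: walk_Cons)
  let ?\<sigma> = "of_int (sign G (fst s)) :: 'k" and ?\<tau> = "of_int (orient G (fst s) (snd s)) :: 'k"
    and ?W = "of_int (walk_sign G p) :: 'k"
  have "gain_along G x (reverse_walk (s # p)) = - (?W * gain_along G x p) + ?W * (?\<sigma> * (?\<tau> * x (fst s)))"
    using Cons.IH[OF s(4)] orient_other_end[OF s(1-3)]
    by (simp add: reverse_walk_Cons gain_along_append mult_ac)
  also have "\<dots> = - (?\<sigma> * ?W * (- (x (fst s) * ?\<tau>) + ?\<sigma> * gain_along G x p))"
  proof -
    have "?\<sigma> * ?W * (?\<sigma> * gain_along G x p) = (?\<sigma> * ?\<sigma>) * (?W * gain_along G x p)" by (simp add: mult_ac)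
    then show ?thesis using sign_square[OF s(1), where 'a='k] by (simp add: algebra_simps)
  qed
  finally show ?case by simp
qed simp

lemma edge_val_ordinary:
  assumes "ordinary_edge G e"
  shows "edge_val G \<theta> e = of_int (orient G e 0) * \<theta> (ends G e ! 0) + of_int (orient G e 1) * \<theta> (ends G e ! 1)"
  using assms by (simp add: edge_val_def ordinary_edge_def numeral_2_eq_2)

lemma edge_val_half:
  "half_edge G e \<Longrightarrow> edge_val G \<theta> e = of_int (orient G e 0) * \<theta> (ends G e ! 0)"
  by (simp add: edge_val_def half_edge_def)

lemma edge_val_loose: "loose_edge G e \<Longrightarrow> edge_val G \<theta> e = 0"
  by (simp add: edge_val_def loose_edge_def)

lemma edge_val_step:
  assumes "fst s \<in> edges G" "ordinary_edge G (fst s)" "snd s < 2"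
  shows "edge_val G \<theta> (fst s) * of_int (orient G (fst s) (snd s)) =
    \<theta> (source G s) - of_int (sign G (fst s)) * \<theta> (target G s)"
proof -
  let ?i = "snd s"
  have i: "?i = 0 \<or> ?i = 1" using assms(3) by auto
  have "orient G (fst s) ?i = 1 \<or> orient G (fst s) ?i = -1"
    using orient_pm[OF assms(1)] assms(2,3) by (simp add: ordinary_edge_def)
  moreover have "edge_val G \<theta> (fst s) =
    of_int (orient G (fst s) ?i) * \<theta> (source G s) + of_int (orient G (fst s) (1 - ?i)) * \<theta> (target G s)"
    using i edge_val_ordinary[OF assms(2)] by (auto simp: source_def target_def)
  ultimately show ?thesis using orient_other_end[OF assms] by (auto simp: algebra_simps)
qed

text \<open>The sum telescopes: by \<open>edge_val_step\<close> each step contributes the difference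
  of the potential at its two ends, the far one multiplied by the sign of the edge. Hence a closed
  walk of sign 1 gives \<open>0\<close>.\<close>

lemma gain_along_edge_val:
  assumes "walk G (edges G) u p w"
  shows "gain_along G (edge_val G \<theta>) p = of_int (walk_sign G p) * \<theta> w - \<theta> u"
  using assms
proof (induction p arbitrary: u)
  case (Cons s p)
  have s: "fst s \<in> edges G" "ordinary_edge G (fst s)" "snd s < 2" "source G s = u"
    "walk G (edges G) (target G s) p w"
    using Cons.prems by (simp_all del: walk.simps(2) add: walk_Cons)
  show ?case
    unfolding gain_along.simps Cons.IH[OF s(5)] edge_val_step[OF s(1-3)] s(4) walk_sign_Cons
    by (simp add: algebra_simps)
qed simp

text \<open>Each edge is traversed once, so its coefficient is a single product of signs and no two
  contributions can cancel.\<close>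

lemma trail_coefficients:
  assumes "walk G (edges G) u p w" "distinct (map fst p)"
  shows "\<exists>c. (\<forall>f. c f = 1 \<or> c f = -1) \<and> (\<forall>x. gain_along G x p = (\<Sum>f\<in>walk_edges p. c f * x f))"
  using assms
proof (induction p arbitrary: u)
  case Nil
  then show ?case by (intro exI[of _ "\<lambda>_. 1"]) simp
next
  case (Cons s p)
  have s: "fst s \<in> edges G" "ordinary_edge G (fst s)" "snd s < 2" "walk G (edges G) (target G s) p w"
    using Cons.prems by (simp_all del: walk.simps(2) add: walk_Cons)
  obtain c where c: "\<And>f. c f = 1 \<or> c f = -1"
    "\<And>x. gain_along G x p = (\<Sum>f\<in>walk_edges p. c f * x f)"
    using Cons.IH[OF s(4)] Cons.prems(2) by auto
  have n: "fst s \<notin> walk_edges p" using Cons.prems(2) by (auto simp: walk_edges_def)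
  let ?c = "\<lambda>f. if f = fst s then - of_int (orient G (fst s) (snd s)) else of_int (sign G (fst s)) * c f"
  have "orient G (fst s) (snd s) = 1 \<or> orient G (fst s) (snd s) = -1"
    using orient_pm[OF s(1)] s(2,3) by (simp add: ordinary_edge_def)
  then have "?c f = 1 \<or> ?c f = -1" for f using c(1)[of f] sign_pm[OF s(1)] by auto
  moreover have "gain_along G x (s # p) = (\<Sum>f\<in>walk_edges (s # p). ?c f * x f)" for x
  proof -
    have "(\<Sum>f\<in>walk_edges p. ?c f * x f) = (\<Sum>f\<in>walk_edges p. of_int (sign G (fst s)) * (c f * x f))"
      using n by (intro sum.cong) auto
    also have "\<dots> = of_int (sign G (fst s)) * gain_along G x p"
      unfolding c(2) by (rule sum_distrib_left[symmetric])
    finally show ?thesis using n by (simp add: mult.commute)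
  qed
  ultimately show ?case by (intro exI[of _ ?c]) blast
qed

lemma once_around_coefficients:
  assumes "circle G C" "once_around G C u q"
  shows "\<exists>c. (\<forall>f. c f = 1 \<or> c f = -1) \<and> (\<forall>x. gain_along G x q = (\<Sum>f\<in>C. c f * x f))"
    "walk_sign G q = prod (sign G) C" "walk G (edges G) u q u"
proof -
  have q: "walk G C u q u" "distinct (map fst q)" "walk_edges q = C"
    using assms(2) by (auto simp: once_around_def)
  show w: "walk G (edges G) u q u" using walk_mono[OF q(1) circleD(2)[OF assms(1)]] .
  show "\<exists>c. (\<forall>f. c f = 1 \<or> c f = -1) \<and> (\<forall>x. gain_along G x q = (\<Sum>f\<in>C. c f * x f))"
    using trail_coefficients[OF w q(2)] q(3) by simp
  show "walk_sign G q = prod (sign G) C" using walk_sign_prod[OF q(2)] q(3) by simp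
qed

text \<open>\<open>circuit_gain\<close> has a rule only for a half edge as the first figure and a
  circle as the second; the opposite order is reached by reversing the path.\<close>

lemma handcuff_sym:
  assumes "handcuff_parts G C1 u p w C2"
  shows "handcuff_parts G C2 w (reverse_walk p) u C1"
proof -
  have "path G (edges G) u p w" using assms by (simp add: handcuff_parts_def)
  then have "path G (edges G) w (reverse_walk p) u"
    "set (walk_verts G w (reverse_walk p)) = set (walk_verts G u p)"
    using path_reverse[of G "edges G" u p w] walk_verts_reverse[of G "edges G" u p w]
    by (auto simp: path_def)
  then show ?thesis using assms by (auto simp: handcuff_parts_def Int_commute)
qed

text \<open>Since \<open>circuit_gain\<close> is a relation, some value has to be exhibited before
  the linear relation of a sign circuit, or its neutrality, can be derived from it.\<close>

lemma sign_circuit_gain_exists: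
  assumes "sign_circuit G C"
  shows "\<exists>g. circuit_gain G C g"
proof -
  have around: "\<exists>q. once_around G D u q" if "circle G D" "u \<in> edge_verts G D" for D u
    using circle_once_around[OF that(1) finite_subset_edges[OF circleD(2)[OF that(1)]] that(2)] by metis
  consider "positive_circle G C" | e where "e \<in> edges G" "loose_edge G e" "C = {e}"
    | C1 u p w C2 where "handcuff_parts G C1 u p w C2" "negative_figure G C1" "negative_figure G C2"
        "C = C1 \<union> walk_edges p \<union> C2"
    using assms unfolding sign_circuit_def by blast
  then show ?thesis
  proof cases
    case 1
    then have c: "circle G C" by (simp add: positive_circle_def)
    obtain u where "u \<in> edge_verts G C" using circle_verts_nonempty[OF c] by blast
    then obtain q where "once_around G C u q" using around[OF c] by blast
    from circuit_gain.circle[OF 1 this] show ?thesis by blast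
  next
    case 2
    from circuit_gain.loose[OF 2(1,2)] show ?thesis unfolding 2(3) by blast
  next
    case 3
    have uw: "u \<in> edge_verts G C1" "w \<in> edge_verts G C2"
      using 3(1) path_between_figures[of G "edges G" u p w "edge_verts G C1" "edge_verts G C2"]
      by (auto simp: handcuff_parts_def)
    have half: "\<exists>g. circuit_gain G ({e} \<union> walk_edges p \<union> D) g"
      if h: "handcuff_parts G {e} u p w D" "half_edge G e" "negative_circle G D" for e u p w D
    proof -
      have "w \<in> edge_verts G D"
        using h(1) path_between_figures(2)[of G "edges G" u p w "edge_verts G {e}" "edge_verts G D"]
        by (auto simp: handcuff_parts_def)
      then obtain q where "once_around G D w q"
        using around[of D w] h(3) by (auto simp: negative_circle_def)
      from circuit_gain.half_circle[OF h this] show ?thesis by blast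
    qed
    consider "negative_circle G C1" "negative_circle G C2"
      | e where "C1 = {e}" "half_edge G e" "negative_circle G C2"
      | e where "negative_circle G C1" "C2 = {e}" "half_edge G e"
      | e f where "C1 = {e}" "half_edge G e" "C2 = {f}" "half_edge G f"
      using 3(2,3) by (auto simp: negative_figure_def half_edge_figure_def)
    then show ?thesis
    proof cases
      case n: 1
      obtain q1 q2 where "once_around G C1 u q1" "once_around G C2 w q2"
        using around[OF _ uw(1)] around[OF _ uw(2)] n by (auto simp: negative_circle_def)
      from circuit_gain.circle_circle[OF 3(1) n this] show ?thesis unfolding 3(4) by blast
    next
      case (2 e)
      then show ?thesis using half[of e u p w C2] 3(1,4) by simp
    next
      case n: (3 e)
      then show ?thesis
        using half[of e w "reverse_walk p" u C1] handcuff_sym[OF 3(1)] 3(4) by (simp add: Un_ac)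
    next
      case (4 e f)
      then show ?thesis
        using circuit_gain.half_half[of G e u p w f] 3(1,4) by auto
    qed
  qed
qed

end

locale gain_signed_char = gain_signed G for G :: "('v, 'e, 'k::field) gsgraph" +
  assumes two_nonzero: "(2::'k) \<noteq> 0"
begin

text \<open>The gain is an expression \<open>F\<close>, linear in the edge function and evaluated at
  \<open>gain G\<close>. At a potential it vanishes: the sum along the walk telescopes, and what is
  left at the two ends cancels, against the half edges where there are any. The coefficients are 1
  or -1, except 2 or -2 on edges that the circuit walk uses twice; these are nonzero because 2
  is.\<close>

lemma circuit_gain_functional:
  assumes "circuit_gain G C g"
  obtains c where "\<And>f. f \<in> C \<Longrightarrow> c f \<noteq> 0" "g = (\<Sum>f\<in>C. c f * gain G f)"
    "\<And>\<theta>. (\<Sum>f\<in>C. c f * edge_val G \<theta> f) = 0"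
proof -
  have "\<exists>c F. (\<forall>f\<in>C. c f \<noteq> 0) \<and> (\<forall>x. F x = (\<Sum>f\<in>C. c f * x f)) \<and> F (gain G) = g \<and>
    (\<forall>\<theta>. F (edge_val G \<theta>) = 0)"
    using assms
  proof cases
    case (loose e)
    then show ?thesis
      by (intro exI[of _ "\<lambda>_. 1"] exI[of _ "\<lambda>x. x e"]) (simp add: edge_val_loose)
  next
    case (circle u p)
    then have c: "circle G C" "walk_sign G p = 1"
      using once_around_coefficients(2)[of C u p] by (auto simp: positive_circle_def)
    note p = once_around_coefficients[OF c(1) circle(3)]
    obtain c' where c': "\<forall>f. c' f = 1 \<or> c' f = -1" "\<forall>x. gain_along G x p = (\<Sum>f\<in>C. c' f * x f)"
      using p(1) by blast
    have nz: "\<forall>f. c' f \<noteq> 0" using c'(1) by (metis neg_equal_0_iff_equal zero_neq_one)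
    show ?thesis
      by (intro exI[of _ c'] exI[of _ "\<lambda>x. gain_along G x p"])
        (use c'(2) nz c(2) circle(1) gain_along_edge_val[OF p(3)] in \<open>simp add: walk_gain_along\<close>)
  next
    case (circle_circle C1 u p w C2 q1 q2)
    have c: "circle G C1" "circle G C2" and neg: "prod (sign G) C1 = -1" "prod (sign G) C2 = -1"
      using circle_circle(4,5) by (auto simp: negative_circle_def)
    have P: "path G (edges G) u p w" using circle_circle(3) by (simp add: handcuff_parts_def)
    then have wp: "walk G (edges G) u p w" "distinct (map fst p)"
      using path_distinct_edges[OF P] by (auto simp: path_def)
    note q1 = once_around_coefficients[OF c(1) circle_circle(6)]
    note q2 = once_around_coefficients[OF c(2) circle_circle(7)]
    obtain c1 where c1: "\<And>f. c1 f = 1 \<or> c1 f = -1" "\<And>x. gain_along G x q1 = (\<Sum>f\<in>C1. c1 f * x f)"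
      using q1(1) by blast
    obtain c2 where c2: "\<And>f. c2 f = 1 \<or> c2 f = -1" "\<And>x. gain_along G x q2 = (\<Sum>f\<in>C2. c2 f * x f)"
      using q2(1) by blast
    obtain cp where cp: "\<And>f. cp f = 1 \<or> cp f = -1"
      "\<And>x. gain_along G x p = (\<Sum>f\<in>walk_edges p. cp f * x f)"
      using trail_coefficients[OF wp] by blast
    let ?s = "of_int (walk_sign G p) :: 'k"
    have s: "?s = 1 \<or> ?s = -1" using walk_sign_pm[OF walk_edges_subset[OF wp(1)]] by auto
    then have ss: "?s * ?s = 1" by auto
    let ?F = "\<lambda>x. gain_along G x (q1 @ p @ q2 @ reverse_walk p)"
    \<comment> \<open>Going around the negative circle \<open>C2\<close> flips the sign of the way
      back, so that it doubles the contribution of \<open>p\<close> instead of cancelling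
      it.\<close>
    have F: "?F x = gain_along G x q1 + (- 2) * gain_along G x p + (- ?s) * gain_along G x q2" for x
      using q1(2) q2(2) neg ss s gain_along_reverse[OF wp(1), of x]
      by (auto simp: gain_along_append algebra_simps)
    let ?c = "\<lambda>f. if f \<in> C1 then c1 f else if f \<in> walk_edges p then - 2 * cp f else - ?s * c2 f"
    have fin: "finite C1" "finite C2" using c circleD(2) finite_subset_edges by blast+
    note d = handcuff_disjoint[OF circle_circle(3)]
    have F': "?F x = (\<Sum>f\<in>C. ?c f * x f)" for x
      unfolding circle_circle(1) sum_three[OF fin(1) finite_walk_edges fin(2) d] F c1(2) c2(2) cp(2)
      by (simp add: sum_distrib_left mult.assoc)
    have "?c f \<noteq> 0" for f
    proof -
      have "c1 f \<noteq> 0" "cp f \<noteq> 0" "c2 f \<noteq> 0" "?s \<noteq> 0" using c1(1)[of f] cp(1)[of f] c2(1)[of f] s by auto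
      then show ?thesis using two_nonzero by simp
    qed
    moreover have "?F (edge_val G \<theta>) = 0" for \<theta>
      unfolding F gain_along_edge_val[OF wp(1)] gain_along_edge_val[OF q1(3)]
        gain_along_edge_val[OF q2(3)] q1(2) q2(2) neg by (simp add: algebra_simps)
    ultimately show ?thesis using F' circle_circle(2)
      by (intro exI[of _ ?c] exI[of _ ?F]) (simp add: walk_gain_along)
  next
    case (half_circle e u p w C2 q)
    have c: "circle G C2" and neg: "prod (sign G) C2 = -1"
      using half_circle(5) by (auto simp: negative_circle_def)
    have P: "path G (edges G) u p w" using half_circle(3) by (simp add: handcuff_parts_def)
    then have wp: "walk G (edges G) u p w" "distinct (map fst p)"
      using path_distinct_edges[OF P] by (auto simp: path_def)
    note q = once_around_coefficients[OF c(1) half_circle(6)]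
    obtain c2 where c2: "\<And>f. c2 f = 1 \<or> c2 f = -1" "\<And>x. gain_along G x q = (\<Sum>f\<in>C2. c2 f * x f)"
      using q(1) by blast
    obtain cp where cp: "\<And>f. cp f = 1 \<or> cp f = -1"
      "\<And>x. gain_along G x p = (\<Sum>f\<in>walk_edges p. cp f * x f)"
      using trail_coefficients[OF wp] by blast
    let ?s = "of_int (walk_sign G p) :: 'k" and ?t = "of_int (orient G e 0) :: 'k"
    have s: "?s = 1 \<or> ?s = -1" using walk_sign_pm[OF walk_edges_subset[OF wp(1)]] by auto
    then have ss: "?s * ?s = 1" by auto
    have eE: "e \<in> edges G" using half_circle(3) figure_subset by (auto simp: handcuff_parts_def)
    have t: "?t = 1 \<or> ?t = -1" using half_orient_pm[OF eE half_circle(4)] .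
    let ?r = "p @ q @ reverse_walk p"
    let ?F = "\<lambda>x. ?t * x e + gain_along G x ?r - x e * of_int (walk_sign G ?r) * ?t"
    have r: "walk_sign G ?r = -1"
      using q(2) neg walk_sign_pm[OF walk_edges_subset[OF wp(1)]] by auto
    \<comment> \<open>The half edge both opens and closes the ultrawalk; as the walk in between has
      sign -1, its two contributions add up.\<close>
    have F: "?F x = 2 * ?t * x e + 2 * gain_along G x p + ?s * gain_along G x q" for x
      unfolding r using q(2) neg s ss gain_along_reverse[OF wp(1), of x]
      by (auto simp: gain_along_append algebra_simps)
    let ?c = "\<lambda>f. if f \<in> {e} then 2 * ?t else if f \<in> walk_edges p then 2 * cp f else ?s * c2 f"
    have fin: "finite {e}" "finite C2" using c circleD(2) finite_subset_edges by blast+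
    note d = handcuff_disjoint[OF half_circle(3)]
    have F': "?F x = (\<Sum>f\<in>C. ?c f * x f)" for x
      unfolding half_circle(1) sum_three[OF fin(1) finite_walk_edges fin(2) d] F c2(2) cp(2)
      by (simp add: sum_distrib_left mult.assoc)
    have "?c f \<noteq> 0" for f
    proof -
      have "cp f \<noteq> 0" "c2 f \<noteq> 0" "?s \<noteq> 0" "?t \<noteq> 0" using cp(1)[of f] c2(1)[of f] s t by auto
      then show ?thesis using two_nonzero by simp
    qed
    moreover have "?F (edge_val G \<theta>) = 0" for \<theta>
    proof -
      have "ends G e ! 0 = u"
      proof -
        have "u \<in> edge_verts G {e}"
          using half_circle(3) path_between_figures(1)[OF P] by (auto simp: handcuff_parts_def)
        then show ?thesis using half_ends[OF half_circle(4)] by auto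
      qed
      then have "2 * ?t * edge_val G \<theta> e = 2 * \<theta> u"
        using t by (auto simp: edge_val_half[OF half_circle(4)])
      then show ?thesis
        unfolding F gain_along_edge_val[OF wp(1)] gain_along_edge_val[OF q(3)] q(2) neg
        by (simp add: algebra_simps)
    qed
    ultimately show ?thesis using F' half_circle(2)
      by (intro exI[of _ ?c] exI[of _ ?F]) (simp add: walk_gain_along ultrawalk_gain_def)
  next
    case (half_half e u p w h)
    have P: "path G (edges G) u p w" using half_half(3) by (simp add: handcuff_parts_def)
    then have wp: "walk G (edges G) u p w" "distinct (map fst p)"
      using path_distinct_edges[OF P] by (auto simp: path_def)
    obtain cp where cp: "\<And>f. cp f = 1 \<or> cp f = -1"
      "\<And>x. gain_along G x p = (\<Sum>f\<in>walk_edges p. cp f * x f)"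
      using trail_coefficients[OF wp] by blast
    let ?s = "of_int (walk_sign G p) :: 'k" and ?t = "of_int (orient G e 0) :: 'k"
      and ?t' = "of_int (orient G h 0) :: 'k"
    have s: "?s = 1 \<or> ?s = -1" using walk_sign_pm[OF walk_edges_subset[OF wp(1)]] by auto
    have E: "e \<in> edges G" "h \<in> edges G"
      using half_half(3) figure_subset by (auto simp: handcuff_parts_def)
    have t: "?t = 1 \<or> ?t = -1" "?t' = 1 \<or> ?t' = -1"
      using half_orient_pm[OF E(1) half_half(4)] half_orient_pm[OF E(2) half_half(5)] by auto
    let ?F = "\<lambda>x. ?t * x e + gain_along G x p - x h * ?s * ?t'"
    let ?c = "\<lambda>f. if f \<in> {e} then ?t else if f \<in> walk_edges p then cp f else - (?s * ?t')"
    note d = handcuff_disjoint[OF half_half(3)]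
    have fin: "finite {e}" "finite {h}" by simp_all
    have F': "?F x = (\<Sum>f\<in>C. ?c f * x f)" for x
      unfolding half_half(1) sum_three[OF fin(1) finite_walk_edges fin(2) d] cp(2)
      by (simp add: mult_ac)
    have "?c f \<noteq> 0" for f using cp(1)[of f] s t by auto
    moreover have "?F (edge_val G \<theta>) = 0" for \<theta>
    proof -
      have "ends G e ! 0 = u" "ends G h ! 0 = w"
      proof -
        have "u \<in> edge_verts G {e}" "w \<in> edge_verts G {h}"
          using half_half(3) path_between_figures(1,2)[OF P] by (auto simp: handcuff_parts_def)
        then show "ends G e ! 0 = u" "ends G h ! 0 = w"
          using half_ends[OF half_half(4)] half_ends[OF half_half(5)] by auto
      qed
      then have "?t * edge_val G \<theta> e = \<theta> u" "edge_val G \<theta> h * ?s * ?t' = ?s * \<theta> w"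
        using t by (auto simp: edge_val_half[OF half_half(4)] edge_val_half[OF half_half(5)])
      then have "?F (edge_val G \<theta>) = \<theta> u + (?s * \<theta> w - \<theta> u) - ?s * \<theta> w"
        by (simp only: gain_along_edge_val[OF wp(1), of \<theta>])
      then show ?thesis by simp
    qed
    ultimately show ?thesis using F' half_half(2)
      by (intro exI[of _ ?c] exI[of _ ?F]) (simp add: walk_gain_along ultrawalk_gain_def)
  qed
  then obtain c F where "\<forall>f\<in>C. c f \<noteq> 0" "\<forall>x. F x = (\<Sum>f\<in>C. c f * x f)" "F (gain G) = g"
    "\<forall>\<theta>. F (edge_val G \<theta>) = 0" by blast
  then show ?thesis by (intro that[of c]) auto
qed

end

subsection \<open>Components and switching\<close>

text \<open>The classification of bases depends on which components are balanced, not only on how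
  many; \<open>balanced_parts_mono\<close> passes from the number to the set.\<close>

definition balanced_parts :: "('v, 'e, 'k) gsgraph \<Rightarrow> 'e set \<Rightarrow> 'v set set" where
  "balanced_parts G S = {X \<in> components G (verts G) S. sign_balanced G (edges_in G S X)}"

lemma num_balanced_card: "num_balanced G S = card (balanced_parts G S)"
  by (simp add: num_balanced_def balanced_parts_def)

lemma sign_balanced_mono: "sign_balanced G S' \<Longrightarrow> S \<subseteq> S' \<Longrightarrow> sign_balanced G S"
  unfolding sign_balanced_def by blast

lemma edges_in_mono: "S \<subseteq> S' \<Longrightarrow> X \<subseteq> X' \<Longrightarrow> edges_in G S X \<subseteq> edges_in G S' X'"
  by (auto simp: edges_in_def)

lemma edges_in_subset: "edges_in G S X \<subseteq> S"
  by (auto simp: edges_in_def)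

lemma edges_in_verts: "edge_verts G (edges_in G S X) \<subseteq> X"
  by (auto simp: edges_in_def edge_verts_def)

lemma edges_in_no_loose: "no_loose_edges G (edges_in G S X)"
  by (simp add: edges_in_def no_loose_edges_def)

lemma component_mem: "x \<in> X \<Longrightarrow> {w \<in> X. conn G S x w} \<in> components G X S"
  by (simp add: components_image)

lemma component_eq:
  assumes "Y \<in> components G X S" "y \<in> Y"
  shows "Y = {w \<in> X. conn G S y w}" "y \<in> X"
proof -
  obtain x where x: "x \<in> X" "Y = {w \<in> X. conn G S x w}" using assms(1) components_conn by metis
  then have xy: "conn G S x y" "y \<in> X" using assms(2) by auto
  then show "y \<in> X" by simp
  show "Y = {w \<in> X. conn G S y w}"
    unfolding x(2) using conn_trans[OF xy(1)] conn_trans[OF conn_sym[OF xy(1)]] by blast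
qed

lemma component_nonempty: "Y \<in> components G X S \<Longrightarrow> Y \<noteq> {}"
  by (auto simp: components_image)

lemma component_subset: "Y \<in> components G X S \<Longrightarrow> Y \<subseteq> X"
  by (auto simp: components_image)

lemma component_unique:
  "Y \<in> components G X S \<Longrightarrow> Y' \<in> components G X S \<Longrightarrow> y \<in> Y \<Longrightarrow> y \<in> Y' \<Longrightarrow> Y = Y'"
  by (rule trans[OF component_eq(1) component_eq(1)[symmetric]])

lemma Union_components: "\<Union>(components G X S) = X"
  by (auto simp: components_image)

lemma finite_components: "finite X \<Longrightarrow> finite (components G X S)"
  by (simp add: components_image)

context gain_signed
begin

section \<open>Components of an edge set and the edges they carry\<close>

lemma nonloose_conn:
  assumes "S \<subseteq> edges G" "e \<in> S" "x \<in> set (ends G e)" "y \<in> set (ends G e)"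
  shows "conn G S x y"
proof (cases "ordinary_edge G e")
  case True
  then show ?thesis using conn_edge assms(2-4) by metis
next
  case False
  then have "half_edge G e" using edge_kinds[OF subsetD[OF assms(1,2)]] assms(3) by (auto simp: loose_edge_def)
  then show ?thesis using half_ends[of e] assms(3,4) by auto
qed

lemma nonloose_ends: "e \<in> edges G \<Longrightarrow> \<not> loose_edge G e \<Longrightarrow> \<exists>x. x \<in> set (ends G e)"
  by (auto simp: loose_edge_def ex_in_conv)

lemma edges_in_component_iff:
  assumes "S \<subseteq> edges G" "Y \<in> components G (verts G) S" "e \<in> S" "x \<in> set (ends G e)"
  shows "e \<in> edges_in G S Y \<longleftrightarrow> x \<in> Y"
proof
  show "e \<in> edges_in G S Y \<Longrightarrow> x \<in> Y" using assms(4) by (auto simp: edges_in_def)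
  assume x: "x \<in> Y"
  have "y \<in> Y" if "y \<in> set (ends G e)" for y
  proof -
    have "conn G S x y" by (rule nonloose_conn[OF assms(1,3,4) that])
    moreover have "y \<in> verts G" using ends_in_verts[of e] assms(1,3) that by blast
    ultimately show ?thesis using component_eq(1)[OF assms(2) x] by blast
  qed
  then show "e \<in> edges_in G S Y" using assms(3,4) by (auto simp: edges_in_def loose_edge_def)
qed

lemma conn_edges_in:
  assumes "S \<subseteq> edges G" "Y \<in> components G (verts G) S" "conn G S u w" "u \<in> Y"
  shows "conn G (edges_in G S Y) u w"
proof -
  obtain p where "walk G S u p w" using assms(3) by (auto simp: conn_def)
  then show ?thesis using assms(4)
  proof (induction p arbitrary: u)
    case (Cons s p)
    have s: "fst s \<in> S" "ordinary_edge G (fst s)" "snd s < 2" "source G s = u"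
      "walk G S (target G s) p w"
      using Cons.prems(1) by (simp_all del: walk.simps(2) add: walk_Cons)
    have e: "fst s \<in> edges_in G S Y"
      using edges_in_component_iff[OF assms(1,2) s(1), of u] step_ends(1)[OF s(2,3)] s(4) Cons.prems(2)
      by simp
    then have t: "target G s \<in> Y" using step_ends(1)[OF s(2,3)] by (auto simp: edges_in_def)
    have "walk G (edges_in G S Y) u [s] (target G s)" unfolding walk_single using s e by simp
    then have "conn G (edges_in G S Y) u (target G s)" by (auto simp: conn_def)
    then show ?case using Cons.IH[OF s(5) t] by (rule conn_trans)
  qed simp
qed

lemma component_connected:
  assumes "S \<subseteq> edges G" "Y \<in> components G (verts G) S"
  shows "connected_graph G Y (edges_in G S Y)"
  unfolding connected_graph_conn
proof (intro ballI)
  fix u w assume u: "u \<in> Y" and w: "w \<in> Y"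
  have "conn G S u w" using component_eq(1)[OF assms(2) u] w by blast
  then show "conn G (edges_in G S Y) u w" by (rule conn_edges_in[OF assms _ u])
qed

lemma component_facts:
  assumes "S \<subseteq> edges G" "Y \<in> components G (verts G) S"
  shows "edges_in G S Y \<subseteq> edges G" "finite Y" "edge_verts G (edges_in G S Y) \<subseteq> Y"
    "no_loose_edges G (edges_in G S Y)" "connected_graph G Y (edges_in G S Y)" "Y \<noteq> {}"
  using edges_in_subset[of G S Y] assms(1) finite_subset[OF component_subset[OF assms(2)] finite_verts]
    edges_in_verts[of G S Y] edges_in_no_loose[of G S Y] component_connected[OF assms]
    component_nonempty[OF assms(2)]
  by auto

lemma sum_card_components: "(\<Sum>Y\<in>components G (verts G) S. card Y) = card (verts G)"
proof -
  have "pairwise disjnt (components G (verts G) S)"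
    using component_unique[of _ G "verts G" S] unfolding pairwise_def disjnt_def by blast
  moreover have "finite Y" if "Y \<in> components G (verts G) S" for Y
    using finite_subset[OF component_subset[OF that] finite_verts] .
  ultimately have "card (\<Union>(components G (verts G) S)) = (\<Sum>Y\<in>components G (verts G) S. card Y)"
    by (rule card_Union_disjoint)
  then show ?thesis by (simp add: Union_components)
qed

lemma sum_card_edges_in:
  assumes "S \<subseteq> edges G"
  shows "(\<Sum>Y\<in>components G (verts G) S. card (edges_in G S Y)) = card {e \<in> S. \<not> loose_edge G e}"
proof -
  let ?K = "components G (verts G) S"
  have fin: "finite S" using finite_subset_edges[OF assms] .
  have disj: "edges_in G S Y \<inter> edges_in G S Y' = {}" if "Y \<in> ?K" "Y' \<in> ?K" "Y \<noteq> Y'" for Y Y'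
  proof (rule ccontr)
    assume "edges_in G S Y \<inter> edges_in G S Y' \<noteq> {}"
    then obtain e where e: "e \<in> edges_in G S Y" "e \<in> edges_in G S Y'" by blast
    then obtain x where "x \<in> set (ends G e)"
      using nonloose_ends[of e] assms by (auto simp: edges_in_def)
    then have "x \<in> Y" "x \<in> Y'" using e by (auto simp: edges_in_def)
    then show False using component_unique[OF that(1,2)] that(3) by blast
  qed
  have "card (\<Union>Y\<in>?K. edges_in G S Y) = (\<Sum>Y\<in>?K. card (edges_in G S Y))"
    using finite_components[OF finite_verts, of G S] finite_subset[OF edges_in_subset fin] disj
    by (intro card_UN_disjoint) auto
  moreover have "(\<Union>Y\<in>?K. edges_in G S Y) = {e \<in> S. \<not> loose_edge G e}"
  proof
    show "(\<Union>Y\<in>?K. edges_in G S Y) \<subseteq> {e \<in> S. \<not> loose_edge G e}" by (auto simp: edges_in_def)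
    show "{e \<in> S. \<not> loose_edge G e} \<subseteq> (\<Union>Y\<in>?K. edges_in G S Y)"
    proof
      fix e assume e: "e \<in> {e \<in> S. \<not> loose_edge G e}"
      then obtain x where x: "x \<in> set (ends G e)" using nonloose_ends[of e] assms by blast
      then have "x \<in> verts G" using ends_in_verts[of e] e assms by blast
      then obtain Y where Y: "Y \<in> ?K" "x \<in> Y" using Union_components[of G "verts G" S] by blast
      then have "e \<in> edges_in G S Y" using edges_in_component_iff[OF assms Y(1) _ x] e by blast
      then show "e \<in> (\<Union>Y\<in>?K. edges_in G S Y)" using Y(1) by blast
    qed
  qed
  ultimately show ?thesis by simp
qed

lemma component_refine:
  assumes "S \<subseteq> S'" "Y \<in> components G (verts G) S" "X \<in> components G (verts G) S'" "y \<in> Y" "y \<in> X"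
  shows "Y \<subseteq> X"
  unfolding component_eq(1)[OF assms(2,4)] component_eq(1)[OF assms(3,5)]
  using conn_mono[OF _ assms(1), of G] by blast

text \<open>Every balanced component of \<open>S'\<close> contains a component of \<open>S\<close>,
  again balanced; choosing one in each is injective. If the numbers agree, every balanced component
  of \<open>S\<close> is chosen, which leaves no room for a second one inside the same component of
  \<open>S'\<close>.\<close>

lemma balanced_parts_mono:
  assumes "S \<subseteq> S'" "S' \<subseteq> edges G"
  shows "num_balanced G S' \<le> num_balanced G S"
    and "num_balanced G S' = num_balanced G S \<Longrightarrow> balanced_parts G S' = balanced_parts G S"
proof -
  let ?P = "balanced_parts G S" and ?P' = "balanced_parts G S'"
  have fin: "finite ?P" "finite ?P'"
    using finite_components[OF finite_verts, of G] by (simp_all add: balanced_parts_def)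
  have inherit: "Y \<in> ?P" if "X \<in> ?P'" "Y \<in> components G (verts G) S" "Y \<subseteq> X" for X Y
    using that sign_balanced_mono edges_in_mono[OF assms(1) that(3), of G]
    by (auto simp: balanced_parts_def)
  \<comment> \<open>The choice of one component of \<open>S\<close> inside each component of
    \<open>S'\<close>.\<close>
  define g where "g X = {w \<in> verts G. conn G S (SOME x. x \<in> X) w}" for X
  have g: "g X \<in> components G (verts G) S" "g X \<subseteq> X" if X: "X \<in> components G (verts G) S'" for X
  proof -
    have x: "(SOME x. x \<in> X) \<in> X" using component_nonempty[OF X] by (simp add: some_in_eq)
    then have xV: "(SOME x. x \<in> X) \<in> verts G" using component_subset[OF X] by blast
    then show c: "g X \<in> components G (verts G) S" unfolding g_def by (rule component_mem)
    show "g X \<subseteq> X"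
      by (rule component_refine[OF assms(1) c X _ x]) (use xV in \<open>simp add: g_def\<close>)
  qed
  have P'_comp: "X \<in> ?P' \<Longrightarrow> X \<in> components G (verts G) S'" for X by (simp add: balanced_parts_def)
  have gP: "g ` ?P' \<subseteq> ?P"
    using g P'_comp inherit by blast
  have inj: "inj_on g ?P'"
  proof (rule inj_onI)
    fix X X' assume X: "X \<in> ?P'" "X' \<in> ?P'" "g X = g X'"
    obtain y where "y \<in> g X" using component_nonempty[OF g(1)[OF P'_comp[OF X(1)]]] by blast
    then have "y \<in> X" "y \<in> X'" using g(2)[OF P'_comp[OF X(1)]] g(2)[OF P'_comp[OF X(2)]] X(3) by auto
    then show "X = X'" using component_unique P'_comp X(1,2) by metis
  qed
  show "num_balanced G S' \<le> num_balanced G S"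
    unfolding num_balanced_card using card_inj_on_le[OF inj gP fin(1)] .
  assume eq: "num_balanced G S' = num_balanced G S"
  have "card (g ` ?P') = card ?P" using card_image[OF inj] eq by (simp add: num_balanced_card)
  then have img: "g ` ?P' = ?P" using card_subset_eq[OF fin(1) gP] by simp
  have "?P \<subseteq> ?P'"
  proof
    fix Y assume Y: "Y \<in> ?P"
    then obtain X where X: "X \<in> ?P'" "Y = g X" using img by blast
    have "X = Y"
    proof (rule ccontr)
      assume "X \<noteq> Y"
      \<comment> \<open>The component of \<open>S\<close> around such an \<open>x\<close> lies in
        \<open>X\<close> and is balanced, so it is the choice made in some component of
        \<open>S'\<close>; that component contains \<open>x\<close>, so it is \<open>X\<close>,
        whose choice is \<open>Y\<close>.\<close>
      then obtain x where x: "x \<in> X" "x \<notin> Y" using g(2)[OF P'_comp[OF X(1)]] X(2) by blast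
      have xV: "x \<in> verts G" using component_subset[OF P'_comp[OF X(1)]] x(1) by blast
      let ?Y = "{w \<in> verts G. conn G S x w}"
      have Y': "?Y \<in> components G (verts G) S" by (rule component_mem[OF xV])
      have xY': "x \<in> ?Y" using xV by simp
      have "?Y \<subseteq> X" by (rule component_refine[OF assms(1) Y' P'_comp[OF X(1)] xY' x(1)])
      then have "?Y \<in> ?P" using inherit[OF X(1) Y'] by blast
      then obtain X' where X': "X' \<in> ?P'" "?Y = g X'" using img by blast
      have "x \<in> X'" using g(2)[OF P'_comp[OF X'(1)]] xY' X'(2) by blast
      then have "X' = X" using component_unique[OF P'_comp[OF X'(1)] P'_comp[OF X(1)]] x(1) by blast
      then show False using X(2) X'(2) xY' x(2) by simp
    qed
    then show "Y \<in> ?P'" using X(1) by simp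
  qed
  then show "?P' = ?P" using card_subset_eq[OF fin(2), of ?P] eq by (simp add: num_balanced_card)
qed

text \<open>Harary's balance theorem, one edge at a time: an edge that joins two components is made
  consistent by negating \<open>\<theta>\<close> on one of them.\<close>

lemma switching_function:
  assumes "S \<subseteq> edges G" "\<And>C. C \<subseteq> S \<Longrightarrow> \<not> negative_circle G C"
  shows "\<exists>\<theta>::'v \<Rightarrow> int. (\<forall>v. \<theta> v = 1 \<or> \<theta> v = -1) \<and>
    (\<forall>e\<in>S. ordinary_edge G e \<longrightarrow> \<theta> (ends G e ! 1) = sign G e * \<theta> (ends G e ! 0))"
  using finite_subset_edges[OF assms(1)] assms
proof (induction S)
  case empty
  then show ?case by (intro exI[of _ "\<lambda>_. 1"]) simp
next
  case (insert e S)
  have "S \<subseteq> edges G" "\<And>C. C \<subseteq> S \<Longrightarrow> \<not> negative_circle G C" using insert.prems by blast+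
  then obtain \<theta> :: "'v \<Rightarrow> int" where t: "\<And>v. \<theta> v = 1 \<or> \<theta> v = -1"
    "\<And>f. f \<in> S \<Longrightarrow> ordinary_edge G f \<Longrightarrow> \<theta> (ends G f ! 1) = sign G f * \<theta> (ends G f ! 0)"
    using insert.IH by metis
  let ?a = "ends G e ! 0" and ?b = "ends G e ! 1"
  show ?case
  proof (cases "ordinary_edge G e \<longrightarrow> \<theta> ?b = sign G e * \<theta> ?a")
    case True
    then show ?thesis using t by (intro exI[of _ \<theta>]) auto
  next
    case False
    then have e: "ordinary_edge G e" and ne: "\<theta> ?b \<noteq> sign G e * \<theta> ?a" by auto
    have se: "sign G e = 1 \<or> sign G e = -1" using sign_pm insert.prems(1) by blast
    have walk_\<theta>: "walk G S u p w \<Longrightarrow> \<theta> w = walk_sign G p * \<theta> u" for u p w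
    proof (induction p arbitrary: u)
      case (Cons s p)
      have s: "fst s \<in> S" "ordinary_edge G (fst s)" "snd s < 2" "source G s = u"
        "walk G S (target G s) p w"
        using Cons.prems(1) by (simp_all del: walk.simps(2) add: walk_Cons)
      have "sign G (fst s) = 1 \<or> sign G (fst s) = -1" using sign_pm s(1) insert.prems(1) by blast
      moreover have "snd s = 0 \<or> snd s = 1" using s(3) by auto
      ultimately have "\<theta> (target G s) = sign G (fst s) * \<theta> u"
        using t(2)[OF s(1,2)] s(4) by (auto simp: source_def target_def)
      then show ?case using Cons.IH[OF s(5)] by simp
    qed simp
    \<comment> \<open>A path of \<open>S\<close> multiplies \<open>\<theta>\<close> by its sign. If
      it joined the ends of \<open>e\<close>, the failure of the condition at \<open>e\<close> would
      make the circle closed by \<open>e\<close> negative.\<close>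
    have nc: "\<not> conn G S ?a ?b"
    proof
      assume "conn G S ?a ?b"
      then obtain p where p: "path G S ?a p ?b" by (rule conn_path)
      then have w: "walk G S ?a p ?b" by (simp add: path_def)
      have ep: "e \<notin> walk_edges p" using walk_edges_subset[OF w] insert.hyps(2) by blast
      have c: "cycle G (insert e S) ?a (p @ [(e, 1)])"
        using path_edge_cycle[OF p, of "(e, 1)"] e ep by (simp add: source_def target_def)
      have "walk_sign G (p @ [(e, 1)]) = -1"
        using walk_\<theta>[OF w] ne se t(1)[of ?a] t(1)[of ?b]
          walk_sign_pm[of p] walk_edges_subset[OF w] insert.prems(1) by auto
      then have "prod (sign G) (walk_edges (p @ [(e, 1)])) = -1"
        using walk_sign_prod[of "p @ [(e, 1)]" G] c unfolding cycle_def by simp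
      then have "negative_circle G (walk_edges (p @ [(e, 1)]))"
        using cycle_imp_circle(1)[OF c insert.prems(1)] by (simp add: negative_circle_def)
      moreover have "walk_edges (p @ [(e, 1)]) \<subseteq> insert e S" using walk_edges_subset[OF w] by auto
      ultimately show False using insert.prems(2) by blast
    qed
    let ?\<theta> = "\<lambda>v. if conn G S ?b v then - \<theta> v else \<theta> v"
    have "?\<theta> v = 1 \<or> ?\<theta> v = -1" for v using t(1)[of v] by auto
    moreover have "?\<theta> (ends G f ! 1) = sign G f * ?\<theta> (ends G f ! 0)"
      if f: "f \<in> insert e S" "ordinary_edge G f" for f
    proof (cases "f = e")
      case True
      have "\<not> conn G S ?b ?a" using nc conn_sym by metis
      then show ?thesis using True ne se t(1)[of ?a] t(1)[of ?b] by auto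
    next
      case False
      then have fS: "f \<in> S" using f(1) by simp
      have c: "conn G S (ends G f ! 0) (ends G f ! 1)"
        by (rule conn_edge[OF fS f(2)]) (use ordinary_ends(1)[OF f(2)] in auto)
      have "conn G S ?b (ends G f ! 0) \<longleftrightarrow> conn G S ?b (ends G f ! 1)"
        using conn_trans[OF _ c] conn_trans[OF _ conn_sym[OF c]] by blast
      then show ?thesis using t(2)[OF fS f(2)] by simp
    qed
    ultimately show ?thesis by (intro exI[of _ ?\<theta>]) blast
  qed
qed

end

section \<open>Potentials against sign circuits and components\<close>

context gain_signed_char
begin

text \<open>The gain is a combination of the edge gains whose coefficients annihilate every
  potential.\<close>

lemma sign_circuit_potential_neutral:
  assumes "sign_circuit G C" "\<And>f. f \<in> C \<Longrightarrow> gain G f = edge_val G \<theta> f"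
  shows "neutral G C"
proof -
  obtain g where g: "circuit_gain G C g" using sign_circuit_gain_exists[OF assms(1)] by blast
  obtain c where c: "g = (\<Sum>f\<in>C. c f * gain G f)" "\<And>\<theta>. (\<Sum>f\<in>C. c f * edge_val G \<theta> f) = 0"
    using circuit_gain_functional[OF g] by metis
  have "g = (\<Sum>f\<in>C. c f * edge_val G \<theta> f)" unfolding c(1) using assms(2) by simp
  then show ?thesis using g c(2) by (simp add: neutral_def)
qed

lemma sign_circuit_subset: "sign_circuit G C \<Longrightarrow> C \<subseteq> edges G"
  unfolding sign_circuit_def positive_circle_def
  using circleD(2) handcuff_count(1) by blast

lemma sum_remove_zero:
  assumes "finite C" "e \<in> C" "(\<Sum>f\<in>C. c f * (x f::'k)) = 0" "c e \<noteq> 0" "\<And>f. f \<in> C - {e} \<Longrightarrow> x f = 0"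
  shows "x e = 0"
proof -
  have "(\<Sum>f\<in>C. c f * x f) = c e * x e + (\<Sum>f\<in>C - {e}. c f * x f)"
    by (rule sum.remove[OF assms(1,2)])
  also have "(\<Sum>f\<in>C - {e}. c f * x f) = 0" using assms(5) by simp
  finally show ?thesis using assms(3,4) by simp
qed

text \<open>The relation on \<open>C\<close> has a nonzero coefficient at \<open>e\<close>: the
  column of \<open>e\<close> is a combination of the other columns of \<open>C\<close>, stated here
  in dual form.\<close>

lemma sign_circuit_edge_val:
  assumes "sign_circuit G C" "e \<in> C" "\<And>f. f \<in> C - {e} \<Longrightarrow> edge_val G \<theta> f = 0"
  shows "edge_val G \<theta> e = 0"
proof -
  obtain g where g: "circuit_gain G C g" using sign_circuit_gain_exists[OF assms(1)] by blast
  obtain c where c: "\<And>f. f \<in> C \<Longrightarrow> c f \<noteq> 0" "\<And>\<theta>. (\<Sum>f\<in>C. c f * edge_val G \<theta> f) = 0"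
    using circuit_gain_functional[OF g] by metis
  show ?thesis
    by (rule sum_remove_zero[OF finite_subset_edges[OF sign_circuit_subset[OF assms(1)]] assms(2)
          c(2) c(1)[OF assms(2)] assms(3)])
qed

text \<open>The relation on \<open>C\<close> annihilates the gains, by neutrality, and the
  potential, hence also their difference, in which only the term of \<open>e\<close> is
  left.\<close>

lemma neutral_circuit_potential:
  assumes "sign_circuit G C" "neutral G C" "e \<in> C" "\<And>f. f \<in> C - {e} \<Longrightarrow> gain G f = edge_val G \<theta> f"
  shows "gain G e = edge_val G \<theta> e"
proof -
  obtain c where c: "\<And>f. f \<in> C \<Longrightarrow> c f \<noteq> 0" "0 = (\<Sum>f\<in>C. c f * gain G f)"
    "\<And>\<theta>. (\<Sum>f\<in>C. c f * edge_val G \<theta> f) = 0"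
    using circuit_gain_functional assms(2) unfolding neutral_def by metis
  have s: "(\<Sum>f\<in>C. c f * (gain G f - edge_val G \<theta> f)) = 0"
    using c(2) c(3)[of \<theta>] by (simp add: right_diff_distrib sum_subtractf)
  have "gain G e - edge_val G \<theta> e = 0"
    by (rule sum_remove_zero[OF finite_subset_edges[OF sign_circuit_subset[OF assms(1)]] assms(3)
          s c(1)[OF assms(3)]]) (use assms(4) in simp)
  then show ?thesis by simp
qed

text \<open>The switching function of the component, extended by \<open>0\<close>. On an edge inside
  \<open>Y\<close> the two end contributions cancel because the product of the end signs is minus
  the edge sign; every other edge of \<open>S\<close> meets no vertex of \<open>Y\<close>.\<close>

lemma balanced_part_function:
  assumes "S \<subseteq> edges G" "Y \<in> balanced_parts G S"
  obtains \<theta> :: "'v \<Rightarrow> 'k" where "\<And>v. v \<in> Y \<Longrightarrow> \<theta> v = 1 \<or> \<theta> v = -1" "\<And>v. v \<notin> Y \<Longrightarrow> \<theta> v = 0"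
    "\<And>f. f \<in> S \<Longrightarrow> edge_val G \<theta> f = 0"
proof -
  let ?T = "edges_in G S Y"
  have Y: "Y \<in> components G (verts G) S" and bal: "sign_balanced G ?T"
    using assms(2) by (auto simp: balanced_parts_def)
  have TE: "?T \<subseteq> edges G" by (rule component_facts(1)[OF assms(1) Y])
  have nc: "\<not> negative_circle G C" if "C \<subseteq> ?T" for C
    using bal that unfolding sign_balanced_def by blast
  obtain t :: "'v \<Rightarrow> int" where t: "\<And>v. t v = 1 \<or> t v = -1"
    "\<And>e. e \<in> ?T \<Longrightarrow> ordinary_edge G e \<Longrightarrow> t (ends G e ! 1) = sign G e * t (ends G e ! 0)"
    using switching_function[OF TE nc] by metis
  define \<theta> :: "'v \<Rightarrow> 'k" where "\<theta> v = (if v \<in> Y then of_int (t v) else 0)" for v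
  have pm: "\<theta> v = 1 \<or> \<theta> v = -1" if "v \<in> Y" for v using t(1)[of v] that by (auto simp: \<theta>_def)
  have "edge_val G \<theta> f = 0" if f: "f \<in> S" for f
  proof (cases "f \<in> ?T")
    case True
    then have "\<not> half_edge G f" "\<not> loose_edge G f" using bal by (auto simp: sign_balanced_def edges_in_def)
    then have o: "ordinary_edge G f" using edge_kinds[of f] f assms(1) by blast
    have fE: "f \<in> edges G" using f assms(1) by blast
    have inY: "ends G f ! 0 \<in> Y" "ends G f ! 1 \<in> Y"
      using True ordinary_ends(1)[OF o] by (auto simp: edges_in_def)
    have "orient G f 1 = - sign G f * orient G f 0" using orient_other_end[OF fE o, of 0] by simp
    then have "orient G f 0 * t (ends G f ! 0) + orient G f 1 * t (ends G f ! 1) = 0"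
      using t(2)[OF True o] sign_pm[OF fE] by auto
    then have "(of_int (orient G f 0 * t (ends G f ! 0) + orient G f 1 * t (ends G f ! 1)) :: 'k) = 0"
      by simp
    then show ?thesis unfolding edge_val_ordinary[OF o] using inY by (simp add: \<theta>_def)
  next
    case False
    then have "x \<notin> Y" if "x \<in> set (ends G f)" for x
      using edges_in_component_iff[OF assms(1) Y f that] by blast
    then show ?thesis by (simp add: edge_val_def \<theta>_def)
  qed
  then show ?thesis using that[of \<theta>] pm by (auto simp: \<theta>_def)
qed

text \<open>Otherwise the function of each balanced component \<open>Y\<close> of \<open>S\<close>
  vanishes on all of \<open>S'\<close>. It is then constant up to sign along walks of
  \<open>S'\<close>, and nonzero exactly on \<open>Y\<close>, so \<open>Y\<close> stays a component.
  A half edge in it would force \<theta>(u) = 0, and a negative circle \<theta>(u) = - \<theta>(u).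
  So every balanced component survives and their number cannot drop.\<close>

lemma num_balanced_decrease:
  assumes "S \<subseteq> S'" "S' \<subseteq> edges G" "num_balanced G S' < num_balanced G S"
  shows "\<exists>\<theta>. \<exists>e\<in>S'. (\<forall>f\<in>S. edge_val G \<theta> f = 0) \<and> edge_val G \<theta> e \<noteq> 0"
proof (rule ccontr)
  assume "\<not> ?thesis"
  then have all: "edge_val G \<theta> e = 0" if "e \<in> S'" "\<And>f. f \<in> S \<Longrightarrow> edge_val G \<theta> f = 0" for \<theta> e
    using that by blast
  have SE: "S \<subseteq> edges G" using assms by blast
  have "balanced_parts G S \<subseteq> balanced_parts G S'"
  proof
    fix Y assume Y: "Y \<in> balanced_parts G S"
    obtain \<theta> :: "'v \<Rightarrow> 'k" where t: "\<And>v. v \<in> Y \<Longrightarrow> \<theta> v = 1 \<or> \<theta> v = -1" "\<And>v. v \<notin> Y \<Longrightarrow> \<theta> v = 0"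
      "\<And>f. f \<in> S \<Longrightarrow> edge_val G \<theta> f = 0"
      using balanced_part_function[OF SE Y] by blast
    have z: "edge_val G \<theta> e = 0" if "e \<in> S'" for e using all[OF that t(3)] .
    have nz: "\<theta> v \<noteq> 0" if "v \<in> Y" for v using t(1)[OF that] by auto
    have YS: "Y \<in> components G (verts G) S" using Y by (simp add: balanced_parts_def)
    have walk_\<theta>: "\<theta> u = of_int (walk_sign G p) * \<theta> w" if "walk G S' u p w" for u p w
    proof -
      have w: "walk G (edges G) u p w" using walk_mono[OF that assms(2)] .
      have "gain_along G (edge_val G \<theta>) p = 0"
        using walk_edges_subset[OF that] z by (induction p) auto
      then show "\<theta> u = of_int (walk_sign G p) * \<theta> w"
        using gain_along_edge_val[OF w, of \<theta>] by simp
    qed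
    obtain y where y: "y \<in> Y" using component_nonempty[OF YS] by blast
    have "Y = {w \<in> verts G. conn G S' y w}"
    proof
      show "Y \<subseteq> {w \<in> verts G. conn G S' y w}"
        using component_eq(1)[OF YS y] conn_mono[OF _ assms(1), of G] by blast
      show "{w \<in> verts G. conn G S' y w} \<subseteq> Y"
      proof
        fix w assume "w \<in> {w \<in> verts G. conn G S' y w}"
        then obtain p where "walk G S' y p w" by (auto simp: conn_def)
        from walk_\<theta>[OF this] have "\<theta> w \<noteq> 0" using nz[OF y] by auto
        then show "w \<in> Y" using t(2) by blast
      qed
    qed
    then have "Y \<in> components G (verts G) S'"
      using component_mem component_eq(2)[OF YS y] by metis
    moreover have "sign_balanced G (edges_in G S' Y)"
      unfolding sign_balanced_def
    proof (intro conjI notI)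
      assume "\<exists>C. C \<subseteq> edges_in G S' Y \<and> negative_circle G C"
      then obtain C where C: "C \<subseteq> edges_in G S' Y" "negative_circle G C" by blast
      then have c: "circle G C" "prod (sign G) C = -1" by (auto simp: negative_circle_def)
      obtain u where u: "u \<in> edge_verts G C" using circle_verts_nonempty[OF c(1)] by blast
      then have uY: "u \<in> Y" using edge_verts_mono[OF C(1), of G] edges_in_verts[of G S' Y] by blast
      obtain q where q: "once_around G C u q"
        using circle_once_around[OF c(1) finite_subset_edges[OF circleD(2)[OF c(1)]] u] .
      then have "walk G C u q u" by (simp add: once_around_def)
      then have "walk G S' u q u" by (rule walk_mono) (use C(1) edges_in_subset[of G S' Y] in blast)
      from walk_\<theta>[OF this] have "\<theta> u = - \<theta> u"
        using once_around_coefficients(2)[OF c(1) q] c(2) by simp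
      then have "2 * \<theta> u = 0" by (metis add.right_inverse mult_2)
      then show False using two_nonzero nz[OF uY] by simp
    next
      assume "\<exists>e. e \<in> edges_in G S' Y \<and> half_edge G e"
      then obtain e where e: "e \<in> edges_in G S' Y" "half_edge G e" by blast
      then have eS: "e \<in> S'" "set (ends G e) \<subseteq> Y" by (auto simp: edges_in_def)
      have "ends G e ! 0 \<in> Y" using half_ends[OF e(2)] eS(2) by auto
      then have "\<theta> (ends G e ! 0) \<noteq> 0" by (rule nz)
      moreover have "(of_int (orient G e 0) :: 'k) \<noteq> 0"
        using half_orient_pm[of e, where 'a='k] eS(1) assms(2) e(2) by force
      ultimately show False using z[OF eS(1)] edge_val_half[OF e(2)] by simp
    qed
    ultimately show "Y \<in> balanced_parts G S'" by (simp add: balanced_parts_def)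
  qed
  moreover have "finite (balanced_parts G S')"
    using finite_components[OF finite_verts, of G S'] by (simp add: balanced_parts_def)
  ultimately show False using assms(3) card_mono unfolding num_balanced_card by (metis not_le)
qed

end

subsection \<open>Nullity and rank\<close>

text \<open>The subtraction does not truncate: see \<open>excess_eq\<close>.\<close>

definition excess :: "('v, 'e, 'k) gsgraph \<Rightarrow> 'e set \<Rightarrow> 'v set \<Rightarrow> nat" where
  "excess G S Y =
     card (edges_in G S Y) + (if sign_balanced G (edges_in G S Y) then 1 else 0) - card Y"

definition nullity :: "('v, 'e, 'k) gsgraph \<Rightarrow> 'e set \<Rightarrow> nat" where
  "nullity G S = card {e \<in> S. loose_edge G e} + (\<Sum>Y\<in>components G (verts G) S. excess G S Y)"

definition defect :: "('v, 'e, 'k::field) gsgraph \<Rightarrow> 'e set \<Rightarrow> nat" where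
  "defect G S = (if hyperbalanced G S then 0 else 1)"

lemma hyperbalanced_mono: "hyperbalanced G S' \<Longrightarrow> S \<subseteq> S' \<Longrightarrow> hyperbalanced G S"
  unfolding hyperbalanced_def by blast

lemma defect_mono: "S \<subseteq> S' \<Longrightarrow> defect G S \<le> defect G S'"
  using hyperbalanced_mono[of G S' S] by (simp add: defect_def)

lemma edge_val_linear: "edge_val G (\<lambda>v. \<theta> v + c * \<theta>' v) e = edge_val G \<theta> e + c * edge_val G \<theta>' e"
  by (simp add: edge_val_def sum.distrib sum_distrib_left algebra_simps)

context gain_signed
begin

text \<open>The lower bound on the edges comes from one root in the balanced case, and from the
  vertices of a negative figure as roots otherwise; such a figure has as many edges as
  vertices.\<close>

lemma excess_eq:
  assumes "S \<subseteq> edges G" "Y \<in> components G (verts G) S"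
  shows "card (edges_in G S Y) + (if sign_balanced G (edges_in G S Y) then 1 else 0) =
    card Y + excess G S Y"
proof -
  let ?T = "edges_in G S Y"
  note f = component_facts[OF assms]
  have fin: "finite ?T" using finite_subset_edges[OF f(1)] .
  have "card Y \<le> card ?T + (if sign_balanced G ?T then 1 else 0)"
  proof (cases "sign_balanced G ?T")
    case True
    obtain y where y: "y \<in> Y" using f(6) by blast
    have "card Y \<le> card {y} + card ?T"
      by (rule card_le_roots[OF fin]) (use f(5) y in \<open>auto simp: connected_graph_conn\<close>)
    then show ?thesis using True by simp
  next
    case False
    then obtain F where F: "F \<subseteq> ?T" "negative_figure G F" using not_sign_balanced_iff[OF f(1)] by blast
    have fig: "figure G F" using negative_figure_figure[OF F(2)] .
    have "card Y + card F \<le> card (edge_verts G F) + card ?T"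
      by (rule connected_card_bound[OF fin f(5,3) F(1) figure_verts_nonempty[OF fig]])
    then show ?thesis using figure_card[OF fig] False by simp
  qed
  then show ?thesis by (simp add: excess_def)
qed

lemma num_balanced_sum:
  "num_balanced G S =
    (\<Sum>Y\<in>components G (verts G) S. if sign_balanced G (edges_in G S Y) then 1 else 0)"
  unfolding num_balanced_def
  using finite_components[OF finite_verts, of G S] by (simp add: sum.If_cases Int_def)

lemma num_balanced_le: "num_balanced G S \<le> card (verts G)"
proof -
  have "num_balanced G S \<le> (\<Sum>Y\<in>components G (verts G) S. card Y)"
    unfolding num_balanced_sum
  proof (rule sum_mono)
    fix Y assume Y: "Y \<in> components G (verts G) S"
    have "finite Y" by (rule finite_subset[OF component_subset[OF Y] finite_verts])
    then have "card Y > 0" using component_nonempty[OF Y] by (simp add: card_gt_0_iff)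
    then show "(if sign_balanced G (edges_in G S Y) then 1 else 0) \<le> card Y" by simp
  qed
  then show ?thesis by (simp add: sum_card_components)
qed

lemma nullity_eq:
  assumes "S \<subseteq> edges G"
  shows "card S + num_balanced G S = card (verts G) + nullity G S"
proof -
  let ?K = "components G (verts G) S"
  have fin: "finite S" using finite_subset_edges[OF assms] .
  have "S = {e \<in> S. loose_edge G e} \<union> {e \<in> S. \<not> loose_edge G e}" by blast
  then have "card S = card {e \<in> S. loose_edge G e} + card {e \<in> S. \<not> loose_edge G e}"
    using card_Un_disjoint[of "{e \<in> S. loose_edge G e}" "{e \<in> S. \<not> loose_edge G e}"] fin by auto
  moreover have "card {e \<in> S. \<not> loose_edge G e} + num_balanced G S =
    (\<Sum>Y\<in>?K. card (edges_in G S Y) + (if sign_balanced G (edges_in G S Y) then 1 else 0))"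
    unfolding sum_card_edges_in[OF assms, symmetric] num_balanced_sum sum.distrib ..
  moreover have "\<dots> = (\<Sum>Y\<in>?K. card Y + excess G S Y)"
    using excess_eq[OF assms] by (rule sum.cong[OF refl])
  ultimately show ?thesis by (simp add: sum.distrib sum_card_components nullity_def)
qed

lemma rank_indep_iff: "rank_indep (edges G) (gs_rank G) I \<longleftrightarrow> I \<subseteq> edges G \<and> nullity G I = defect G I"
proof -
  have "gs_rank G I + num_balanced G I = card (verts G) + defect G I"
    using num_balanced_le[of I] by (simp add: gs_rank_def defect_def)
  then show ?thesis using nullity_eq[of I] by (auto simp: rank_indep_def)
qed

text \<open>The nullity comes from a loose edge or from a component of positive excess. The latter
  has at least as many edges as vertices if balanced, which gives a positive circle, and more edges
  than vertices if not, which is the case of \<open>bicyclic_sign_circuit\<close>.\<close>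

lemma sign_circuit_exists:
  assumes "S \<subseteq> edges G" "nullity G S > 0"
  obtains C where "C \<subseteq> S" "sign_circuit G C"
proof (cases "{e \<in> S. loose_edge G e} = {}")
  case False
  then obtain e where "e \<in> S" "loose_edge G e" by blast
  then show ?thesis using that[of "{e}"] assms(1) by (auto simp: sign_circuit_def)
next
  case True
  then have "(\<Sum>Y\<in>components G (verts G) S. excess G S Y) \<noteq> 0"
    using assms(2) unfolding nullity_def True by simp
  then obtain Y where Y: "Y \<in> components G (verts G) S" "excess G S Y \<noteq> 0"
    by (meson sum.neutral)
  note f = component_facts[OF assms(1) Y(1)]
  note ex = excess_eq[OF assms(1) Y(1)]
  have sub: "edges_in G S Y \<subseteq> S" by (rule edges_in_subset)
  show ?thesis
  proof (cases "sign_balanced G (edges_in G S Y)")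
    case True
    then have "card Y \<le> card (edges_in G S Y)" using ex Y(2) by simp
    then obtain C where "C \<subseteq> edges_in G S Y" "positive_circle G C"
      using unicyclic_positive_circle[OF f(1,2,6,3,4,5) _ True] by blast
    then show ?thesis using that[of C] sub by (auto simp: sign_circuit_def)
  next
    case False
    then obtain F where F: "F \<subseteq> edges_in G S Y" "negative_figure G F"
      using not_sign_balanced_iff[OF f(1)] by blast
    have "card Y < card (edges_in G S Y)" using ex Y(2) False by simp
    then obtain C where "C \<subseteq> edges_in G S Y" "sign_circuit G C"
      using bicyclic_sign_circuit[OF f(1-5) _ F(2,1)] by blast
    then show ?thesis using that[of C] sub by blast
  qed
qed

end

section \<open>Deletion of circuit edges, and the bases as maximal independent sets\<close>

context gain_signed_char
begin

lemma sign_circuit_nonempty: "sign_circuit G C \<Longrightarrow> C \<noteq> {}"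
  by (auto simp: sign_circuit_def positive_circle_def handcuff_parts_def
      dest: circleD(1) figure_nonempty)

text \<open>If the number changed, some potential would vanish on \<open>S - {e}\<close> but not on
  \<open>e\<close>; it would vanish on the rest of \<open>C\<close>, and the relation on
  \<open>C\<close> excludes that.\<close>

lemma num_balanced_remove:
  assumes "S \<subseteq> edges G" "sign_circuit G C" "C \<subseteq> S" "e \<in> C"
  shows "num_balanced G (S - {e}) = num_balanced G S"
proof (rule ccontr)
  assume "\<not> ?thesis"
  moreover have "num_balanced G S \<le> num_balanced G (S - {e})"
    by (rule balanced_parts_mono(1)) (use assms(1) in auto)
  ultimately have less: "num_balanced G S < num_balanced G (S - {e})" by simp
  obtain \<theta> f where f: "f \<in> S" "\<And>h. h \<in> S - {e} \<Longrightarrow> edge_val G \<theta> h = 0" "edge_val G \<theta> f \<noteq> 0"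
    using num_balanced_decrease[OF Diff_subset assms(1) less] by blast
  have "edge_val G \<theta> e = 0"
    by (rule sign_circuit_edge_val[OF assms(2,4)]) (use f(2) assms(3) in blast)
  then show False using f by (cases "f = e") auto
qed

lemma nullity_remove:
  assumes "S \<subseteq> edges G" "sign_circuit G C" "C \<subseteq> S" "e \<in> C"
  shows "nullity G S = Suc (nullity G (S - {e}))"
proof -
  have e: "e \<in> S" "finite S" using assms(3,4) finite_subset_edges[OF assms(1)] by auto
  have sub: "S - {e} \<subseteq> edges G" using assms(1) by blast
  have "card S = Suc (card (S - {e}))" using card_Suc_Diff1[OF e(2,1)] by simp
  then show ?thesis
    using nullity_eq[OF assms(1)] nullity_eq[OF sub] num_balanced_remove[OF assms] by simp
qed

lemma nullity_0_no_circuit: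
  assumes "S \<subseteq> edges G" "nullity G S = 0" "C \<subseteq> S"
  shows "\<not> sign_circuit G C"
proof
  assume C: "sign_circuit G C"
  then obtain e where "e \<in> C" using sign_circuit_nonempty by blast
  then show False using nullity_remove[OF assms(1) C assms(3)] assms(2) by simp
qed

text \<open>Deleting an edge of one circuit outside another would leave a set of nullity 0 that
  still contains the other.\<close>

lemma nullity_1_unique_circuit:
  assumes "S \<subseteq> edges G" "nullity G S = 1" "C \<subseteq> S" "sign_circuit G C" "D \<subseteq> S" "sign_circuit G D"
  shows "C = D"
proof -
  have "A \<subseteq> A'" if A: "A \<subseteq> S" "sign_circuit G A" "A' \<subseteq> S" "sign_circuit G A'" for A A'
  proof (rule ccontr)
    assume "\<not> A \<subseteq> A'"
    then obtain f where f: "f \<in> A" "f \<notin> A'" by blast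
    have "nullity G (S - {f}) = 0" using nullity_remove[OF assms(1) A(2,1) f(1)] assms(2) by simp
    then show False using nullity_0_no_circuit[of "S - {f}" A'] assms(1) A(3,4) f(2) by blast
  qed
  then show ?thesis using assms(3-6) by blast
qed

text \<open>By induction: while the nullity stays 0, each new edge lowers the number of balanced
  components. So some potential vanishes on the old edges but not on the new one, and a multiple of
  it adjusts the value there.\<close>

lemma nullity_0_potential:
  assumes "B \<subseteq> edges G" "nullity G B = 0"
  shows "\<exists>\<theta>. \<forall>f\<in>B. gain G f = edge_val G \<theta> f"
  using finite_subset_edges[OF assms(1)] assms
proof (induction B)
  case (insert e B)
  have B: "B \<subseteq> edges G" using insert.prems(1) by blast
  have "nullity G B = 0"
  proof (rule ccontr)
    assume "nullity G B \<noteq> 0"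
    then obtain C where "C \<subseteq> B" "sign_circuit G C" using sign_circuit_exists[OF B] by blast
    then show False using nullity_0_no_circuit[OF insert.prems, of C] by blast
  qed
  then obtain \<theta> where t: "\<And>f. f \<in> B \<Longrightarrow> gain G f = edge_val G \<theta> f" using insert.IH[OF B] by blast
  have less: "num_balanced G (insert e B) < num_balanced G B"
    using nullity_eq[OF insert.prems(1)] nullity_eq[OF B] \<open>nullity G B = 0\<close> insert.prems(2) insert.hyps
    by simp
  obtain \<theta>' f where f: "f \<in> insert e B" "\<And>h. h \<in> B \<Longrightarrow> edge_val G \<theta>' h = 0" "edge_val G \<theta>' f \<noteq> 0"
    using num_balanced_decrease[OF subset_insertI insert.prems(1) less] by blast
  then have e: "edge_val G \<theta>' e \<noteq> 0" by auto
  \<comment> \<open>The multiple of \<open>\<theta>'\<close> that corrects the value at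
    \<open>e\<close>; on \<open>B\<close> the correction is \<open>0\<close>.\<close>
  let ?c = "(gain G e - edge_val G \<theta> e) / edge_val G \<theta>' e"
  have "gain G h = edge_val G (\<lambda>v. \<theta> v + ?c * \<theta>' v) h" if "h \<in> insert e B" for h
    using that t[of h] f(2)[of h] e unfolding edge_val_linear by (cases "h = e") auto
  then show ?case by blast
qed simp

text \<open>A larger independent set is squeezed between \<open>B\<close> and
  \<open>edges G\<close>, so it has the same numbers and hence the same cardinality. Conversely, a
  shortfall in either number yields an edge whose addition keeps \<open>B\<close>
  independent.\<close>

lemma rank_basis_iff:
  assumes "B \<subseteq> edges G"
  shows "rank_basis (edges G) (gs_rank G) B \<longleftrightarrow> nullity G B = defect G B \<and>
    num_balanced G B = num_balanced G (edges G) \<and> defect G B = defect G (edges G)"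
proof
  assume r: "nullity G B = defect G B \<and> num_balanced G B = num_balanced G (edges G) \<and>
    defect G B = defect G (edges G)"
  have "B' = B" if B': "rank_indep (edges G) (gs_rank G) B'" "B \<subseteq> B'" for B'
  proof -
    have sub: "B' \<subseteq> edges G" and n: "nullity G B' = defect G B'" using B'(1) rank_indep_iff by auto
    have "num_balanced G B' = num_balanced G B"
      using balanced_parts_mono(1)[OF B'(2) sub] balanced_parts_mono(1)[OF sub subset_refl] r by simp
    moreover have "defect G B' = defect G B"
      using defect_mono[OF B'(2), of G] defect_mono[OF sub, of G] r by simp
    ultimately have "card B' = card B"
      using nullity_eq[OF sub] nullity_eq[OF assms] n r by simp
    then show ?thesis using card_subset_eq[OF finite_subset_edges[OF sub] B'(2)] by simp
  qed
  then show "rank_basis (edges G) (gs_rank G) B"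
    using r assms by (simp add: rank_basis_def rank_indep_iff)
next
  assume "rank_basis (edges G) (gs_rank G) B"
  then have n: "nullity G B = defect G B"
    and maximal: "\<And>B'. rank_indep (edges G) (gs_rank G) B' \<Longrightarrow> B \<subseteq> B' \<Longrightarrow> B' = B"
    by (auto simp: rank_basis_def rank_indep_iff)
  have fin: "finite B" using finite_subset_edges[OF assms] .
  have not_indep: "nullity G (insert e B) \<noteq> defect G (insert e B)" if "e \<in> edges G" "e \<notin> B" for e
    using maximal[of "insert e B"] that assms by (auto simp: rank_indep_iff)
  \<comment> \<open>A potential that vanishes on \<open>B\<close> but not on \<open>e\<close> keeps
    \<open>e\<close> out of every sign circuit of \<open>insert e B\<close>. Then neither the defect
    nor the nullity changes, and \<open>insert e B\<close> is independent.\<close>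
  have b: "num_balanced G B = num_balanced G (edges G)"
  proof (rule ccontr)
    assume "\<not> ?thesis"
    then have less: "num_balanced G (edges G) < num_balanced G B"
      using balanced_parts_mono(1)[OF assms subset_refl] by simp
    obtain \<theta> e where e: "e \<in> edges G" "\<And>f. f \<in> B \<Longrightarrow> edge_val G \<theta> f = 0" "edge_val G \<theta> e \<noteq> 0"
      using num_balanced_decrease[OF assms subset_refl less] by blast
    then have eB: "e \<notin> B" by blast
    let ?B = "insert e B"
    have sub: "?B \<subseteq> edges G" using e(1) assms by blast
    have circuits: "C \<subseteq> B" if C: "sign_circuit G C" "C \<subseteq> ?B" for C
    proof (rule ccontr)
      assume "\<not> C \<subseteq> B"
      then have "e \<in> C" using C(2) by blast
      then have "edge_val G \<theta> e = 0"
        by (rule sign_circuit_edge_val[OF C(1)]) (use e(2) C(2) in blast)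
      then show False using e(3) by simp
    qed
    have d: "defect G ?B = defect G B"
    proof -
      have "hyperbalanced G ?B \<longleftrightarrow> hyperbalanced G B"
        using circuits unfolding hyperbalanced_def by blast
      then show ?thesis by (simp add: defect_def)
    qed
    have "nullity G ?B = nullity G B"
    proof (cases "nullity G B = 0")
      case True
      have "nullity G ?B = 0"
      proof (rule ccontr)
        assume "nullity G ?B \<noteq> 0"
        then obtain C where "C \<subseteq> ?B" "sign_circuit G C" using sign_circuit_exists[OF sub] by blast
        then show False using circuits nullity_0_no_circuit[OF assms True] by blast
      qed
      then show ?thesis using True by simp
    next
      case False
      then have one: "nullity G B = 1" using n by (simp add: defect_def split: if_splits)
      then obtain C where C: "C \<subseteq> B" "sign_circuit G C" using sign_circuit_exists[OF assms] by auto
      obtain f where f: "f \<in> C" using sign_circuit_nonempty[OF C(2)] by blast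
      have sub': "?B - {f} \<subseteq> edges G" using sub by blast
      \<comment> \<open>\<open>f\<close> lies on the only sign circuit of \<open>B\<close>, and
        \<open>insert e B\<close> has no further one.\<close>
      have "nullity G (?B - {f}) = 0"
      proof (rule ccontr)
        assume "nullity G (?B - {f}) \<noteq> 0"
        then obtain D where D: "D \<subseteq> ?B - {f}" "sign_circuit G D" using sign_circuit_exists[OF sub'] by blast
        then have "D \<subseteq> B" using circuits by blast
        then have "D = C" using nullity_1_unique_circuit[OF assms one _ D(2) C] by blast
        then show False using D(1) f by blast
      qed
      moreover have "nullity G ?B = Suc (nullity G (?B - {f}))"
        by (rule nullity_remove[OF sub C(2) _ f]) (use C(1) in blast)
      ultimately show ?thesis using one by simp
    qed
    then show False using not_indep[OF e(1) eB] n d by simp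
  qed
  \<comment> \<open>A hyperbalanced \<open>B\<close> has nullity 0 and thus a potential. Every
    further edge closes a sign circuit with \<open>B\<close>, neutral by maximality, so the same
    potential also gives its gain, and the whole graph would be hyperbalanced.\<close>
  moreover have "defect G B = defect G (edges G)"
  proof (rule ccontr)
    assume ne: "\<not> ?thesis"
    then have hb: "hyperbalanced G B" and nhE: "\<not> hyperbalanced G (edges G)"
      using hyperbalanced_mono[OF _ assms] by (auto simp: defect_def split: if_splits)
    have n0: "nullity G B = 0" using n hb by (simp add: defect_def)
    obtain \<theta> where t: "\<And>f. f \<in> B \<Longrightarrow> gain G f = edge_val G \<theta> f"
      using nullity_0_potential[OF assms n0] by blast
    have "gain G e = edge_val G \<theta> e" if e: "e \<in> edges G" for e
    proof (cases "e \<in> B")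
      case True
      then show ?thesis by (rule t)
    next
      case False
      let ?B = "insert e B"
      have sub: "?B \<subseteq> edges G" using e assms by blast
      have "num_balanced G ?B = num_balanced G B"
        using balanced_parts_mono(1)[OF subset_insertI sub] balanced_parts_mono(1)[OF sub subset_refl] b
        by simp
      then have n1: "nullity G ?B = 1"
        using nullity_eq[OF sub] nullity_eq[OF assms] n0 fin False by simp
      then have hyp: "hyperbalanced G ?B"
        using not_indep[OF e False] by (auto simp: defect_def split: if_splits)
      obtain C where C: "C \<subseteq> ?B" "sign_circuit G C" using sign_circuit_exists[OF sub] n1 by auto
      have "e \<in> C" using nullity_0_no_circuit[OF assms n0, of C] C by blast
      moreover have "neutral G C" using hyp C unfolding hyperbalanced_def by blast
      ultimately show ?thesis
        using neutral_circuit_potential[OF C(2), of e \<theta>] t C(1) by blast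
    qed
    then have "hyperbalanced G (edges G)"
      unfolding hyperbalanced_def using sign_circuit_potential_neutral by blast
    then show False using nhE by simp
  qed
  ultimately show "nullity G B = defect G B \<and> num_balanced G B = num_balanced G (edges G) \<and>
    defect G B = defect G (edges G)" using n by simp
qed

end

subsection \<open>The shapes of the bases\<close>

lemma sum_eq_1_single:
  fixes f :: "'a \<Rightarrow> nat"
  assumes "finite K" "(\<Sum>Y\<in>K. f Y) \<le> 1" "X \<in> K" "f X \<noteq> 0"
  shows "f X = 1" "Y \<in> K \<Longrightarrow> Y \<noteq> X \<Longrightarrow> f Y = 0"
proof -
  have s: "f X + (\<Sum>Y\<in>K - {X}. f Y) \<le> 1" using assms(2) by (simp add: sum.remove[OF assms(1,3)])
  then show "f X = 1" using assms(4) by simp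
  have "(\<Sum>Y\<in>K - {X}. f Y) = 0" using s assms(4) by simp
  then show "Y \<in> K \<Longrightarrow> Y \<noteq> X \<Longrightarrow> f Y = 0" using assms(1) by simp
qed

lemma sum_single:
  fixes f :: "'a \<Rightarrow> nat"
  assumes "finite K" "X \<in> K" "\<And>Y. Y \<in> K \<Longrightarrow> Y \<noteq> X \<Longrightarrow> f Y = 0"
  shows "(\<Sum>Y\<in>K. f Y) = f X"
  using assms by (simp add: sum.remove)

context gain_signed
begin

section \<open>Components of \<open>B\<close> inside components of \<open>G\<close>\<close>

lemma finite_comps: "finite (components G (verts G) S)"
  by (rule finite_components[OF finite_verts])

lemma part_eq: "B \<subseteq> edges G \<Longrightarrow> part G B X = edges_in G B X"
  by (auto simp: edges_in_def)

lemma component_container: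
  assumes "B \<subseteq> edges G" "Y \<in> components G (verts G) B"
  obtains X where "X \<in> comps G" "Y \<subseteq> X"
proof -
  obtain y where y: "y \<in> Y" using component_nonempty[OF assms(2)] by blast
  then have "y \<in> verts G" using component_subset[OF assms(2)] by blast
  then obtain X where X: "X \<in> comps G" "y \<in> X" using Union_components[of G "verts G" "edges G"] by blast
  show ?thesis by (rule that[OF X(1) component_refine[OF assms X(1) y X(2)]])
qed

lemma subcomponent:
  assumes "B \<subseteq> edges G" "X \<in> comps G" "x \<in> X"
  shows "{w \<in> X. conn G (edges_in G B X) x w} = {w \<in> verts G. conn G B x w}"
proof -
  have xV: "x \<in> verts G" using component_subset[OF assms(2)] assms(3) by blast
  let ?Y = "{w \<in> verts G. conn G B x w}"
  have Y: "?Y \<in> components G (verts G) B" by (rule component_mem[OF xV])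
  have xY: "x \<in> ?Y" using xV by simp
  have YX: "?Y \<subseteq> X" by (rule component_refine[OF assms(1) Y assms(2) xY assms(3)])
  show ?thesis
  proof
    show "{w \<in> X. conn G (edges_in G B X) x w} \<subseteq> ?Y"
      using component_subset[OF assms(2)] conn_mono[OF _ edges_in_subset[of G B X], of G] by blast
    show "?Y \<subseteq> {w \<in> X. conn G (edges_in G B X) x w}"
    proof
      fix w assume w: "w \<in> ?Y"
      have "conn G (edges_in G B ?Y) x w" by (rule conn_edges_in[OF assms(1) Y _ xY]) (use w in simp)
      then have "conn G (edges_in G B X) x w"
        by (rule conn_mono) (rule edges_in_mono[OF subset_refl YX])
      then show "w \<in> {w \<in> X. conn G (edges_in G B X) x w}" using w YX by blast
    qed
  qed
qed

text \<open>The conditions of the theorem take components within each component of \<open>G\<close>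
  separately, while nullity sums over the components of \<open>B\<close> as a spanning subgraph;
  this identifies the two.\<close>

lemma components_within:
  assumes "B \<subseteq> edges G" "X \<in> comps G"
  shows "components G X (edges_in G B X) = {Y \<in> components G (verts G) B. Y \<subseteq> X}"
proof
  show "components G X (edges_in G B X) \<subseteq> {Y \<in> components G (verts G) B. Y \<subseteq> X}"
  proof
    fix Y assume Y: "Y \<in> components G X (edges_in G B X)"
    then obtain x where x: "x \<in> X" "Y = {w \<in> X. conn G (edges_in G B X) x w}"
      by (auto simp: components_image)
    then have "Y = {w \<in> verts G. conn G B x w}" using subcomponent[OF assms x(1)] by simp
    then have "Y \<in> components G (verts G) B"
      using component_mem[of x "verts G" G B] component_subset[OF assms(2)] x(1) by blast
    then show "Y \<in> {Y \<in> components G (verts G) B. Y \<subseteq> X}" using component_subset[OF Y] by blast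
  qed
  show "{Y \<in> components G (verts G) B. Y \<subseteq> X} \<subseteq> components G X (edges_in G B X)"
  proof
    fix Y assume Y: "Y \<in> {Y \<in> components G (verts G) B. Y \<subseteq> X}"
    then have Yc: "Y \<in> components G (verts G) B" "Y \<subseteq> X" by auto
    obtain x where x: "x \<in> Y" using component_nonempty[OF Yc(1)] by blast
    then have xX: "x \<in> X" using Yc(2) by blast
    have "Y = {w \<in> X. conn G (edges_in G B X) x w}"
      using component_eq(1)[OF Yc(1) x] subcomponent[OF assms xX] by simp
    then show "Y \<in> components G X (edges_in G B X)" using component_mem[OF xX] by metis
  qed
qed

lemma edges_in_within: "Y \<subseteq> X \<Longrightarrow> edges_in G (edges_in G B X) Y = edges_in G B Y"
  by (auto simp: edges_in_def)

lemma connected_part_component: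
  assumes "B \<subseteq> edges G" "X \<in> comps G" "connected_graph G X (edges_in G B X)"
  shows "X \<in> components G (verts G) B"
proof -
  obtain x where x: "x \<in> X" using component_nonempty[OF assms(2)] by blast
  have "X = {w \<in> X. conn G (edges_in G B X) x w}"
    using assms(3) x by (auto simp: connected_graph_conn)
  then have "X \<in> components G X (edges_in G B X)" using component_mem[OF x] by metis
  then show ?thesis using components_within[OF assms(1,2)] by blast
qed

section \<open>The conditions of the theorem in terms of excess\<close>

lemma tree_sign_balanced: "T \<subseteq> edges G \<Longrightarrow> tree G X T \<Longrightarrow> sign_balanced G T"
  using kinds_disjoint(1) unfolding tree_def forest_def sign_balanced_def negative_circle_def by blast

lemma tree_component_iff:
  assumes "B \<subseteq> edges G" "X \<in> components G (verts G) B"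
  shows "tree G X (edges_in G B X) \<longleftrightarrow> X \<in> balanced_parts G B \<and> excess G B X = 0"
proof -
  note f = component_facts[OF assms]
  have "tree G X (edges_in G B X) \<longleftrightarrow> card X = Suc (card (edges_in G B X))"
    using tree_iff[OF f(1,2,6,3)] f(5) by simp
  then show ?thesis
    using tree_sign_balanced[OF f(1), of X] excess_eq[OF assms] assms(2)
    by (auto simp: balanced_parts_def)
qed

lemma unicycle_component_iff:
  assumes "B \<subseteq> edges G" "Y \<in> components G (verts G) B"
  shows "unbalanced_unicycle G Y (edges_in G B Y) \<longleftrightarrow> Y \<notin> balanced_parts G B \<and> excess G B Y = 0"
  using unbalanced_unicycle_iff[OF component_facts(1-3)[OF assms]] component_facts(5)[OF assms]
    excess_eq[OF assms] assms(2) by (auto simp: balanced_parts_def)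

lemma balanced_comp_iff: "balanced_comp G X \<longleftrightarrow> X \<in> balanced_parts G (edges G)"
  by (simp add: balanced_comp_def balanced_parts_def)

lemma unbalanced_comp_iff: "unbalanced_comp G X \<longleftrightarrow> X \<in> comps G \<and> X \<notin> balanced_parts G (edges G)"
  by (auto simp: unbalanced_comp_def balanced_parts_def)

lemma balanced_part_inherit:
  assumes "B \<subseteq> edges G" "X \<in> balanced_parts G (edges G)" "Y \<in> components G (verts G) B" "Y \<subseteq> X"
  shows "Y \<in> balanced_parts G B"
  using assms sign_balanced_mono[of G "edges_in G (edges G) X" "edges_in G B Y"]
    edges_in_mono[OF assms(1,4)] by (auto simp: balanced_parts_def)

text \<open>A spanning tree of \<open>X\<close> keeps \<open>X\<close> connected in
  \<open>B\<close>, and its balance is inherited from the component of \<open>G\<close>; hence the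
  first clause speaks only of components and excess.\<close>

lemma comp_conditions_iff:
  assumes "B \<subseteq> edges G"
  shows "comp_conditions G B A \<longleftrightarrow>
    (\<forall>X\<in>balanced_parts G (edges G) - A. X \<in> components G (verts G) B \<and> excess G B X = 0) \<and>
    (\<forall>X\<in>comps G - balanced_parts G (edges G) - A. \<forall>Y\<in>components G (verts G) B.
       Y \<subseteq> X \<longrightarrow> Y \<notin> balanced_parts G B \<and> excess G B Y = 0)"
proof -
  have t: "tree G X (part G B X) \<longleftrightarrow> X \<in> components G (verts G) B \<and> excess G B X = 0"
    if X: "X \<in> balanced_parts G (edges G)" for X
  proof
    have Xc: "X \<in> comps G" using X by (simp add: balanced_parts_def)
    assume t: "tree G X (part G B X)"
    then have "connected_graph G X (edges_in G B X)" unfolding part_eq[OF assms] by (simp add: tree_def)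
    then have "X \<in> components G (verts G) B" by (rule connected_part_component[OF assms Xc])
    then show "X \<in> components G (verts G) B \<and> excess G B X = 0"
      using tree_component_iff[OF assms] t unfolding part_eq[OF assms] by blast
  next
    assume c: "X \<in> components G (verts G) B \<and> excess G B X = 0"
    then have "X \<in> balanced_parts G B" using balanced_part_inherit[OF assms X] by blast
    then show "tree G X (part G B X)"
      using tree_component_iff[OF assms] c unfolding part_eq[OF assms] by blast
  qed
  have u: "union_of_unbalanced_unicycles G X (part G B X) \<longleftrightarrow>
    (\<forall>Y\<in>components G (verts G) B. Y \<subseteq> X \<longrightarrow> Y \<notin> balanced_parts G B \<and> excess G B Y = 0)"
    if X: "X \<in> comps G" for X
    unfolding union_of_unbalanced_unicycles_def part_eq[OF assms] components_within[OF assms X]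
    using unicycle_component_iff[OF assms] by (auto simp: edges_in_within)
  show ?thesis
    unfolding comp_conditions_def balanced_comp_iff unbalanced_comp_iff
    by (rule arg_cong2[where f = "(\<and>)"]; simp add: Ball_def t u)
qed

text \<open>By the last premise a balanced component of \<open>B\<close> lies in a balanced
  component of \<open>G\<close>; as the latter is itself a component of \<open>B\<close>, the two
  coincide.\<close>

lemma balanced_parts_eqI:
  assumes "B \<subseteq> edges G" "balanced_parts G (edges G) \<subseteq> components G (verts G) B"
    "\<And>X Y. X \<in> comps G \<Longrightarrow> X \<notin> balanced_parts G (edges G) \<Longrightarrow> Y \<in> components G (verts G) B \<Longrightarrow>
       Y \<subseteq> X \<Longrightarrow> Y \<notin> balanced_parts G B"
  shows "balanced_parts G B = balanced_parts G (edges G)"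
proof
  show "balanced_parts G (edges G) \<subseteq> balanced_parts G B"
    using assms(2) balanced_part_inherit[OF assms(1)] by blast
  show "balanced_parts G B \<subseteq> balanced_parts G (edges G)"
  proof
    fix Y assume Y: "Y \<in> balanced_parts G B"
    then have Yc: "Y \<in> components G (verts G) B" by (simp add: balanced_parts_def)
    obtain X where X: "X \<in> comps G" "Y \<subseteq> X" using component_container[OF assms(1) Yc] .
    then have Xb: "X \<in> balanced_parts G (edges G)" using assms(3)[OF X(1) _ Yc X(2)] Y by blast
    obtain y where y: "y \<in> Y" using component_nonempty[OF Yc] by blast
    have "Y = X" by (rule component_unique[OF Yc _ y]) (use assms(2) Xb X(2) y in auto)
    then show "Y \<in> balanced_parts G (edges G)" using Xb by simp
  qed
qed

text \<open>A balanced component of \<open>B\<close> is now a component of \<open>G\<close> as well,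
  hence equal to the one that contains it.\<close>

lemma unbalanced_comp_parts:
  assumes "B \<subseteq> edges G" "balanced_parts G B = balanced_parts G (edges G)" "X \<in> comps G"
    "Y \<in> components G (verts G) B" "Y \<subseteq> X"
  shows "Y \<in> balanced_parts G B \<longleftrightarrow> X \<in> balanced_parts G (edges G)" "Y \<in> balanced_parts G B \<Longrightarrow> Y = X"
proof -
  obtain y where y: "y \<in> Y" using component_nonempty[OF assms(4)] by blast
  have eq: "Y = X" if "Y \<in> balanced_parts G B"
    by (rule component_unique[OF _ assms(3) y]) (use that assms(2,5) y in \<open>auto simp: balanced_parts_def\<close>)
  then show "Y \<in> balanced_parts G B \<Longrightarrow> Y = X" .
  show "Y \<in> balanced_parts G B \<longleftrightarrow> X \<in> balanced_parts G (edges G)"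
    using eq assms(2) balanced_part_inherit[OF assms(1) _ assms(4,5)] by blast
qed

lemma comp_conditionsI:
  assumes "B \<subseteq> edges G" "balanced_parts G B = balanced_parts G (edges G)"
    "\<And>X Y. X \<in> comps G - A \<Longrightarrow> Y \<in> components G (verts G) B \<Longrightarrow> Y \<subseteq> X \<Longrightarrow> excess G B Y = 0"
  shows "comp_conditions G B A"
  unfolding comp_conditions_iff[OF assms(1)]
proof (intro conjI ballI impI)
  fix X assume X: "X \<in> balanced_parts G (edges G) - A"
  then have "X \<in> balanced_parts G B" using assms(2) by simp
  then show c: "X \<in> components G (verts G) B" by (simp add: balanced_parts_def)
  show "excess G B X = 0" by (rule assms(3)[OF _ c subset_refl]) (use X in \<open>auto simp: balanced_parts_def\<close>)
next
  fix X Y assume XY: "X \<in> comps G - balanced_parts G (edges G) - A"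
    "Y \<in> components G (verts G) B" "Y \<subseteq> X"
  then show "Y \<notin> balanced_parts G B" using unbalanced_comp_parts(1)[OF assms(1,2) _ XY(2,3)] by blast
  show "excess G B Y = 0" using assms(3)[OF _ XY(2,3)] XY(1) by blast
qed

lemma comp_conditions_excess:
  assumes "B \<subseteq> edges G" "comp_conditions G B A" "X \<in> comps G - A" "Y \<in> components G (verts G) B" "Y \<subseteq> X"
  shows "excess G B Y = 0"
proof (cases "X \<in> balanced_parts G (edges G)")
  case True
  then have X: "X \<in> components G (verts G) B" "excess G B X = 0"
    using assms(2,3) unfolding comp_conditions_iff[OF assms(1)] by blast+
  obtain y where y: "y \<in> Y" using component_nonempty[OF assms(4)] by blast
  have "Y = X" by (rule component_unique[OF assms(4) X(1) y]) (use y assms(5) in blast)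
  then show ?thesis using X(2) by simp
next
  case False
  then show ?thesis using assms(2-5) unfolding comp_conditions_iff[OF assms(1)] by blast
qed

lemma comp_conditions_balanced_parts:
  assumes "B \<subseteq> edges G" "comp_conditions G B A"
    "\<And>X. X \<in> A \<Longrightarrow> X \<in> balanced_parts G (edges G) \<Longrightarrow> X \<in> components G (verts G) B"
    "\<And>X Y. X \<in> A \<Longrightarrow> X \<in> comps G \<Longrightarrow> X \<notin> balanced_parts G (edges G) \<Longrightarrow>
       Y \<in> components G (verts G) B \<Longrightarrow> Y \<subseteq> X \<Longrightarrow> Y \<notin> balanced_parts G B"
  shows "balanced_parts G B = balanced_parts G (edges G)"
proof (rule balanced_parts_eqI[OF assms(1)])
  note cc = assms(2)[unfolded comp_conditions_iff[OF assms(1)]]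
  show "balanced_parts G (edges G) \<subseteq> components G (verts G) B" using cc assms(3) by blast
  show "Y \<notin> balanced_parts G B" if "X \<in> comps G" "X \<notin> balanced_parts G (edges G)"
    "Y \<in> components G (verts G) B" "Y \<subseteq> X" for X Y
    using that cc assms(4) by (cases "X \<in> A") blast+
qed

lemma no_loose_card: "B \<subseteq> edges G \<Longrightarrow> no_loose_edges G B \<longleftrightarrow> card {e \<in> B. loose_edge G e} = 0"
  using finite_subset_edges[of B] by (auto simp: no_loose_edges_def)

lemma type_I_iff:
  assumes "B \<subseteq> edges G"
  shows "type_I G B \<longleftrightarrow> balanced_parts G B = balanced_parts G (edges G) \<and> nullity G B = 0"
proof
  assume t: "type_I G B"
  then have cc: "comp_conditions G B {}" and nl: "no_loose_edges G B" by (auto simp: type_I_def)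
  have "balanced_parts G B = balanced_parts G (edges G)"
    by (rule comp_conditions_balanced_parts[OF assms cc]) auto
  moreover have "excess G B Y = 0" if Y: "Y \<in> components G (verts G) B" for Y
  proof -
    obtain X where X: "X \<in> comps G" "Y \<subseteq> X" using component_container[OF assms Y] .
    show ?thesis by (rule comp_conditions_excess[OF assms cc _ Y X(2)]) (use X(1) in simp)
  qed
  ultimately show "balanced_parts G B = balanced_parts G (edges G) \<and> nullity G B = 0"
    using nl no_loose_card[OF assms] by (simp add: nullity_def)
next
  assume a: "balanced_parts G B = balanced_parts G (edges G) \<and> nullity G B = 0"
  then have "card {e \<in> B. loose_edge G e} = 0" "(\<Sum>Y\<in>components G (verts G) B. excess G B Y) = 0"
    by (simp_all add: nullity_def)
  then have "no_loose_edges G B" "\<And>Y. Y \<in> components G (verts G) B \<Longrightarrow> excess G B Y = 0"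
    using no_loose_card[OF assms] finite_comps[of B] by auto
  then show "type_I G B" using comp_conditionsI[OF assms] a by (simp add: type_I_def)
qed

text \<open>These are the bases of a hyperfrustrated graph. The cases of the theorem differ only in
  where the single unit of nullity sits: in a loose edge, in a balanced component or in an
  unbalanced one.\<close>

definition exceptional :: "'e set \<Rightarrow> bool" where
  "exceptional B \<longleftrightarrow> balanced_parts G B = balanced_parts G (edges G) \<and>
     \<not> hyperbalanced G B \<and> nullity G B = 1"

end

section \<open>The three places for the unit of nullity\<close>

context gain_signed_char
begin

lemma exceptional_circuit:
  assumes "B \<subseteq> edges G" "exceptional B"
  obtains C where "C \<subseteq> B" "sign_circuit G C" "\<not> neutral G C"
    "\<And>D. D \<subseteq> B \<Longrightarrow> sign_circuit G D \<Longrightarrow> D = C"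
proof -
  obtain C where C: "C \<subseteq> B" "sign_circuit G C" "\<not> neutral G C"
    using assms(2) unfolding exceptional_def hyperbalanced_def by blast
  have "nullity G B = 1" using assms(2) by (simp add: exceptional_def)
  then show ?thesis using that[OF C] nullity_1_unique_circuit[OF assms(1) _ _ _ C(1,2)] by blast
qed

lemma type_II_loose_iff:
  assumes "B \<subseteq> edges G"
  shows "type_II_loose G B \<longleftrightarrow> exceptional B \<and> \<not> no_loose_edges G B"
proof
  assume "type_II_loose G B"
  then obtain e where cc: "comp_conditions G B {}" and e: "e \<in> B" "loose_edge G e" "\<not> neutral G {e}"
    "no_loose_edges G (B - {e})" by (auto simp: type_II_loose_def)
  have "balanced_parts G B = balanced_parts G (edges G)"
    by (rule comp_conditions_balanced_parts[OF assms cc]) auto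
  moreover have "excess G B Y = 0" if Y: "Y \<in> components G (verts G) B" for Y
  proof -
    obtain X where X: "X \<in> comps G" "Y \<subseteq> X" using component_container[OF assms Y] .
    show ?thesis by (rule comp_conditions_excess[OF assms cc _ Y X(2)]) (use X(1) in simp)
  qed
  moreover have "{e \<in> B. loose_edge G e} = {e}" using e by (auto simp: no_loose_edges_def)
  moreover have "sign_circuit G {e}" using e(1,2) assms by (auto simp: sign_circuit_def)
  then have "\<not> hyperbalanced G B" using e(1,3) unfolding hyperbalanced_def by blast
  ultimately show "exceptional B \<and> \<not> no_loose_edges G B"
    using e(1,2) by (auto simp: exceptional_def nullity_def no_loose_edges_def)
next
  assume a: "exceptional B \<and> \<not> no_loose_edges G B"
  then have ex: "balanced_parts G B = balanced_parts G (edges G)" "nullity G B = 1"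
    by (simp_all add: exceptional_def)
  have "card {e \<in> B. loose_edge G e} \<noteq> 0" using a no_loose_card[OF assms] by blast
  then have c: "card {e \<in> B. loose_edge G e} = 1" "(\<Sum>Y\<in>components G (verts G) B. excess G B Y) = 0"
    using ex(2) unfolding nullity_def by linarith+
  obtain e where e: "{e \<in> B. loose_edge G e} = {e}" using c(1) by (rule card_1_singletonE)
  then have eB: "e \<in> B" "loose_edge G e" by auto
  have "no_loose_edges G (B - {e})" using e by (auto simp: no_loose_edges_def)
  moreover have "\<And>Y. Y \<in> components G (verts G) B \<Longrightarrow> excess G B Y = 0"
    using c(2) finite_comps[of B] by auto
  then have "comp_conditions G B {}" using comp_conditionsI[OF assms ex(1)] by blast
  \<comment> \<open>\<open>{e}\<close> is a sign circuit inside a set whose only sign circuit is not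
    neutral.\<close>
  moreover have "\<not> neutral G {e}"
  proof -
    obtain C where C: "\<not> neutral G C" "\<And>D. D \<subseteq> B \<Longrightarrow> sign_circuit G D \<Longrightarrow> D = C"
      using exceptional_circuit[OF assms] a by metis
    have "sign_circuit G {e}" using eB assms by (auto simp: sign_circuit_def)
    then have "{e} = C" using C(2)[of "{e}"] eB(1) by blast
    then show ?thesis using C(1) by simp
  qed
  ultimately show "type_II_loose G B" using eB by (auto simp: type_II_loose_def)
qed

lemma nullity_single_excess:
  assumes "B \<subseteq> edges G" "no_loose_edges G B" "Y \<in> components G (verts G) B" "excess G B Y = 1"
    "\<And>Y'. Y' \<in> components G (verts G) B \<Longrightarrow> Y' \<noteq> Y \<Longrightarrow> excess G B Y' = 0"
  shows "nullity G B = 1"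
proof -
  have "(\<Sum>Y\<in>components G (verts G) B. excess G B Y) = excess G B Y"
    by (rule sum_single[OF finite_comps assms(3,5)])
  then show ?thesis unfolding nullity_def using assms(2,4) no_loose_card[OF assms(1)] by simp
qed

lemma exceptional_excess:
  assumes "exceptional B" "Y \<in> components G (verts G) B" "excess G B Y \<noteq> 0"
  shows "excess G B Y = 1" "Y' \<in> components G (verts G) B \<Longrightarrow> Y' \<noteq> Y \<Longrightarrow> excess G B Y' = 0"
proof -
  have "(\<Sum>Y\<in>components G (verts G) B. excess G B Y) \<le> 1"
    using assms(1) by (simp add: exceptional_def nullity_def)
  note s = sum_eq_1_single[OF finite_comps this assms(2), OF assms(3)]
  show "excess G B Y = 1" "Y' \<in> components G (verts G) B \<Longrightarrow> Y' \<noteq> Y \<Longrightarrow> excess G B Y' = 0"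
    using s by blast+
qed

text \<open>The unicycle keeps \<open>X\<close> connected, so every balanced component of
  \<open>G\<close> remains a component of \<open>B\<close>. Conversely, the unit of excess gives a
  positive circle; as the only sign circuit of \<open>B\<close> it is not neutral, and its presence
  shows that the component of \<open>G\<close> is no tree.\<close>

lemma type_II_balanced_iff:
  assumes "B \<subseteq> edges G"
  shows "type_II_balanced G B \<longleftrightarrow> exceptional B \<and> no_loose_edges G B \<and>
    (\<exists>Y\<in>balanced_parts G B. excess G B Y \<noteq> 0)"
proof
  assume "type_II_balanced G B"
  then obtain X where nl: "no_loose_edges G B" and X: "X \<in> balanced_parts G (edges G)"
    "nonneutral_balanced_unicycle G X (edges_in G B X)" and cc: "comp_conditions G B {X}"
    unfolding type_II_balanced_def balanced_comp_iff part_eq[OF assms] by blast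
  obtain C where C: "positive_circle G C" "with_trees G C X (edges_in G B X)" "\<not> neutral G C"
    using X(2) by (auto simp: nonneutral_balanced_unicycle_def)
  have Xc: "X \<in> comps G" using X(1) by (simp add: balanced_parts_def)
  have CT: "C \<subseteq> edges_in G B X" using C(2) by (simp add: with_trees_def)
  have TE: "edges_in G B X \<subseteq> edges G" using edges_in_subset[of G B X] assms by blast
  have finX: "finite X" by (rule finite_subset[OF component_subset[OF Xc] finite_verts])
  have conn: "connected_graph G X (edges_in G B X)" "card X = card (edges_in G B X)"
    using C(2) balanced_unicycle_iff[OF TE finX edges_in_verts CT C(1)] by auto
  have XB: "X \<in> components G (verts G) B" by (rule connected_part_component[OF assms Xc conn(1)])
  have bal: "X \<in> balanced_parts G B" by (rule balanced_part_inherit[OF assms X(1) XB subset_refl])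
  have P: "balanced_parts G B = balanced_parts G (edges G)"
    by (rule comp_conditions_balanced_parts[OF assms cc]) (use XB X(1) in auto)
  have ex1: "excess G B X = 1" using excess_eq[OF assms XB] bal conn(2) by (simp add: balanced_parts_def)
  have "excess G B Y = 0" if Y: "Y \<in> components G (verts G) B" "Y \<noteq> X" for Y
  proof -
    obtain X' where X': "X' \<in> comps G" "Y \<subseteq> X'" using component_container[OF assms Y(1)] .
    have "X' \<noteq> X"
    proof
      assume "X' = X"
      obtain y where y: "y \<in> Y" using component_nonempty[OF Y(1)] by blast
      then show False using component_unique[OF Y(1) XB y] X'(2) \<open>X' = X\<close> Y(2) by blast
    qed
    then show ?thesis using comp_conditions_excess[OF assms cc _ Y(1) X'(2)] X'(1) by blast
  qed
  then have "nullity G B = 1" by (rule nullity_single_excess[OF assms nl XB ex1])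
  moreover have "C \<subseteq> B" using CT edges_in_subset[of G B X] by blast
  then have "\<not> hyperbalanced G B" using C(1,3) unfolding hyperbalanced_def sign_circuit_def by blast
  ultimately have "exceptional B" using P by (simp add: exceptional_def)
  moreover have "excess G B X \<noteq> 0" using ex1 by simp
  ultimately show "exceptional B \<and> no_loose_edges G B \<and> (\<exists>Y\<in>balanced_parts G B. excess G B Y \<noteq> 0)"
    using nl bal by blast
next
  assume a: "exceptional B \<and> no_loose_edges G B \<and> (\<exists>Y\<in>balanced_parts G B. excess G B Y \<noteq> 0)"
  then obtain X where X: "X \<in> balanced_parts G B" "excess G B X \<noteq> 0" by blast
  have P: "balanced_parts G B = balanced_parts G (edges G)" using a by (simp add: exceptional_def)
  have XB: "X \<in> components G (verts G) B" and bal: "sign_balanced G (edges_in G B X)"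
    using X(1) by (auto simp: balanced_parts_def)
  have XE: "X \<in> balanced_parts G (edges G)" using X(1) P by simp
  then have Xc: "X \<in> comps G" by (simp add: balanced_parts_def)
  note ex = exceptional_excess[OF _ XB X(2)]
  have ex1: "excess G B X = 1" using ex(1) a by blast
  note f = component_facts[OF assms XB]
  have cX: "card X = card (edges_in G B X)" using excess_eq[OF assms XB] bal ex1 by simp
  then obtain C where C: "C \<subseteq> edges_in G B X" "positive_circle G C"
    using unicyclic_positive_circle[OF f(1,2,6,3,4,5) _ bal] by auto
  have CB: "C \<subseteq> B" using C(1) edges_in_subset[of G B X] by blast
  obtain D where D: "\<not> neutral G D" "\<And>C. C \<subseteq> B \<Longrightarrow> sign_circuit G C \<Longrightarrow> C = D"
    using exceptional_circuit[OF assms] a by metis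
  have "C = D" using D(2)[OF CB] C(2) by (simp add: sign_circuit_def)
  then have nn: "\<not> neutral G C" using D(1) by simp
  have "with_trees G C X (edges_in G B X)"
    using balanced_unicycle_iff[OF f(1-3) C] f(5) cX by simp
  then have "nonneutral_balanced_unicycle G X (part G B X)"
    unfolding part_eq[OF assms] using C(2) nn by (auto simp: nonneutral_balanced_unicycle_def)
  moreover have "\<not> tree G X (edges_in G (edges G) X)"
  proof
    assume "tree G X (edges_in G (edges G) X)"
    then have "\<nexists>C. C \<subseteq> edges_in G (edges G) X \<and> circle G C" by (simp add: tree_def forest_def)
    moreover have "C \<subseteq> edges_in G (edges G) X"
      using C(1) edges_in_mono[OF assms subset_refl, of G X] by blast
    ultimately show False using C(2) by (auto simp: positive_circle_def)
  qed
  moreover have "comp_conditions G B {X}"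
  proof (rule comp_conditionsI[OF assms P])
    fix X' Y assume Y: "X' \<in> comps G - {X}" "Y \<in> components G (verts G) B" "Y \<subseteq> X'"
    obtain y where y: "y \<in> Y" using component_nonempty[OF Y(2)] by blast
    have "Y \<noteq> X" using component_unique[of X' G "verts G" "edges G" X y] Y(1,3) Xc y by blast
    then show "excess G B Y = 0" using ex(2) a Y(2) by blast
  qed
  ultimately show "type_II_balanced G B"
    using a XE unfolding type_II_balanced_def balanced_comp_iff by blast
qed

text \<open>An unbalanced component of excess 1 is connected with one edge more than vertices, which
  by \<open>theta_or_handcuff_with_trees_iff\<close> is the required shape. That it contains exactly
  one sign circuit, and that this one is not neutral, follows from nullity 1 and the failure of
  hyperbalance.\<close>

lemma type_II_unbalanced_iff:
  assumes "B \<subseteq> edges G"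
  shows "type_II_unbalanced G B \<longleftrightarrow> exceptional B \<and> no_loose_edges G B \<and>
    (\<exists>Y\<in>components G (verts G) B - balanced_parts G B. excess G B Y \<noteq> 0)"
proof
  assume "type_II_unbalanced G B"
  then obtain X where nl: "no_loose_edges G B" and X: "X \<in> comps G" "X \<notin> balanced_parts G (edges G)"
    "union_with_nonneutral_exception G X (edges_in G B X)" and cc: "comp_conditions G B {X}"
    unfolding type_II_unbalanced_def unbalanced_comp_iff part_eq[OF assms] by blast
  obtain Y0 where Y0: "Y0 \<in> components G (verts G) B" "Y0 \<subseteq> X"
    "nonneutral_theta_or_handcuff G Y0 (edges_in G B Y0)"
    "\<And>Y. Y \<in> components G (verts G) B \<Longrightarrow> Y \<subseteq> X \<Longrightarrow> Y \<noteq> Y0 \<Longrightarrow> unbalanced_unicycle G Y (edges_in G B Y)"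
    using X(3) edges_in_within[of _ X B]
    unfolding union_with_nonneutral_exception_def components_within[OF assms X(1)] by fastforce
  note f = component_facts[OF assms Y0(1)]
  have Y0': "card (edges_in G B Y0) = Suc (card Y0)" "\<not> sign_balanced G (edges_in G B Y0)"
    using Y0(3) theta_or_handcuff_with_trees_iff[OF f(1-4)]
    unfolding nonneutral_theta_or_handcuff_def by blast+
  obtain C where "{C'. C' \<subseteq> edges_in G B Y0 \<and> sign_circuit G C'} = {C}" "\<not> neutral G C"
    using Y0(3) unfolding nonneutral_theta_or_handcuff_def by blast
  then have C: "C \<subseteq> edges_in G B Y0" "sign_circuit G C" "\<not> neutral G C" by blast+
  have ex1: "excess G B Y0 = 1" using excess_eq[OF assms Y0(1)] Y0' by simp
  have unb0: "Y0 \<notin> balanced_parts G B" using Y0'(2) by (simp add: balanced_parts_def)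
  have others: "Y \<notin> balanced_parts G B \<and> excess G B Y = 0"
    if "Y \<in> components G (verts G) B" "Y \<subseteq> X" "Y \<noteq> Y0" for Y
    using Y0(4)[OF that] unicycle_component_iff[OF assms that(1)] by blast
  have P: "balanced_parts G B = balanced_parts G (edges G)"
    by (rule comp_conditions_balanced_parts[OF assms cc]) (use X(2) others unb0 in auto)
  have "excess G B Y = 0" if Y: "Y \<in> components G (verts G) B" "Y \<noteq> Y0" for Y
  proof -
    obtain X' where X': "X' \<in> comps G" "Y \<subseteq> X'" using component_container[OF assms Y(1)] .
    show ?thesis
      using others[OF Y(1) _ Y(2)] comp_conditions_excess[OF assms cc _ Y(1) X'(2)] X' by blast
  qed
  then have "nullity G B = 1" by (rule nullity_single_excess[OF assms nl Y0(1) ex1])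
  moreover have "C \<subseteq> B" using C(1) edges_in_subset[of G B Y0] by blast
  then have "\<not> hyperbalanced G B" using C(2,3) unfolding hyperbalanced_def by blast
  ultimately have "exceptional B" using P by (simp add: exceptional_def)
  moreover have "excess G B Y0 \<noteq> 0" using ex1 by simp
  ultimately show "exceptional B \<and> no_loose_edges G B \<and>
    (\<exists>Y\<in>components G (verts G) B - balanced_parts G B. excess G B Y \<noteq> 0)"
    using nl unb0 Y0(1) by blast
next
  assume a: "exceptional B \<and> no_loose_edges G B \<and>
    (\<exists>Y\<in>components G (verts G) B - balanced_parts G B. excess G B Y \<noteq> 0)"
  then obtain Y0 where Y0: "Y0 \<in> components G (verts G) B" "Y0 \<notin> balanced_parts G B" "excess G B Y0 \<noteq> 0"
    by blast
  have P: "balanced_parts G B = balanced_parts G (edges G)" using a by (simp add: exceptional_def)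
  obtain X where X: "X \<in> comps G" "Y0 \<subseteq> X" using component_container[OF assms Y0(1)] .
  have XE: "X \<notin> balanced_parts G (edges G)"
    using unbalanced_comp_parts(1)[OF assms P X(1) Y0(1) X(2)] Y0(2) by blast
  have unb: "\<not> sign_balanced G (edges_in G B Y0)" using Y0(1,2) by (simp add: balanced_parts_def)
  note ex = exceptional_excess[OF _ Y0(1,3)]
  have ex1: "excess G B Y0 = 1" using ex(1) a by blast
  note f = component_facts[OF assms Y0(1)]
  have card: "card (edges_in G B Y0) = Suc (card Y0)" using excess_eq[OF assms Y0(1)] unb ex1 by simp
  obtain D where D: "\<not> neutral G D" "\<And>C. C \<subseteq> B \<Longrightarrow> sign_circuit G C \<Longrightarrow> C = D"
    using exceptional_circuit[OF assms] a by metis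
  obtain F where F: "F \<subseteq> edges_in G B Y0" "negative_figure G F"
    using not_sign_balanced_iff[OF f(1)] unb by blast
  obtain C where C: "C \<subseteq> edges_in G B Y0" "sign_circuit G C"
    using bicyclic_sign_circuit[OF f(1-5) _ F(2,1)] card by auto
  have sub: "edges_in G B Y0 \<subseteq> B" by (rule edges_in_subset)
  have CD: "C = D" using D(2)[OF _ C(2)] C(1) sub by blast
  have "{C'. C' \<subseteq> edges_in G B Y0 \<and> sign_circuit G C'} = {D}"
  proof
    show "{C'. C' \<subseteq> edges_in G B Y0 \<and> sign_circuit G C'} \<subseteq> {D}" using D(2) sub by blast
    show "{D} \<subseteq> {C'. C' \<subseteq> edges_in G B Y0 \<and> sign_circuit G C'}" using C CD by simp
  qed
  then have "nonneutral_theta_or_handcuff G Y0 (edges_in G B Y0)"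
    using theta_or_handcuff_with_trees_iff[OF f(1-4)] f(5) card unb D(1)
    unfolding nonneutral_theta_or_handcuff_def by blast
  moreover have "unbalanced_unicycle G Y (edges_in G B Y)"
    if Y: "Y \<in> components G (verts G) B" "Y \<subseteq> X" "Y \<noteq> Y0" for Y
    using unicycle_component_iff[OF assms Y(1)] ex(2)[OF _ Y(1,3)] a
      unbalanced_comp_parts(1)[OF assms P X(1) Y(1,2)] XE by blast
  ultimately have "union_with_nonneutral_exception G X (part G B X)"
    unfolding union_with_nonneutral_exception_def part_eq[OF assms] components_within[OF assms X(1)]
    using Y0(1) X(2) edges_in_within[of _ X B] by (intro bexI[of _ Y0]) auto
  moreover have "comp_conditions G B {X}"
  proof (rule comp_conditionsI[OF assms P])
    fix X' Y assume Y: "X' \<in> comps G - {X}" "Y \<in> components G (verts G) B" "Y \<subseteq> X'"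
    obtain y where y: "y \<in> Y" using component_nonempty[OF Y(2)] by blast
    have "Y \<noteq> Y0" using component_unique[of X' G "verts G" "edges G" X y] Y(1,3) X y by blast
    then show "excess G B Y = 0" using ex(2) a Y(2) by blast
  qed
  ultimately show "type_II_unbalanced G B"
    using a X(1) XE unfolding type_II_unbalanced_def unbalanced_comp_iff by blast
qed

text \<open>A sum of natural numbers equal to 1 has exactly one nonzero term: the count of loose
  edges or the excess of a single component, which is either balanced or not.\<close>

lemma exactly_one_type_II_iff:
  assumes "B \<subseteq> edges G"
  shows "exactly_one (type_II_loose G B) (type_II_balanced G B) (type_II_unbalanced G B) \<longleftrightarrow> exceptional B"
proof -
  have "\<exists>Y\<in>components G (verts G) B. excess G B Y \<noteq> 0" if "exceptional B" "no_loose_edges G B"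
  proof (rule ccontr)
    assume "\<not> ?thesis"
    then have "nullity G B = 0"
      using no_loose_card[OF assms] that(2) unfolding nullity_def by simp
    then show False using that(1) by (simp add: exceptional_def)
  qed
  moreover have "Y = Y'" if "exceptional B" "Y \<in> components G (verts G) B" "excess G B Y \<noteq> 0"
    "Y' \<in> components G (verts G) B" "excess G B Y' \<noteq> 0" for Y Y'
    using exceptional_excess(2)[OF that(1-3), of Y'] that(4,5) by blast
  moreover have "balanced_parts G B \<subseteq> components G (verts G) B" by (auto simp: balanced_parts_def)
  ultimately show ?thesis
    unfolding exactly_one_def type_II_loose_iff[OF assms] type_II_balanced_iff[OF assms]
      type_II_unbalanced_iff[OF assms] by blast
qed

end

theorem theorem7p5:
  fixes G :: "('v, 'e, 'k::field) gsgraph" and B :: "'e set"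
  assumes "CHAR('k) \<noteq> 2"
    and "gain_signed_graph G"
    and "B \<subseteq> edges G"
  shows "rank_basis (edges G) (gs_rank G) B \<longleftrightarrow>
    (if hyperbalanced G (edges G) then type_I G B
     else exactly_one (type_II_loose G B) (type_II_balanced G B) (type_II_unbalanced G B))"
proof -
  have "(2::'k) \<noteq> 0"
  proof
    assume "(2::'k) = 0"
    then have "of_nat 2 = (0::'k)" by simp
    then have "CHAR('k) dvd 2" by (simp only: of_nat_eq_0_iff_char_dvd)
    moreover from this have "CHAR('k) \<le> 2" by (rule dvd_imp_le) simp
    \<comment> \<open>The characteristic 1 would mean \<open>1 = 0\<close>, so a characteristic
      dividing 2 must be 2.\<close>
    moreover have "CHAR('k) \<noteq> 1" using of_nat_CHAR[where 'a='k] by auto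
    ultimately show False using assms(1) by (cases "CHAR('k) = 0") auto
  qed
  then interpret gain_signed_char G
    using assms(2) by unfold_locales
  \<comment> \<open>Equal numbers mean equal sets here because \<open>B\<close> is a subset of the
    edge set: \<open>rank_basis_iff\<close> counts balanced components, whereas the shapes refer to
    the components themselves.\<close>
  have b: "num_balanced G B = num_balanced G (edges G) \<longleftrightarrow> balanced_parts G B = balanced_parts G (edges G)"
    using balanced_parts_mono(2)[OF assms(3) subset_refl] by (auto simp: num_balanced_card)
  show ?thesis
  proof (cases "hyperbalanced G (edges G)")
    case True
    then have "hyperbalanced G B" using hyperbalanced_mono assms(3) by blast
    then show ?thesis
      using True rank_basis_iff[OF assms(3)] b type_I_iff[OF assms(3)] by (auto simp: defect_def)
  next
    case False
    then show ?thesis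
      using rank_basis_iff[OF assms(3)] b exactly_one_type_II_iff[OF assms(3)]
      by (auto simp: defect_def exceptional_def)
  qed
qed

end
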